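(* Let $\mu\in\mathbb{Z}^r$ be dominant ($\mu_1\ge\dots\ge\mu_r$). Let $\lambda\in A^{(n)}$ and $w^{(n)}\in W^{(n)}_{\mathrm{Cox}}$ be the unique pair with $w^{(n)}\lambda=\mu$ and $w^{(n)}$ of minimal length; write a reduced expression $w^{(n)}=s^{(n)}_{i_1}\cdots s^{(n)}_{i_\ell}$, $\vec w=(i_1,\dots,i_\ell)$, and $\beta_j^{(n)}=s^{(n)}_{i_\ell}*\cdots*s^{(n)}_{i_{j+1}}*\alpha^{(n)}_{i_j}$. For an alcove walk $p$ choose a reduced expression $\phi(p)=s_{u_{p,1}}\cdots s_{u_{p,t}}$ and put \[c(p)=\Big(\prod_{a=1}^{t}\sigma\big((\lambda,s_{u_{p,t}}\cdots s_{u_{p,a+1}}\alpha_{u_{p,a}})\big)\Big)\Big(\prod_{j\in f^+(p)}\frac{k^{-1}-k}{1-\gamma(-\beta^{(n)}_j;\lambda)}\Big)\Big(\prod_{j\in f^-(p)}\frac{(k^{-1}-k)\gamma(-\beta_j^{(n)};\lambda)}{1-\gamma(-\beta^{(n)}_j;\lambda)}\Big).\] Then $P^{(n)}_\mu$ is a nonzero scalar multiple of \[\sum_{u\in S_r}k^{\ell(u)}\sum_{p\in\mathcal{B}(u,\vec w)}c(p)\,x^{n\,\mathrm{wt}(p)+\phi(p)\lambda}.\]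
   Context: Fix integers $r\ge2$, $n\ge1$. Notation: $\epsilon_i$ standard basis of $\mathbb{R}^r$, $(\cdot,\cdot)$ standard inner product, $\Phi=\{\epsilon_i-\epsilon_j:i\ne j\}$, $\Phi_+=\{\epsilon_i-\epsilon_j:i<j\}$, $\alpha_i=\epsilon_i-\epsilon_{i+1}$, $\theta=\epsilon_1-\epsilon_r$, $Q=\mathbb{Z}\Phi$; $S_r$ permutes coordinates, $s_i=(i\ i+1)$, $s_\theta$ swaps coordinates $1,r$, $\ell$ = Coxeter length. $\delta$ formal, $P_a^{(n)}=n\mathbb{Z}^r\oplus n^2\mathbb{Z}\delta$. Groups: $W_{\mathrm{Cox}}=Q\rtimes S_r$ and $W^{(n)}_{\mathrm{Cox}}=nQ\rtimes S_r$ acting on $\mathbb{R}^r$ by affine maps ($\tau(\beta)$ = translation); $W_{\mathrm{Cox}}$ is Coxeter with generators $s_1,\dots,s_{r-1},s_0=\tau(\theta)s_\theta$, $W^{(n)}_{\mathrm{Cox}}$ with $s_i^{(n)}=s_i$ and $s_0^{(n)}=\tau(n\theta)s_\theta$ ($s_0^{(n)}(v)=(v_r+n,v_2,\dots,v_{r-1},v_1-n)$). Linear action: $s_i*(\mu+s\delta)=s_i\mu+s\delta$, $s_0^{(n)}*(\mu+s\delta)=s_\theta\mu+(s+n(\mu,\theta))\delta$. $\alpha_i^{(n)}=n\alpha_i$ ($1\le i\le r-1$), $\alpha_0^{(n)}=-n\theta+n^2\delta$. $A^{(n)}=\{\lambda\in\mathbb{Z}^r:\lambda_1\ge\dots\ge\lambda_r,\lambda_1-\lambda_r\le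 n\}$. Alcove walks: hyperplanes $\{v:(\alpha,v)+s=0\}$ ($\alpha\in\Phi_+,s\in\mathbb{Z}$) cut $\mathbb{R}^r$ into alcoves; $\mathcal{A}=\{v:v_1>\dots>v_r,v_1-v_r<1\}$; $u\mapsto u\mathcal{A}$ identifies $W_{\mathrm{Cox}}$ with alcoves. $v$ is on the positive side of $\{(\alpha,v)+s=0\}$ ($\alpha\in\Phi_+$) if $(\alpha,v)+s>0$. An alcove walk of type $\vec w=(i_1,\dots,i_\ell)$ starting at $u\in W_{\mathrm{Cox}}$ is $p=(A_0,\dots,A_\ell)$, $A_0=u$, $A_j\in\{A_{j-1},A_{j-1}s_{i_j}\}$. Fold at $j$ if $A_j=A_{j-1}$; positive if $A_{j-1}$ lies on the positive side of the hyperplane separating $A_{j-1}$ and $A_{j-1}s_{i_j}$, negative otherwise; $f^\pm(p)$ the sets of positive/negative fold steps. $\mathcal{B}(u,\vec w)$ = set of such walks. $A_\ell=\tau(\mathrm{wt}(p))\phi(p)$ with $\mathrm{wt}(p)\in Q$, $\phi(p)\in S_r$. Parameters: $k$, $G_j$ with $G_0=k$, $G_jG_{-j}=1$, $G_j$ depending only on $j$ mod $n$ ($G_{n/2}=\pm1$ fixed if $n$ even); $k,q,G_1,\dots,G_{\lfloor(n-1)/2\rfloor}$ independent indeterminates, $\mathbb{F}^{(n)}=\mathbb{C}(k,G_1,\dots,G_{\lfloor(n-1)/2\rfloor},q)$. $\sigma(a)=k^{-1}$ if $a\in n\mathbb{Z}_{>0}$, else $G_a$. $\gamma(\mu+sn^2\delta;\lambda)=q^{-sn-(\mu,\lambda)/n}\prod_{\alpha\in\Phi_+}\sigma((\lambda,\alpha))^{(\mu,\alpha)/n}$.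 On $\mathbb{F}^{(n)}[x^{\pm1}]$ ($x^\mu=\prod x_i^{\mu_i}$), with $t_n(j)=j-r_n(j)$, $r_n(j)\in\{0,\dots,n-1\}$ the residue mod $n$: $T_ix^\lambda=(k-k^{-1})\frac{1-x^{-t_n((\lambda,\alpha_i))\alpha_i}}{1-x^{n\alpha_i}}x^\lambda+G_{(\lambda,\alpha_i)}x^{s_i\lambda}$ ($1\le i\le r-1$, invertible), $\omega x^\lambda=q^{-\lambda_r}x^{(\lambda_r,\lambda_1,\dots,\lambda_{r-1})}$, $Y_i=T_{i-1}^{-1}\cdots T_1^{-1}\omega T_{r-1}\cdots T_i$. $E^{(n)}_\mu$ is the unique Laurent polynomial with coefficient $1$ at $x^\mu$ and $Y_iE^{(n)}_\mu=\gamma(n\epsilon_i;\mu)E^{(n)}_\mu$ for all $i$. $T_u=T_{j_1}\cdots T_{j_m}$ for a reduced word $u=s_{j_1}\cdots s_{j_m}$; $P^{(n)}_\mu=\sum_{u\in S_r}k^{\ell(u)}T_uE^{(n)}_\mu$. *)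

theory Defs
  imports
    Complex_Main
    "HOL-Library.Poly_Mapping"
    "HOL-Library.Product_Plus"
    "HOL-Combinatorics.Permutations"
begin

abbreviation lookup :: "('a \<Rightarrow>\<^sub>0 'b::zero) \<Rightarrow> 'a \<Rightarrow> 'b" where
  "lookup \<equiv> Poly_Mapping.lookup"

abbreviation keys :: "('a \<Rightarrow>\<^sub>0 'b::zero) \<Rightarrow> 'a set" where
  "keys \<equiv> Poly_Mapping.keys"

text \<open>
  Vectors with coordinates \<open>1, \<dots>, r\<close> are finitely supported functions on \<^typ>\<open>nat\<close> whose
  support lies in \<open>{1..r}\<close>; the coordinate type is \<^typ>\<open>int\<close> for lattice vectors and \<^typ>\<open>real\<close>
  for points of Euclidean space.  Laurent polynomials in \<open>x\<^sub>1, \<dots>, x\<^sub>r\<close> are elements of the group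
  ring \<open>(nat \<Rightarrow>\<^sub>0 int) \<Rightarrow>\<^sub>0 'f\<close> all of whose exponents are such lattice vectors.
\<close>

definition poly_val ::
    "(complex \<Rightarrow> 'f::field) \<Rightarrow> 'f list \<Rightarrow> ((nat \<Rightarrow>\<^sub>0 nat) \<Rightarrow>\<^sub>0 complex) \<Rightarrow> 'f" where
  "poly_val \<iota> xs P =
     (\<Sum>m\<in>keys P. \<iota> (lookup P m) * (\<Prod>i\<in>keys m. (xs ! i) ^ lookup m i))"

text \<open>The whole type \<open>'f\<close> is a field of rational functions over the complex numbers in the
  independent indeterminates \<open>xs\<close>: \<open>\<iota>\<close> embeds the complex numbers, the elements of \<open>xs\<close> are
  algebraically independent over the image of \<open>\<iota>\<close>, and together they generate \<open>'f\<close> as a field.\<close>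

definition rational_function_field :: "'f::field list \<Rightarrow> bool" where
  "rational_function_field xs \<longleftrightarrow>
     (\<exists>\<iota> :: complex \<Rightarrow> 'f.
        \<iota> 1 = 1 \<and> (\<forall>a b. \<iota> (a + b) = \<iota> a + \<iota> b) \<and> (\<forall>a b. \<iota> (a * b) = \<iota> a * \<iota> b) \<and>
        (let Pols = {P. \<forall>m\<in>keys P. keys m \<subseteq> {..<length xs}} in
           (\<forall>P\<in>Pols. P \<noteq> 0 \<longrightarrow> poly_val \<iota> xs P \<noteq> 0) \<and>
           (\<forall>f. \<exists>P\<in>Pols. \<exists>Q\<in>Pols. Q \<noteq> 0 \<and> f = poly_val \<iota> xs P / poly_val \<iota> xs Q)))"

text \<open>The relation \<open>G j * G (- j) = 1\<close> is imposed only for \<open>j\<close> not divisible by \<open>n\<close>: since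
  \<open>G 0 = k\<close>, it would otherwise force \<open>k\<^sup>2 = 1\<close>.\<close>

definition metaplectic_parameters ::
    "nat \<Rightarrow> 'f::field \<Rightarrow> 'f \<Rightarrow> (int \<Rightarrow> 'f) \<Rightarrow> bool" where
  "metaplectic_parameters n k q G \<longleftrightarrow>
     rational_function_field (k # q # map (\<lambda>j. G (int j)) [1..<Suc ((n - 1) div 2)]) \<and>
     G 0 = k \<and>
     (\<forall>j. \<not> int n dvd j \<longrightarrow> G j * G (- j) = 1) \<and>
     (\<forall>i j. i mod int n = j mod int n \<longrightarrow> G i = G j) \<and>
     (even n \<longrightarrow> G (int n div 2) \<in> {1, - 1})"

definition vectors :: "nat \<Rightarrow> (nat \<Rightarrow>\<^sub>0 'a::zero) set" where
  "vectors r = {v. keys v \<subseteq> {1..r}}"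

definition scale :: "'a::semiring_0 \<Rightarrow> ('b \<Rightarrow>\<^sub>0 'a) \<Rightarrow> ('b \<Rightarrow>\<^sub>0 'a)" where
  "scale c v = Poly_Mapping.map ((*) c) v"

definition ip :: "nat \<Rightarrow> (nat \<Rightarrow>\<^sub>0 'a::comm_ring_1) \<Rightarrow> (nat \<Rightarrow>\<^sub>0 'a) \<Rightarrow> 'a" where
  "ip r u v = (\<Sum>i=1..r. lookup u i * lookup v i)"

definition eps :: "nat \<Rightarrow> (nat \<Rightarrow>\<^sub>0 'a::ring_1)" where
  "eps i = Poly_Mapping.single i 1"

definition roots :: "nat \<Rightarrow> (nat \<Rightarrow>\<^sub>0 'a::ring_1) set" where
  "roots r = {eps i - eps j | i j. i \<in> {1..r} \<and> j \<in> {1..r} \<and> i \<noteq> j}"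

definition pos_roots :: "nat \<Rightarrow> (nat \<Rightarrow>\<^sub>0 'a::ring_1) set" where
  "pos_roots r = {eps i - eps j | i j. i \<in> {1..r} \<and> j \<in> {1..r} \<and> i < j}"

definition simple_root :: "nat \<Rightarrow> (nat \<Rightarrow>\<^sub>0 'a::ring_1)" where
  "simple_root i = eps i - eps (i + 1)"

definition highest_root :: "nat \<Rightarrow> (nat \<Rightarrow>\<^sub>0 'a::ring_1)" where
  "highest_root r = eps 1 - eps r"

definition root_lattice :: "nat \<Rightarrow> (nat \<Rightarrow>\<^sub>0 int) set" where
  "root_lattice r = {(\<Sum>\<alpha>\<in>roots r. scale (c \<alpha>) \<alpha>) | c. True}"

text \<open>Coordinate \<open>j\<close> of \<open>w v\<close> is coordinate \<open>w\<^sup>-\<^sup>1 j\<close> of \<open>v\<close>, so that \<open>w (eps i) = eps (w i)\<close>.\<close>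

definition perm_act :: "(nat \<Rightarrow> nat) \<Rightarrow> (nat \<Rightarrow>\<^sub>0 'a::zero) \<Rightarrow> (nat \<Rightarrow>\<^sub>0 'a)" where
  "perm_act w v = Poly_Mapping.map_key (inv w) v"

abbreviation sym_group :: "nat \<Rightarrow> (nat \<Rightarrow> nat) set" where
  "sym_group r \<equiv> {w. w permutes {1..r}}"

definition simple_refl :: "nat \<Rightarrow> (nat \<Rightarrow> nat)" where
  "simple_refl i = transpose i (i + 1)"

definition dominant :: "nat \<Rightarrow> (nat \<Rightarrow>\<^sub>0 int) \<Rightarrow> bool" where
  "dominant r v \<longleftrightarrow> (\<forall>i\<in>{1..<r}. lookup v i \<ge> lookup v (i + 1))"

definition alcove_weights :: "nat \<Rightarrow> nat \<Rightarrow> (nat \<Rightarrow>\<^sub>0 int) set" where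
  "alcove_weights r n =
     {v \<in> vectors r. dominant r v \<and> lookup v 1 - lookup v r \<le> int n}"

text \<open>\<open>ev\<close> evaluates a word in the generators indexed by \<open>I\<close>.\<close>

definition cox_length :: "(nat list \<Rightarrow> 'g) \<Rightarrow> nat set \<Rightarrow> 'g \<Rightarrow> nat" where
  "cox_length ev I g = (LEAST m. \<exists>ws. set ws \<subseteq> I \<and> ev ws = g \<and> length ws = m)"

definition reduced_word :: "(nat list \<Rightarrow> 'g) \<Rightarrow> nat set \<Rightarrow> 'g \<Rightarrow> nat list \<Rightarrow> bool" where
  "reduced_word ev I g ws \<longleftrightarrow>
     set ws \<subseteq> I \<and> ev ws = g \<and> length ws = cox_length ev I g"

definition sym_word :: "nat list \<Rightarrow> (nat \<Rightarrow> nat)" where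
  "sym_word ws = foldr (\<lambda>i w. simple_refl i \<circ> w) ws id"

definition sym_length :: "nat \<Rightarrow> (nat \<Rightarrow> nat) \<Rightarrow> nat" where
  "sym_length r w = cox_length sym_word {1..<r} w"

definition sym_reduced :: "nat \<Rightarrow> (nat \<Rightarrow> nat) \<Rightarrow> nat list \<Rightarrow> bool" where
  "sym_reduced r w ws \<longleftrightarrow> reduced_word sym_word {1..<r} w ws"

text \<open>The pair \<open>(\<beta>, w)\<close> stands for \<open>\<tau>(\<beta>) w\<close> in the semidirect product of \<open>n Q\<close> and the
  symmetric group.\<close>

type_synonym aff = "(nat \<Rightarrow>\<^sub>0 int) \<times> (nat \<Rightarrow> nat)"

definition aff_group :: "nat \<Rightarrow> nat \<Rightarrow> aff set" where
  "aff_group r n = (scale (int n) ` root_lattice r) \<times> sym_group r"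

definition aff_mult :: "aff \<Rightarrow> aff \<Rightarrow> aff" where
  "aff_mult g h = (fst g + perm_act (snd g) (fst h), snd g \<circ> snd h)"

definition aff_gen :: "nat \<Rightarrow> nat \<Rightarrow> nat \<Rightarrow> aff" where
  "aff_gen r n i =
     (if i = 0 then (scale (int n) (highest_root r), transpose 1 r) else (0, simple_refl i))"

definition aff_act :: "aff \<Rightarrow> (nat \<Rightarrow>\<^sub>0 'a::ring_1) \<Rightarrow> (nat \<Rightarrow>\<^sub>0 'a)" where
  "aff_act g v = perm_act (snd g) v + Poly_Mapping.map of_int (fst g)"

definition aff_word :: "nat \<Rightarrow> nat \<Rightarrow> nat list \<Rightarrow> aff" where
  "aff_word r n ws = foldr (\<lambda>i g. aff_mult (aff_gen r n i) g) ws (0, id)"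

definition aff_length :: "nat \<Rightarrow> nat \<Rightarrow> aff \<Rightarrow> nat" where
  "aff_length r n g = cox_length (aff_word r n) {0..<r} g"

definition aff_reduced :: "nat \<Rightarrow> nat \<Rightarrow> aff \<Rightarrow> nat list \<Rightarrow> bool" where
  "aff_reduced r n g ws \<longleftrightarrow> reduced_word (aff_word r n) {0..<r} g ws"

text \<open>The pair \<open>(\<mu>, s)\<close> stands for \<open>\<mu> + s \<delta>\<close>.\<close>

definition lin_gen ::
    "nat \<Rightarrow> nat \<Rightarrow> nat \<Rightarrow> (nat \<Rightarrow>\<^sub>0 int) \<times> int \<Rightarrow> (nat \<Rightarrow>\<^sub>0 int) \<times> int" where
  "lin_gen r n i b =
     (if i = 0
      then (perm_act (transpose 1 r) (fst b), snd b + int n * ip r (fst b) (highest_root r))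
      else (perm_act (simple_refl i) (fst b), snd b))"

definition aff_root :: "nat \<Rightarrow> nat \<Rightarrow> nat \<Rightarrow> (nat \<Rightarrow>\<^sub>0 int) \<times> int" where
  "aff_root r n i =
     (if i = 0 then (- scale (int n) (highest_root r), (int n)\<^sup>2)
      else (scale (int n) (simple_root i), 0))"

text \<open>Steps are numbered from \<open>1\<close>, so that \<open>i\<^sub>j\<close> is \<open>ws ! (j - 1)\<close> and \<open>drop j ws\<close> is
  \<open>(i\<^sub>j\<^sub>+\<^sub>1, \<dots>, i\<^sub>\<ell>)\<close>; \<open>fold\<close> applies the generator of the head of the list first.\<close>

definition beta :: "nat \<Rightarrow> nat \<Rightarrow> nat list \<Rightarrow> nat \<Rightarrow> (nat \<Rightarrow>\<^sub>0 int) \<times> int" where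
  "beta r n ws j = fold (lin_gen r n) (drop j ws) (aff_root r n (ws ! (j - 1)))"

definition fund_alcove :: "nat \<Rightarrow> (nat \<Rightarrow>\<^sub>0 real) set" where
  "fund_alcove r =
     {v \<in> vectors r. (\<forall>i\<in>{1..<r}. lookup v i > lookup v (i + 1)) \<and> lookup v 1 - lookup v r < 1}"

definition alcove :: "nat \<Rightarrow> aff \<Rightarrow> (nat \<Rightarrow>\<^sub>0 real) set" where
  "alcove r u = aff_act u ` fund_alcove r"

definition pos_side :: "nat \<Rightarrow> (nat \<Rightarrow>\<^sub>0 real) \<Rightarrow> int \<Rightarrow> (nat \<Rightarrow>\<^sub>0 real) set" where
  "pos_side r \<alpha> s = {v \<in> vectors r. ip r \<alpha> v + of_int s > 0}"

definition neg_side :: "nat \<Rightarrow> (nat \<Rightarrow>\<^sub>0 real) \<Rightarrow> int \<Rightarrow> (nat \<Rightarrow>\<^sub>0 real) set" where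
  "neg_side r \<alpha> s = {v \<in> vectors r. ip r \<alpha> v + of_int s < 0}"

definition separates ::
    "nat \<Rightarrow> (nat \<Rightarrow>\<^sub>0 real) \<Rightarrow> int \<Rightarrow> (nat \<Rightarrow>\<^sub>0 real) set \<Rightarrow> (nat \<Rightarrow>\<^sub>0 real) set \<Rightarrow> bool" where
  "separates r \<alpha> s A B \<longleftrightarrow>
     A \<subseteq> pos_side r \<alpha> s \<and> B \<subseteq> neg_side r \<alpha> s \<or> A \<subseteq> neg_side r \<alpha> s \<and> B \<subseteq> pos_side r \<alpha> s"

definition walks :: "nat \<Rightarrow> aff \<Rightarrow> nat list \<Rightarrow> aff list set" where
  "walks r u ws =
     {p. length p = Suc (length ws) \<and> p ! 0 = u \<and>
         (\<forall>j\<in>{1..length ws}.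
            p ! j \<in> {p ! (j - 1), aff_mult (p ! (j - 1)) (aff_gen r 1 (ws ! (j - 1)))})}"

definition folds :: "nat list \<Rightarrow> aff list \<Rightarrow> nat set" where
  "folds ws p = {j \<in> {1..length ws}. p ! j = p ! (j - 1)}"

definition pos_folds :: "nat \<Rightarrow> nat list \<Rightarrow> aff list \<Rightarrow> nat set" where
  "pos_folds r ws p =
     {j \<in> folds ws p.
        \<exists>\<alpha>\<in>pos_roots r. \<exists>s.
          separates r \<alpha> s (alcove r (p ! (j - 1)))
            (alcove r (aff_mult (p ! (j - 1)) (aff_gen r 1 (ws ! (j - 1))))) \<and>
          alcove r (p ! (j - 1)) \<subseteq> pos_side r \<alpha> s}"

definition neg_folds :: "nat \<Rightarrow> nat list \<Rightarrow> aff list \<Rightarrow> nat set" where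
  "neg_folds r ws p = folds ws p - pos_folds r ws p"

definition wt :: "aff list \<Rightarrow> (nat \<Rightarrow>\<^sub>0 int)" where
  "wt p = fst (last p)"

definition final_dir :: "aff list \<Rightarrow> (nat \<Rightarrow> nat)" where
  "final_dir p = snd (last p)"

definition sigma :: "nat \<Rightarrow> 'f::field \<Rightarrow> (int \<Rightarrow> 'f) \<Rightarrow> int \<Rightarrow> 'f" where
  "sigma n k G a = (if a > 0 \<and> int n dvd a then inverse k else G a)"

text \<open>Intended for arguments \<open>b = (\<mu>, s n\<^sup>2)\<close> with \<open>\<mu>\<close> in \<open>n\<close> times the weight lattice; all the
  divisions below are then exact, and \<open>snd b div n\<^sup>2\<close> is \<open>s\<close>.\<close>

definition gamma ::
    "nat \<Rightarrow> nat \<Rightarrow> 'f::field \<Rightarrow> 'f \<Rightarrow> (int \<Rightarrow> 'f) \<Rightarrow>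
     (nat \<Rightarrow>\<^sub>0 int) \<times> int \<Rightarrow> (nat \<Rightarrow>\<^sub>0 int) \<Rightarrow> 'f" where
  "gamma r n k q G b v =
     q powi (- (snd b div (int n)\<^sup>2) * int n - ip r (fst b) v div int n) *
     (\<Prod>\<alpha>\<in>pos_roots r. sigma n k G (ip r v \<alpha>) powi (ip r (fst b) \<alpha> div int n))"

type_synonym 'f laurent = "(nat \<Rightarrow>\<^sub>0 int) \<Rightarrow>\<^sub>0 'f"

definition laurent_polys :: "nat \<Rightarrow> 'f::field laurent set" where
  "laurent_polys r = {f. keys f \<subseteq> vectors r}"

definition xpow :: "(nat \<Rightarrow>\<^sub>0 int) \<Rightarrow> 'f::field laurent" where
  "xpow v = Poly_Mapping.single v 1"

definition lin_ext ::
    "((nat \<Rightarrow>\<^sub>0 int) \<Rightarrow> 'f::field laurent) \<Rightarrow> 'f laurent \<Rightarrow> 'f laurent" where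
  "lin_ext F f = (\<Sum>v\<in>keys f. scale (lookup f v) (F v))"

text \<open>The quotient of Laurent polynomials, when the division is exact (the ring is a domain).\<close>

definition laurent_quot :: "'f::field laurent \<Rightarrow> 'f laurent \<Rightarrow> 'f laurent" where
  "laurent_quot f g = (THE h. h * g = f)"

definition tn :: "nat \<Rightarrow> int \<Rightarrow> int" where
  "tn n j = j - j mod int n"

definition T_op ::
    "nat \<Rightarrow> nat \<Rightarrow> 'f::field \<Rightarrow> (int \<Rightarrow> 'f) \<Rightarrow> nat \<Rightarrow> 'f laurent \<Rightarrow> 'f laurent" where
  "T_op r n k G i =
     lin_ext (\<lambda>v.
       scale (k - inverse k)
         (laurent_quot (1 - xpow (scale (- tn n (ip r v (simple_root i))) (simple_root i)))
            (1 - xpow (scale (int n) (simple_root i))) * xpow v) +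
       scale (G (ip r v (simple_root i))) (xpow (perm_act (simple_refl i) v)))"

definition T_inv ::
    "nat \<Rightarrow> nat \<Rightarrow> 'f::field \<Rightarrow> (int \<Rightarrow> 'f) \<Rightarrow> nat \<Rightarrow> 'f laurent \<Rightarrow> 'f laurent" where
  "T_inv r n k G i = inv_into (laurent_polys r) (T_op r n k G i)"

text \<open>\<open>(v\<^sub>r, v\<^sub>1, \<dots>, v\<^sub>r\<^sub>-\<^sub>1)\<close>\<close>

definition rotate_vec :: "nat \<Rightarrow> (nat \<Rightarrow>\<^sub>0 int) \<Rightarrow> (nat \<Rightarrow>\<^sub>0 int)" where
  "rotate_vec r v =
     Poly_Mapping.single 1 (lookup v r) + (\<Sum>i=1..<r. Poly_Mapping.single (i + 1) (lookup v i))"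

definition omega_op :: "nat \<Rightarrow> 'f::field \<Rightarrow> 'f laurent \<Rightarrow> 'f laurent" where
  "omega_op r q = lin_ext (\<lambda>v. scale (q powi (- lookup v r)) (xpow (rotate_vec r v)))"

definition Y_op ::
    "nat \<Rightarrow> nat \<Rightarrow> 'f::field \<Rightarrow> 'f \<Rightarrow> (int \<Rightarrow> 'f) \<Rightarrow> nat \<Rightarrow> 'f laurent \<Rightarrow> 'f laurent" where
  "Y_op r n k q G i f =
     fold (T_inv r n k G) [1..<i] (omega_op r q (fold (T_op r n k G) [i..<r] f))"

definition E_poly ::
    "nat \<Rightarrow> nat \<Rightarrow> 'f::field \<Rightarrow> 'f \<Rightarrow> (int \<Rightarrow> 'f) \<Rightarrow> (nat \<Rightarrow>\<^sub>0 int) \<Rightarrow> 'f laurent" where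
  "E_poly r n k q G \<mu> =
     (THE E. E \<in> laurent_polys r \<and> lookup E \<mu> = 1 \<and>
        (\<forall>i\<in>{1..r}. Y_op r n k q G i E = scale (gamma r n k q G (scale (int n) (eps i), 0) \<mu>) E))"

definition T_perm ::
    "nat \<Rightarrow> nat \<Rightarrow> 'f::field \<Rightarrow> (int \<Rightarrow> 'f) \<Rightarrow> (nat \<Rightarrow> nat) \<Rightarrow> 'f laurent \<Rightarrow> 'f laurent" where
  "T_perm r n k G u = foldr (T_op r n k G) (SOME ws. sym_reduced r u ws)"

definition P_poly ::
    "nat \<Rightarrow> nat \<Rightarrow> 'f::field \<Rightarrow> 'f \<Rightarrow> (int \<Rightarrow> 'f) \<Rightarrow> (nat \<Rightarrow>\<^sub>0 int) \<Rightarrow> 'f laurent" where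
  "P_poly r n k q G \<mu> =
     (\<Sum>u\<in>sym_group r. scale (k ^ sym_length r u) (T_perm r n k G u (E_poly r n k q G \<mu>)))"

text \<open>\<open>us\<close> is the chosen reduced expression of the final direction of the walk \<open>p\<close>.  In the first
  product \<open>a\<close> counts from \<open>0\<close>, and \<open>fold\<close> applies \<open>s\<close> of the entry after position \<open>a\<close> first.\<close>

definition walk_coeff ::
    "nat \<Rightarrow> nat \<Rightarrow> 'f::field \<Rightarrow> 'f \<Rightarrow> (int \<Rightarrow> 'f) \<Rightarrow> (nat \<Rightarrow>\<^sub>0 int) \<Rightarrow>
     nat list \<Rightarrow> nat list \<Rightarrow> aff list \<Rightarrow> 'f" where
  "walk_coeff r n k q G lam ws us p =
     (\<Prod>a<length us. sigma n k G
        (ip r lam (fold (\<lambda>i. perm_act (simple_refl i)) (drop (Suc a) us) (simple_root (us ! a))))) *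
     (\<Prod>j\<in>pos_folds r ws p. (inverse k - k) / (1 - gamma r n k q G (- beta r n ws j) lam)) *
     (\<Prod>j\<in>neg_folds r ws p.
        (inverse k - k) * gamma r n k q G (- beta r n ws j) lam /
        (1 - gamma r n k q G (- beta r n ws j) lam))"

end

theory Submission
  imports Defs
begin

text \<open>
  The nonsymmetric polynomial \<open>E\<^sub>\<mu>\<close> is produced from \<open>x\<^sup>\<lambda>\<close>, which is a joint eigenvector of the
  \<open>Y\<^sub>i\<close> because \<open>\<lambda>\<close> lies in the closed alcove, by applying the intertwiners
  \<open>T\<^sub>i + (k\<^sup>-\<^sup>1 - k) / (1 - \<gamma>)\<close> along the reduced word.  Here \<open>T\<^sub>0 = \<pi> T\<^sub>r\<^sub>-\<^sub>1 \<pi>\<^sup>-\<^sup>1\<close> with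
  \<open>\<pi> = x\<^sub>1\<^sup>n T\<^sub>1 \<dots> T\<^sub>r\<^sub>-\<^sub>1\<close>.  Minimality of the word means that every letter moves the current weight,
  so that \<open>\<gamma>\<close> involves a nonzero power of \<open>q\<close> and the intertwiner is defined and injective on the
  eigenvector.  The \<open>Y\<^sub>i\<close> are triangular for the order by norm, refined by dominance within an orbit
  of the symmetric group, and the weights are separated by their powers of \<open>q\<close>; hence the result
  is a nonzero multiple of \<open>E\<^sub>\<mu>\<close>.  To expand, let \<open>X\<^sup>A = x\<^sup>n\<^sup>\<beta> T\<^sub>w\<close> for an alcove \<open>A = \<tau>(\<beta>) w\<close>.  Then
  \<open>X\<^sup>A T\<^sub>i\<close> (if \<open>A\<close> is on the positive side of the wall) or \<open>X\<^sup>A T\<^sub>i\<^sup>-\<^sup>1\<close> (otherwise) is \<open>X\<^sup>A\<^sup>s\<^sup>i\<close>, and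
  the remaining scalar is the weight of a positive or negative fold.
\<close>

text \<open>\<open>T_i\<close> spreads a monomial \<open>x^v\<close> over a string of exponents, and
  the proof rests on controlling the two ends of that string. Write
  \<open>a = v_i - v_(i+1)\<close>. At \<open>s_i v\<close> the coefficient is
  \<open>sigma(a)\<close>: when \<open>n\<close> divides \<open>a > 0\<close>, the last term of the
  geometric sum lands there and turns \<open>G_0 = k\<close> into
  \<open>k + (k^-1 - k) = k^-1\<close>. At \<open>v\<close> itself an extra term appears only for
  \<open>a < 0\<close>. Inside the closed alcove entries differ by at most \<open>n\<close>, which
  leaves no room for terms between the ends; this is the source of the exact formulas on
  \<open>x^lambda\<close> and of the first product in \<open>c(p)\<close>. The lopsided
  \<open>sigma\<close> satisfies \<open>sigma(a) sigma(-a) = 1\<close> except at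
  \<open>a = 0\<close>, and \<open>sigma(a) sigma(2n - a) = 1\<close> except at
  \<open>a = n\<close>. These exceptions are exactly the weights fixed by the reflection, the steps
  that a minimal word avoids, so equivariance of \<open>gamma\<close> and minimality fit together.
  Identities of operators use relations between the parameters only. Nonvanishing and uniqueness use
  the independence of \<open>q\<close>, which is isolated in the statement that no nontrivial power
  of \<open>q\<close> is a signed monomial in the other parameters.\<close>

lemma lookup_scale [simp]: "lookup (scale c v) i = c * lookup v i"
  by (simp add: scale_def map.rep_eq when_def)

lemma lookup_eps: "lookup (eps i) j = (if i = j then 1 else 0)"
  by (simp add: eps_def lookup_single when_def)

lemma lookup_perm_act:
  assumes "bij w"
  shows "lookup (perm_act w v) j = lookup v (inv w j)"
  using assms by (simp add: perm_act_def map_key.rep_eq bij_imp_bij_inv bij_is_inj)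

lemma inv_simple_refl [simp]: "inv (simple_refl i) = simple_refl i"
  by (simp add: simple_refl_def inv_equality)

lemma bij_simple_refl [simp]: "bij (simple_refl i)"
  by (simp add: simple_refl_def)

lemma lookup_simple_refl [simp]:
  "lookup (perm_act (simple_refl i) v) j = lookup v (simple_refl i j)"
  by (simp add: lookup_perm_act)

lemma perm_act_comp:
  assumes "bij u" "bij w"
  shows "perm_act u (perm_act w v) = perm_act (u \<circ> w) v"
  using assms by (intro poly_mapping_eqI) (simp add: lookup_perm_act bij_comp o_inv_distrib)

lemma perm_act_id [simp]: "perm_act id v = v"
  by (intro poly_mapping_eqI) (simp add: lookup_perm_act)

lemma perm_act_add:
  assumes "bij w"
  shows "perm_act w (u + v) = perm_act w u + perm_act w v"
  using assms by (intro poly_mapping_eqI) (simp add: lookup_perm_act lookup_add)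

lemma perm_act_scale:
  assumes "bij w"
  shows "perm_act w (scale c v) = scale c (perm_act w v)"
  using assms by (intro poly_mapping_eqI) (simp add: lookup_perm_act)

lemma perm_act_eps:
  assumes "bij w"
  shows "perm_act w (eps i) = eps (w i)"
  using assms by (intro poly_mapping_eqI)
    (auto simp add: lookup_perm_act lookup_eps bij_inv_eq_iff)

lemma simple_refl_apply:
  "simple_refl i j = (if j = i then i + 1 else if j = i + 1 then i else j)"
  by (simp add: simple_refl_def transpose_def)

lemma simple_refl_invol [simp]: "simple_refl i (simple_refl i j) = j"
  by (simp add: simple_refl_def)

lemma ip_simple_root:
  assumes "1 \<le> i" "i < r"
  shows "ip r v (simple_root i) = lookup v i - lookup v (i + 1)"
proof -
  have "ip r v (simple_root i) =
      (\<Sum>j=1..r. (if j = i then lookup v j else 0) - (if j = i + 1 then lookup v j else 0))"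
    unfolding ip_def by (rule sum.cong) (auto simp: simple_root_def lookup_minus lookup_eps)
  also have "\<dots> = lookup v i - lookup v (i + 1)"
    using assms by (simp add: sum_subtractf)
  finally show ?thesis .
qed

subsection \<open>Linear operators on Laurent polynomials\<close>

abbreviation cst :: "'f::field \<Rightarrow> 'f laurent" where
  "cst c \<equiv> Poly_Mapping.single 0 c"

lemma scale_laurent: "scale c (f :: 'f::field laurent) = cst c * f"
  by (simp add: scale_def mult_map_scale_conv_mult)

lemma cst_mult: "cst (a * b) = cst a * cst b"
  by (simp add: mult_single)

lemma cst_add: "cst (a + b) = cst a + cst b"
  by (simp add: single_add)

lemma cst_diff: "cst (a - b) = cst a - cst b"
  by (simp add: single_diff)

lemma xpow_add: "xpow (u + v) = (xpow u * xpow v :: 'f::field laurent)"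
  by (simp add: xpow_def mult_single)

lemma xpow_zero [simp]: "xpow 0 = 1"
  by (simp add: xpow_def)

lemma lookup_xpow: "lookup (xpow v) u = (if u = v then 1 else 0)"
  by (simp add: xpow_def lookup_single when_def)

lemma lookup_cst_mult [simp]: "lookup (cst c * (f :: 'f::field laurent)) v = c * lookup f v"
  by (simp flip: scale_laurent)

lemma laurent_expansion: "(f :: 'f::field laurent) = (\<Sum>v\<in>keys f. cst (lookup f v) * xpow v)"
proof (rule poly_mapping_eqI)
  fix u
  have "lookup (\<Sum>v\<in>keys f. cst (lookup f v) * xpow v) u =
      (\<Sum>v\<in>keys f. if v = u then lookup f v else 0)"
    unfolding lookup_sum by (rule sum.cong) (auto simp: lookup_xpow)
  then show "lookup f u = lookup (\<Sum>v\<in>keys f. cst (lookup f v) * xpow v) u"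
    by (simp add: not_in_keys_iff_lookup_eq_zero)
qed

definition linop :: "('f::field laurent \<Rightarrow> 'f laurent) \<Rightarrow> bool" where
  "linop F \<longleftrightarrow> (\<forall>f g. F (f + g) = F f + F g) \<and> (\<forall>c f. F (cst c * f) = cst c * F f)"

lemma linop_add: "linop F \<Longrightarrow> F (f + g) = F f + F g"
  and linop_cst: "linop F \<Longrightarrow> F (cst c * f) = cst c * F f"
  by (auto simp: linop_def)

lemma linop_zero: "linop F \<Longrightarrow> F 0 = 0"
  using linop_cst[of F 0 0] by simp

lemma linop_uminus: "linop F \<Longrightarrow> F (- f) = - F f"
  by (metis add.inverse_inverse add_eq_0_iff linop_add linop_zero)

lemma linop_diff: "linop F \<Longrightarrow> F (f - g) = F f - F g"
  by (metis diff_conv_add_uminus linop_add linop_uminus)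

lemma linop_sum: "linop F \<Longrightarrow> F (\<Sum>i\<in>A. f i) = (\<Sum>i\<in>A. F (f i))"
  by (induction A rule: infinite_finite_induct) (auto simp: linop_zero linop_add)

lemma linop_id: "linop (\<lambda>f. f)"
  and linop_mult: "linop (\<lambda>f. g * f)"
  and linop_comp: "linop F \<Longrightarrow> linop H \<Longrightarrow> linop (\<lambda>f. F (H f))"
  and linop_plus: "linop F \<Longrightarrow> linop H \<Longrightarrow> linop (\<lambda>f. F f + H f)"
  and linop_minus: "linop F \<Longrightarrow> linop H \<Longrightarrow> linop (\<lambda>f. F f - H f)"
  by (simp_all add: linop_def algebra_simps)

lemma linop_lmult: "linop F \<Longrightarrow> linop (\<lambda>f. g * F f)"
  by (simp add: linop_def algebra_simps)

lemmas linop_intros = linop_id linop_mult linop_plus linop_minus linop_lmult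

lemma linop_eqI:
  assumes "linop F" "linop H" "\<And>v. F (xpow v) = H (xpow v)"
  shows "F f = H f"
  by (subst (1 2) laurent_expansion) (simp add: assms linop_sum linop_cst)

lemma lin_ext_superset:
  fixes f :: "'f::field laurent"
  assumes "finite A" "keys f \<subseteq> A"
  shows "lin_ext F f = (\<Sum>v\<in>A. cst (lookup f v) * F v)"
  unfolding lin_ext_def scale_laurent
  using assms by (intro sum.mono_neutral_left) (auto simp: in_keys_iff)

lemma linop_lin_ext: "linop (lin_ext F)"
  unfolding linop_def
proof (intro conjI allI)
  fix f g :: "'a laurent" and c
  have "finite (keys f \<union> keys g)" "keys (f + g) \<subseteq> keys f \<union> keys g"
    using keys_add[of f g] by auto
  then show "lin_ext F (f + g) = lin_ext F f + lin_ext F g"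
    by (simp add: lin_ext_superset[where A = "keys f \<union> keys g"] lookup_add cst_add
        algebra_simps sum.distrib)
  have "keys (cst c * f) \<subseteq> keys f"
    by (auto simp: in_keys_iff)
  then have "lin_ext F (cst c * f) = (\<Sum>v\<in>keys f. cst (lookup (cst c * f) v) * F v)"
    by (rule lin_ext_superset[OF finite_keys])
  also have "\<dots> = (\<Sum>v\<in>keys f. cst c * (cst (lookup f v) * F v))"
    by (rule sum.cong) (simp_all only: lookup_cst_mult cst_mult mult.assoc)
  also have "\<dots> = cst c * lin_ext F f"
    by (simp only: sum_distrib_left lin_ext_superset[OF finite_keys order.refl])
  finally show "lin_ext F (cst c * f) = cst c * lin_ext F f" .
qed

lemma lin_ext_xpow [simp]: "lin_ext F (xpow v) = F v"
  by (simp add: lin_ext_superset[where A = "{v}"] xpow_def)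

subsection \<open>The operators \<open>T\<^sub>i\<close>\<close>

text \<open>\<open>geo \<alpha> m\<close> is \<open>(1 - x\<^sup>-\<^sup>m\<^sup>\<alpha>) / (1 - x\<^sup>\<alpha>)\<close>.\<close>

definition geo :: "(nat \<Rightarrow>\<^sub>0 int) \<Rightarrow> int \<Rightarrow> 'f::field laurent" where
  "geo \<alpha> m = (\<Sum>j\<in>{0..<- m}. xpow (scale j \<alpha>)) - (\<Sum>j\<in>{1..m}. xpow (scale (- j) \<alpha>))"

lemma scale_add_left: "scale (a + b) (v :: _ \<Rightarrow>\<^sub>0 int) = scale a v + scale b v"
  by (intro poly_mapping_eqI) (simp add: lookup_add algebra_simps)

lemma scale_one [simp]: "scale 1 (v :: _ \<Rightarrow>\<^sub>0 int) = v"
  by (intro poly_mapping_eqI) simp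

lemma scale_zero_left [simp]: "scale 0 (v :: _ \<Rightarrow>\<^sub>0 int) = 0"
  by (intro poly_mapping_eqI) simp

text \<open>Two telescoping sums, one for each sign of \<open>m\<close>: \<open>geo\<close> has
  exponents \<open>0, ..., -m - 1\<close> for \<open>m <= 0\<close> and \<open>-1, ..., -m\<close>
  for \<open>m > 0\<close>.\<close>

lemma geo_mult: "geo \<alpha> m * (1 - xpow \<alpha>) = (1 - xpow (scale (- m) \<alpha>) :: 'f::field laurent)"
proof -
  have neg: "(\<Sum>j\<in>{0..<int p}. xpow (scale j \<alpha>)) * (1 - xpow \<alpha>) =
      (1 - xpow (scale (int p) \<alpha>) :: 'f laurent)" for p
  proof (induction p)
    case (Suc p)
    have *: "{0..<int (Suc p)} = insert (int p) {0..<int p}" by auto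
    have e: "(\<Sum>j\<in>{0..<int (Suc p)}. xpow (scale j \<alpha>)) =
        (xpow (scale (int p) \<alpha>) + (\<Sum>j\<in>{0..<int p}. xpow (scale j \<alpha>)) :: 'f laurent)"
      unfolding * by simp
    have "int (Suc p) = int p + 1" by simp
    then have x: "xpow (scale (int (Suc p)) \<alpha>) = (xpow (scale (int p) \<alpha>) * xpow \<alpha> :: 'f laurent)"
      by (simp only: scale_add_left scale_one xpow_add)
    show ?case
      unfolding e x distrib_right Suc by (simp add: right_diff_distrib)
  qed simp
  have pos: "- (\<Sum>j\<in>{1..int p}. xpow (scale (- j) \<alpha>)) * (1 - xpow \<alpha>) =
      (1 - xpow (scale (- int p) \<alpha>) :: 'f laurent)" for p
  proof (induction p)
    case (Suc p)
    have *: "{1..int (Suc p)} = insert (1 + int p) {1..int p}" by auto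
    have e: "- (\<Sum>j\<in>{1..int (Suc p)}. xpow (scale (- j) \<alpha>)) =
        (- (\<Sum>j\<in>{1..int p}. xpow (scale (- j) \<alpha>)) - xpow (scale (- int (Suc p)) \<alpha>) :: 'f laurent)"
      unfolding * by simp
    have "- int p = - int (Suc p) + 1" by simp
    then have x: "xpow (scale (- int p) \<alpha>) = (xpow (scale (- int (Suc p)) \<alpha>) * xpow \<alpha> :: 'f laurent)"
      by (simp only: scale_add_left scale_one xpow_add)
    show ?case
      unfolding e left_diff_distrib Suc unfolding x by (simp add: right_diff_distrib)
  qed simp
  show ?thesis
  proof (cases "m \<ge> 0")
    case True
    then obtain p where "m = int p" by (metis nat_0_le)
    then show ?thesis using pos[of p] by (simp add: geo_def)
  next
    case False
    then obtain p where "m = - int p" using int_cases2[of m] by auto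
    then show ?thesis using neg[of p] by (simp add: geo_def)
  qed
qed

lemma laurent_quot_eq:
  fixes f g h :: "'f::field laurent"
  assumes "h * g = f" "g \<noteq> 0"
  shows "laurent_quot f g = h"
  unfolding laurent_quot_def
proof (rule the_equality)
  fix h' assume "h' * g = f"
  with assms have "(h' - h) * g = 0" by (simp add: algebra_simps)
  with assms(2) show "h' = h" by simp
qed (fact assms)

lemma one_minus_xpow_nonzero:
  assumes "\<alpha> \<noteq> 0"
  shows "1 - xpow \<alpha> \<noteq> (0 :: 'f::field laurent)"
proof
  assume "1 - xpow \<alpha> = (0 :: 'f laurent)"
  then have "lookup (1 :: 'f laurent) 0 = lookup (xpow \<alpha>) 0" by simp
  with assms show False by (simp add: lookup_xpow)
qed

lemma scale_scale: "scale a (scale b v) = scale (a * b) (v :: _ \<Rightarrow>\<^sub>0 int)"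
  by (intro poly_mapping_eqI) simp

text \<open>\<open>tn n a\<close> is \<open>n\<close> times the floor of \<open>a / n\<close>, so
  the division in \<open>T_op\<close> is exact, and the quotient is unique because the divisor is
  nonzero.\<close>

lemma quot_geo:
  assumes "n \<ge> 1"
  shows "laurent_quot (1 - xpow (scale (- tn n a) (simple_root i)))
      (1 - xpow (scale (int n) (simple_root i))) =
    (geo (scale (int n) (simple_root i)) (a div int n) :: 'f::field laurent)"
proof (rule laurent_quot_eq)
  have "tn n a = (a div int n) * int n"
    by (simp add: tn_def minus_mod_eq_div_mult)
  then show "geo (scale (int n) (simple_root i)) (a div int n) *
      (1 - xpow (scale (int n) (simple_root i))) =
      (1 - xpow (scale (- tn n a) (simple_root i)) :: 'f laurent)"
    unfolding geo_mult by (simp add: scale_scale)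
  have "scale (int n) (simple_root i) \<noteq> (0 :: nat \<Rightarrow>\<^sub>0 int)"
  proof
    assume "scale (int n) (simple_root i) = (0 :: nat \<Rightarrow>\<^sub>0 int)"
    then have "lookup (scale (int n) (simple_root i) :: nat \<Rightarrow>\<^sub>0 int) i = 0" by simp
    then show False using assms by (simp add: simple_root_def lookup_minus lookup_eps)
  qed
  then show "1 - xpow (scale (int n) (simple_root i)) \<noteq> (0 :: 'f laurent)"
    by (rule one_minus_xpow_nonzero)
qed

text \<open>Multiplying a monomial by \<open>x_i^n\<close> raises \<open>a div n\<close> by one.
  This recurrence is what becomes the Bernstein relations between \<open>T i\<close> and
  \<open>X i\<close>.\<close>

lemma geo_shift:
  assumes "\<alpha> \<noteq> 0"
  shows "xpow \<alpha> * geo \<alpha> (m + 1) = (geo \<alpha> m - 1 :: 'f::field laurent)"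
proof -
  have "scale (- (m + 1)) \<alpha> + \<alpha> = scale (- m) \<alpha>"
    by (intro poly_mapping_eqI) (simp add: lookup_add algebra_simps)
  then have x: "xpow (scale (- (m + 1)) \<alpha>) * xpow \<alpha> = (xpow (scale (- m) \<alpha>) :: 'f laurent)"
    by (simp only: xpow_add[symmetric])
  have "(xpow \<alpha> * geo \<alpha> (m + 1)) * (1 - xpow \<alpha>) =
      xpow \<alpha> * (geo \<alpha> (m + 1) * (1 - xpow \<alpha>) :: 'f laurent)"
    by (simp only: mult.assoc)
  also have "\<dots> = xpow \<alpha> - xpow (scale (- (m + 1)) \<alpha>) * xpow \<alpha>"
    unfolding geo_mult by (simp add: right_diff_distrib mult.commute)
  also have "\<dots> = geo \<alpha> m * (1 - xpow \<alpha>) - (1 - xpow \<alpha>)"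
    unfolding geo_mult x by simp
  also have "\<dots> = (geo \<alpha> m - 1) * (1 - xpow \<alpha>)"
    by (simp add: left_diff_distrib)
  finally show ?thesis
    using one_minus_xpow_nonzero[OF assms] by (metis mult_right_cancel)
qed

lemma perm_act_simple_refl:
  "perm_act (simple_refl i) v =
    v + scale (- (lookup v i - lookup v (i + 1))) (simple_root i :: nat \<Rightarrow>\<^sub>0 int)"
  by (intro poly_mapping_eqI)
    (auto simp: lookup_add simple_root_def lookup_minus lookup_eps simple_refl_apply)

section \<open>Metaplectic parameters, Bernstein relations and the expansion of \<open>T_i\<close>
  on monomials\<close>

locale metaplectic =
  fixes r n :: nat and k q :: "'f::field" and G :: "int \<Rightarrow> 'f"
  assumes r_ge_2: "r \<ge> 2" and n_pos: "n \<ge> 1" and k_nonzero: "k \<noteq> 0" and G_0: "G 0 = k" and q_nonzero: "q \<noteq> 0"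
    and G_inverse: "\<not> int n dvd j \<Longrightarrow> G j * G (- j) = 1"
    and G_periodic: "i mod int n = j mod int n \<Longrightarrow> G i = G j"
begin

abbreviation "T \<equiv> T_op r n k G"
abbreviation hk :: "'f laurent" where "hk \<equiv> cst (k - inverse k)"
abbreviation "sig \<equiv> sigma n k G"

definition X :: "nat \<Rightarrow> 'f laurent" where "X j = xpow (scale (int n) (eps j))"
text \<open>By the quadratic relation this is the two-sided inverse of \<open>T i\<close>, given in
  closed form so that it is linear on the whole group ring.\<close>

definition T' :: "nat \<Rightarrow> 'f laurent \<Rightarrow> 'f laurent" where "T' i f = T i f - hk * f"

lemma linop_T [intro!, simp]: "linop (T i)"
  unfolding T_op_def by (rule linop_lin_ext)

lemma linop_T' [intro!, simp]: "linop (T' i)"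
  unfolding T'_def by (intro linop_intros linop_T)

lemma linop_T_comp: "linop F \<Longrightarrow> linop (\<lambda>f. T i (F f))"
  and linop_T'_comp: "linop F \<Longrightarrow> linop (\<lambda>f. T' i (F f))"
  by (rule linop_comp[OF linop_T] linop_comp[OF linop_T']; assumption)+

lemma G_shift: "G (a + int n) = G a" "G (a - int n) = G a"
  by (rule G_periodic; simp)+

lemma G_dvd: "int n dvd a \<Longrightarrow> G a = k"
  using G_periodic[of a 0] G_0 by (simp add: dvd_eq_mod_eq_0)

lemma sig_inverse: "a \<noteq> 0 \<Longrightarrow> sig a * sig (- a) = 1"
  using G_inverse[of a] G_dvd[of a] G_dvd[of "- a"] k_nonzero by (auto simp: sigma_def)

lemma sig_zero: "sig 0 = k"
  by (simp add: sigma_def G_0)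

lemma sig_nonzero [simp]: "sig a \<noteq> 0"
  using sig_inverse[of a] sig_zero k_nonzero by (cases "a = 0") auto

lemma T_xpow:
  assumes "1 \<le> i" "i < r"
  defines "a \<equiv> \<lambda>v. lookup v i - lookup v (i + 1)"
  shows "T i (xpow v) =
    hk * (geo (scale (int n) (simple_root i)) (a v div int n) * xpow v) +
      cst (G (a v)) * xpow (perm_act (simple_refl i) v)"
  using assms n_pos by (simp add: T_op_def ip_simple_root quot_geo scale_laurent)

lemma X_lookup_shift:
  "lookup (scale (int n) (eps j) + v) i = (if i = j then int n else 0) + lookup v i"
  by (simp add: lookup_add lookup_eps)

lemma simple_refl_X:
  "xpow (perm_act (simple_refl i) (scale (int n) (eps j) + v)) =
    (X (simple_refl i j) * xpow (perm_act (simple_refl i) v) :: 'f laurent)"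
  by (simp add: perm_act_add perm_act_scale perm_act_eps xpow_add X_def)

lemma X_root: "X i = xpow (scale (int n) (simple_root i)) * X (i + 1)"
  unfolding X_def xpow_add[symmetric]
  by (rule arg_cong[of _ _ xpow], rule poly_mapping_eqI)
    (simp add: simple_root_def lookup_add lookup_minus lookup_eps)

lemma scaled_root_nonzero: "scale (int n) (simple_root i) \<noteq> (0 :: nat \<Rightarrow>\<^sub>0 int)"
proof
  assume "scale (int n) (simple_root i) = (0 :: nat \<Rightarrow>\<^sub>0 int)"
  then have "lookup (scale (int n) (simple_root i) :: nat \<Rightarrow>\<^sub>0 int) i = 0" by simp
  then show False using n_pos by (simp add: simple_root_def lookup_minus lookup_eps)
qed

text \<open>The Bernstein relation \<open>T_i X_i T_i = X_(i+1)\<close>. On a monomial the shift of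
  \<open>geo\<close> contributes the term \<open>- hk\<close>, which turns \<open>T i\<close> into
  \<open>T' i\<close>.\<close>

lemma T_X_left:
  assumes "1 \<le> i" "i < r"
  shows "T i (X i * f) = X (i + 1) * T' i f"
proof (rule linop_eqI[where F = "\<lambda>f. T i (X i * f)"])
  fix v :: "nat \<Rightarrow>\<^sub>0 int"
  let ?a = "lookup v i - lookup v (i + 1)" and ?\<alpha> = "scale (int n) (simple_root i) :: nat \<Rightarrow>\<^sub>0 int"
  have d: "(?a + int n) div int n = ?a div int n + 1" using n_pos by simp
  have "T i (X i * xpow v) = T i (xpow (scale (int n) (eps i) + v))"
    by (simp add: X_def xpow_add)
  also have "\<dots> = hk * (geo ?\<alpha> (?a div int n + 1) * (X i * xpow v)) +
      cst (G ?a) * (X (i + 1) * xpow (perm_act (simple_refl i) v))"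
    unfolding T_xpow[OF assms] X_lookup_shift simple_refl_X
    using d G_shift(1)[of ?a] by (simp add: X_def xpow_add algebra_simps simple_refl_apply)
  also have "hk * (geo ?\<alpha> (?a div int n + 1) * (X i * xpow v)) =
      hk * ((xpow ?\<alpha> * geo ?\<alpha> (?a div int n + 1)) * (X (i + 1) * xpow v))"
    unfolding X_root[of i] by (simp only: ac_simps)
  also have "\<dots> + cst (G ?a) * (X (i + 1) * xpow (perm_act (simple_refl i) v)) =
      X (i + 1) * T' i (xpow v)"
    unfolding geo_shift[OF scaled_root_nonzero] T'_def T_xpow[OF assms]
    by (simp add: algebra_simps)
  finally show "T i (X i * xpow v) = X (i + 1) * T' i (xpow v)" .
qed (intro linop_intros linop_T_comp linop_T'_comp)+

lemma T_X_right:
  assumes "1 \<le> i" "i < r"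
  shows "T i (X (i + 1) * f) = X i * T i f + hk * (X (i + 1) * f)"
proof (rule linop_eqI[where F = "\<lambda>f. T i (X (i + 1) * f)"])
  fix v :: "nat \<Rightarrow>\<^sub>0 int"
  let ?a = "lookup v i - lookup v (i + 1)" and ?\<alpha> = "scale (int n) (simple_root i) :: nat \<Rightarrow>\<^sub>0 int"
  have "(?a - int n) div int n = ?a div int n - 1"
    using n_pos div_mult_self1[of "int n" "?a" "-1"] by simp
  moreover have "lookup v i - (int n + lookup v (Suc i)) = ?a - int n" by simp
  ultimately have d': "(lookup v i - (int n + lookup v (Suc i))) div int n =
      (lookup v i - lookup v (Suc i)) div int n - 1" by (simp only: Suc_eq_plus1)
  have g: "xpow ?\<alpha> * geo ?\<alpha> (?a div int n) + (1 :: 'f laurent) = geo ?\<alpha> (?a div int n - 1)"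
    using geo_shift[OF scaled_root_nonzero, of i "?a div int n - 1"] by (simp add: eq_diff_eq)
  have "T i (X (i + 1) * xpow v) = T i (xpow (scale (int n) (eps (i + 1)) + v))"
    by (simp add: X_def xpow_add)
  also have "\<dots> = hk * (geo ?\<alpha> (?a div int n - 1) * (X (i + 1) * xpow v)) +
      cst (G ?a) * (X i * xpow (perm_act (simple_refl i) v))"
    unfolding T_xpow[OF assms(1,2)] X_lookup_shift simple_refl_X
    using G_shift(2)[of ?a] by (simp add: d' X_def xpow_add algebra_simps simple_refl_apply)
  also have "\<dots> = X i * T i (xpow v) + hk * (X (i + 1) * xpow v)"
    unfolding g[symmetric] T_xpow[OF assms(1,2)] X_root[of i] by (simp add: algebra_simps)
  finally show "T i (X (i + 1) * xpow v) = X i * T i (xpow v) + hk * (X (i + 1) * xpow v)" .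
qed (intro linop_intros linop_T_comp)+

lemma T_mult_invariant:
  assumes "1 \<le> i" "i < r" "lookup \<beta> i = lookup \<beta> (i + 1)"
  shows "T i (xpow \<beta> * f) = xpow \<beta> * T i f"
proof (rule linop_eqI[where F = "\<lambda>f. T i (xpow \<beta> * f)"])
  fix v
  have "perm_act (simple_refl i) \<beta> = \<beta>"
    using assms(3) unfolding perm_act_simple_refl by simp
  then have "perm_act (simple_refl i) (\<beta> + v) = \<beta> + perm_act (simple_refl i) v"
    by (simp add: perm_act_add)
  then show "T i (xpow \<beta> * xpow v) = xpow \<beta> * T i (xpow v)"
    unfolding xpow_add[symmetric] T_xpow[OF assms(1,2)]
    using assms(3) by (simp add: lookup_add xpow_add algebra_simps)
qed (intro linop_intros linop_T_comp)+

lemma T_X_other: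
  assumes "1 \<le> i" "i < r" "j \<noteq> i" "j \<noteq> i + 1"
  shows "T i (X j * f) = X j * T i f"
  unfolding X_def using assms by (intro T_mult_invariant) (auto simp: lookup_eps)

text \<open>The exponents form a string \<open>v + c alpha_i\<close> in steps of \<open>n\<close>,
  with ends \<open>c = 0\<close> (that is \<open>v\<close>) and \<open>c = - a v\<close> (that is
  \<open>s_i v\<close>). The condition \<open>c * (c + a v) < 0\<close> says strictly between the
  ends. The function \<open>sig\<close> collects everything that lands on
  \<open>s_i v\<close>.\<close>

lemma T_expand:
  assumes "1 \<le> i" "i < r"
  defines "a \<equiv> \<lambda>v. lookup v i - lookup v (i + 1)"
  obtains R where
    "T i (xpow v) = cst (sig (a v)) * xpow (perm_act (simple_refl i) v) +
       (if a v < 0 then hk * xpow v else 0) + R"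
    "\<And>u. u \<in> keys R \<Longrightarrow> \<exists>c. int n dvd c \<and> c * (c + a v) < 0 \<and> u = v + scale c (simple_root i)"
proof -
  note * = that
  let ?b = "a v" and ?m = "a v div int n" and ?N = "int n"
  let ?\<alpha> = "simple_root i :: nat \<Rightarrow>\<^sub>0 int"
  define S where "S J = (\<Sum>j\<in>J. xpow (scale (j * ?N) ?\<alpha> + v) :: 'f laurent)" for J
  have keysS: "\<exists>j\<in>J. u = v + scale (j * ?N) ?\<alpha>" if "u \<in> keys (cst d * S J)" for u d J
  proof -
    have "lookup (cst d * S J) u \<noteq> 0" using that by (simp add: in_keys_iff)
    then have "lookup (S J) u \<noteq> 0" by auto
    then have "(\<Sum>j\<in>J. lookup (xpow (scale (j * ?N) ?\<alpha> + v) :: 'f laurent) u) \<noteq> 0"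
      by (simp add: S_def lookup_sum)
    then obtain j where "j \<in> J" "lookup (xpow (scale (j * ?N) ?\<alpha> + v) :: 'f laurent) u \<noteq> 0"
      by (meson sum.neutral)
    then show ?thesis by (auto simp: lookup_xpow add.commute split: if_splits)
  qed
  have "S (uminus ` {1..m}) = (\<Sum>j\<in>{1..m}. xpow (scale (- j * ?N) ?\<alpha> + v))" for m
    unfolding S_def by (subst sum.reindex) (auto simp: inj_on_def)
  then have geo: "geo (scale ?N ?\<alpha>) m * xpow v = S {0..<- m} - S (uminus ` {1..m})" for m
    by (simp add: geo_def S_def left_diff_distrib sum_distrib_right scale_scale xpow_add
        del: image_uminus_atLeastAtMost)
  have b: "?N * ?m \<le> ?b" "?b < ?N * ?m + ?N"
    using n_pos pos_mod_bound[of ?N ?b] pos_mod_sign[of ?N ?b] mult_div_mod_eq[of ?N ?b]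
    by linarith+
  have T: "T i (xpow v) = hk * (S {0..<- ?m} - S (uminus ` {1..?m})) +
      cst (G ?b) * xpow (perm_act (simple_refl i) v)"
    unfolding geo[symmetric] a_def by (rule T_xpow[OF assms(1,2)])
  have mh: "cst (inverse k - k) = - hk" by (simp flip: single_uminus)
  have fin: thesis
    if "T i (xpow v) = cst (sig ?b) * xpow (perm_act (simple_refl i) v) +
        (if ?b < 0 then hk * xpow v else 0) + cst d * S J"
      and J: "\<And>j. j \<in> J \<Longrightarrow> ?N dvd j * ?N \<and> (j * ?N) * (j * ?N + ?b) < 0" for d J
  proof (rule *)
    fix u assume "u \<in> keys (cst d * S J)"
    then obtain j where "j \<in> J" "u = v + scale (j * ?N) ?\<alpha>" using keysS by blast
    with J show "\<exists>c. ?N dvd c \<and> c * (c + ?b) < 0 \<and> u = v + scale c ?\<alpha>" by blast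
  qed (fact that(1))
  consider "?b < 0" | "?b \<ge> 0" "\<not> (?N dvd ?b \<and> ?b > 0)" | "?N dvd ?b" "?b > 0" by linarith
  then show thesis
  proof cases
    case 1
    then have m: "?m < 0" using n_pos div_neg_pos_less0[of ?b ?N] by simp
    \<comment> \<open>The summand 0 is \<open>x^v\<close> itself, the extra term at the near end of
      the string.\<close>
    then have "{0..<- ?m} = insert 0 {1..<- ?m}" "{1..?m} = {}" by auto
    then have "S {0..<- ?m} - S (uminus ` {1..?m}) = xpow v + S {1..<- ?m}"
      by (simp add: S_def)
    then have "T i (xpow v) = cst (sig ?b) * xpow (perm_act (simple_refl i) v) +
       (if ?b < 0 then hk * xpow v else 0) + hk * S {1..<- ?m}"
      using 1 T by (simp add: sigma_def algebra_simps)
    moreover have "?N dvd j * ?N \<and> (j * ?N) * (j * ?N + ?b) < 0" if "j \<in> {1..<- ?m}" for j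
    proof -
      have "j * ?N \<le> (- ?m - 1) * ?N" using that by (intro mult_right_mono) auto
      then have "j * ?N + ?b < 0" using b by (simp add: algebra_simps)
      moreover have "j * ?N > 0" using that n_pos by simp
      ultimately show ?thesis by (simp add: mult_pos_neg)
    qed
    ultimately show thesis by (rule fin)
  next
    case 2
    then have m: "?m \<ge> 0" using n_pos pos_imp_zdiv_nonneg_iff[of ?N ?b] by simp
    then have "S {0..<- ?m} = 0" by (simp add: S_def)
    moreover have "sig ?b = G ?b" using 2 by (auto simp: sigma_def)
    ultimately have "T i (xpow v) = cst (sig ?b) * xpow (perm_act (simple_refl i) v) +
       (if ?b < 0 then hk * xpow v else 0) + cst (inverse k - k) * S (uminus ` {1..?m})"
      using 2 T by (simp add: mh algebra_simps)
    moreover have "?N dvd j * ?N \<and> (j * ?N) * (j * ?N + ?b) < 0" if "j \<in> uminus ` {1..?m}" for j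
    proof -
      \<comment> \<open>The sum reaches \<open>s_i v\<close> only if \<open>n\<close> divides
        \<open>?b\<close>. In this case that forces \<open>?b = 0\<close>, where the sum is
        empty.\<close>
      have "?b \<noteq> ?m * ?N"
      proof
        assume "?b = ?m * ?N"
        then have "?N dvd ?b" by (metis dvd_triv_right)
        with 2 have "?b = 0" by simp
        then have "?m = 0" by simp
        with that show False by auto
      qed
      then have "?b > ?m * ?N" using b by (simp add: mult.commute)
      moreover have "- j * ?N \<le> ?m * ?N" using that by (intro mult_right_mono) auto
      ultimately have "j * ?N + ?b > 0" by simp
      moreover have "j * ?N < 0" using that n_pos by (auto simp: mult_neg_pos)
      ultimately show ?thesis by (simp add: mult_neg_pos)
    qed
    ultimately show thesis by (rule fin)
  next
    case 3
    then have bm: "?b = ?m * ?N" by simp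
    then have m: "?m > 0" using 3 n_pos zdvd_imp_le[of ?N ?b]
      pos_imp_zdiv_pos_iff[of ?N ?b] by simp
    \<comment> \<open>The last summand falls on \<open>s_i v\<close>. Its coefficient
      \<open>k^-1 - k\<close> joins \<open>G ?b = k\<close> and gives
      \<open>sig ?b = k^-1\<close>.\<close>
    have "{1..?m} = insert ?m {1..<?m}" using m by auto
    then have "uminus ` {1..?m} = insert (- ?m) (uminus ` {1..<?m})" by simp
    moreover have "- ?m \<notin> uminus ` {1..<?m}" by auto
    ultimately have "S (uminus ` {1..?m}) =
        xpow (scale (- ?m * ?N) ?\<alpha> + v) + S (uminus ` {1..<?m})"
      by (simp add: S_def)
    also have "scale (- ?m * ?N) ?\<alpha> + v = perm_act (simple_refl i) v"
      unfolding perm_act_simple_refl using bm by (simp add: a_def add.commute)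
    finally have S: "S (uminus ` {1..?m}) =
        xpow (perm_act (simple_refl i) v) + S (uminus ` {1..<?m})" .
    have "S {0..<- ?m} = 0" using m by (simp add: S_def)
    then have "T i (xpow v) = cst (sig ?b) * xpow (perm_act (simple_refl i) v) +
       (if ?b < 0 then hk * xpow v else 0) + cst (inverse k - k) * S (uminus ` {1..<?m})"
      using 3 T S G_dvd[OF 3(1)]
      by (simp add: sigma_def mh cst_diff algebra_simps)
    moreover have "?N dvd j * ?N \<and> (j * ?N) * (j * ?N + ?b) < 0" if "j \<in> uminus ` {1..<?m}" for j
    proof -
      have "- j * ?N < ?m * ?N" using that n_pos by (intro mult_strict_right_mono) auto
      then have "j * ?N + ?b > 0" using bm by simp
      moreover have "j * ?N < 0" using that n_pos by (auto simp: mult_neg_pos)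
      ultimately show ?thesis by (simp add: mult_neg_pos)
    qed
    ultimately show thesis by (rule fin)
  qed
qed

text \<open>A point strictly inside the string has \<open>0 < |c| < |a v| <= n\<close>, which no
  multiple of \<open>n\<close> satisfies.\<close>

lemma T_small:
  assumes "1 \<le> i" "i < r"
  defines "a \<equiv> \<lambda>v. lookup v i - lookup v (i + 1)"
  assumes "\<bar>a v\<bar> \<le> int n"
  shows "T i (xpow v) = cst (sig (a v)) * xpow (perm_act (simple_refl i) v) +
       (if a v < 0 then hk * xpow v else 0)"
proof -
  obtain R where R: "T i (xpow v) = cst (sig (a v)) * xpow (perm_act (simple_refl i) v) +
       (if a v < 0 then hk * xpow v else 0) + R"
    and keys: "\<And>u. u \<in> keys R \<Longrightarrow> \<exists>c. int n dvd c \<and> c * (c + a v) < 0 \<and> u = v + scale c (simple_root i)"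
    unfolding a_def using T_expand[OF assms(1,2)] by blast
  have "\<not> (int n dvd c \<and> c * (c + a v) < 0)" for c
  proof
    assume c: "int n dvd c \<and> c * (c + a v) < 0"
    then have "c \<noteq> 0" by auto
    with c have "int n \<le> \<bar>c\<bar>" using dvd_imp_le_int[of c "int n"] by simp
    moreover have "\<bar>c\<bar> < \<bar>a v\<bar>" using c by (auto simp: mult_less_0_iff)
    ultimately show False using assms(4) by simp
  qed
  then have "keys R = {}" using keys by blast
  then show ?thesis using R by simp
qed

subsection \<open>Quadratic and braid relations\<close>

lemmas T_lin = linop_add[OF linop_T] linop_diff[OF linop_T] linop_cst[OF linop_T]
  linop_uminus[OF linop_T] linop_zero[OF linop_T] linop_sum[OF linop_T]

lemma X_nonzero: "X j \<noteq> 0"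
proof
  assume "X j = 0"
  then have "lookup (X j) (scale (int n) (eps j)) = 0" by simp
  then show False by (simp add: X_def lookup_xpow)
qed

text \<open>The operators of the Hecke relations below commute with multiplication by \<open>x\<^sub>j\<^sup>n\<close> up to
  permuting \<open>j\<close>, so that the relations need only be checked on exponents with entries in
  \<open>[0, n)\<close>, on which the \<open>T\<^sub>i\<close> act by two-term formulas.\<close>

lemma residue_induct:
  assumes "finite J"
    and shift: "\<And>j f. j \<in> J \<Longrightarrow> F (X j * f) = 0 \<longleftrightarrow> F f = (0 :: 'f laurent)"
    and base: "\<And>v. (\<And>j. j \<in> J \<Longrightarrow> 0 \<le> lookup v j \<and> lookup v j < int n) \<Longrightarrow> F (xpow v) = 0"
  shows "F (xpow v) = 0"
proof -
  have shift_int: "F (xpow (scale (m * int n) (eps j) + v)) = 0 \<longleftrightarrow> F (xpow v) = 0"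
    if "j \<in> J" for m j v
  proof -
    have x: "xpow (scale ((m + 1) * int n) (eps j) + v) =
        (X j * xpow (scale (m * int n) (eps j) + v) :: 'f laurent)" for m
      unfolding X_def xpow_add[symmetric]
      by (rule arg_cong[of _ _ xpow], rule poly_mapping_eqI) (simp add: lookup_add algebra_simps)
    show ?thesis
    proof (induction m rule: int_induct[where k = 0])
      case (step1 m)
      then show ?case unfolding x shift[OF that] by simp
    next
      case (step2 m)
      then show ?case using x[of "m - 1"] shift[OF that] by simp
    qed simp
  qed
  have "F (xpow v) = 0"
    if "J' \<subseteq> J" "\<And>j. j \<in> J - J' \<Longrightarrow> 0 \<le> lookup v j \<and> lookup v j < int n" for J' v
    using finite_subset[OF that(1) assms(1)] that
  proof (induction J' arbitrary: v rule: finite_induct)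
    case empty
    then show ?case by (intro base) auto
  next
    case (insert i J')
    let ?v = "scale (- (lookup v i div int n) * int n) (eps i) + v"
    have l: "lookup ?v j = (if j = i then lookup v i mod int n else lookup v j)" for j
      by (simp add: lookup_add lookup_eps minus_div_mult_eq_mod[symmetric])
    have "F (xpow ?v) = 0"
    proof (rule insert.IH)
      show "J' \<subseteq> J" using insert.prems(1) by simp
      fix j assume "j \<in> J - J'"
      then show "0 \<le> lookup ?v j \<and> lookup ?v j < int n"
        unfolding l using insert.prems(2)[of j] n_pos by simp
    qed
    then show ?case using shift_int insert.prems(1) by blast
  qed
  from this[of J v] show ?thesis by simp
qed

lemma T_quadratic:
  assumes "1 \<le> i" "i < r"
  shows "T i (T i f) = hk * T i f + f"
proof -
  define Q where "Q f = T i (T i f) - hk * T i f - f" for f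
  have lin: "linop Q"
    unfolding Q_def by (intro linop_intros linop_T_comp)
  note TX = T_X_left[OF assms] T_X_right[OF assms] T'_def T_lin
  have X1: "Q (X i * f) = X i * Q f" for f
    unfolding Q_def by (simp only: TX) (simp only: algebra_simps)
  have X2: "Q (X (i + 1) * f) = X (i + 1) * Q f" for f
    unfolding Q_def by (simp only: TX) (simp only: algebra_simps)
  have "Q (xpow v) = 0" for v
  proof (rule residue_induct[where J = "{i, i + 1}"])
    fix j f assume "j \<in> {i, i + 1}"
    then show "Q (X j * f) = 0 \<longleftrightarrow> Q f = 0"
      using X1[of f] X2[of f] X_nonzero by auto
  next
    fix v
    assume "\<And>j. j \<in> {i, i + 1} \<Longrightarrow> 0 \<le> lookup v j \<and> lookup v j < int n"
    from this[of i] this[of "i + 1"]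
    have b: "0 \<le> lookup v i" "lookup v i < int n" "0 \<le> lookup v (i + 1)" "lookup v (i + 1) < int n"
      by auto
    \<comment> \<open>The two arrangements of the entries at \<open>i\<close> and
      \<open>i + 1\<close> span a space stable under \<open>T i\<close>, so the relation becomes a
      computation in dimension at most two.\<close>
    define V where "V x y = v + scale (x - lookup v i) (eps i) +
      scale (y - lookup v (i + 1)) (eps (i + 1))" for x y
    have lV: "lookup (V x y) j = (if j = i then x else if j = i + 1 then y else lookup v j)" for x y j
      by (simp add: V_def lookup_add lookup_eps)
    have sV: "perm_act (simple_refl i) (V x y) = V y x" for x y
      by (intro poly_mapping_eqI) (auto simp: lV simple_refl_apply)
    have TV: "T i (xpow (V x y)) = cst (sig (x - y)) * xpow (V y x) + (if x < y then hk * xpow (V x y) else 0)"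
      if "0 \<le> x" "x < int n" "0 \<le> y" "y < int n" for x y
      using T_small[OF assms, of "V x y"] that by (simp add: lV sV)
    obtain a c where ac: "a = lookup v i" "c = lookup v (i + 1)" by blast
    have v: "v = V a c" by (intro poly_mapping_eqI) (simp add: lV ac)
    have bd: "0 \<le> a" "a < int n" "0 \<le> c" "c < int n" using b ac by auto
    have inv: "sig (c - a) = inverse (sig (a - c))" if "a \<noteq> c"
      using sig_inverse[of "a - c"] that sig_nonzero[of "a - c"] by (simp add: field_simps)
    have kk: "k * inverse k = 1" using k_nonzero by simp
    show "Q (xpow v) = 0"
      unfolding v Q_def
    proof (rule poly_mapping_eqI)
      fix u
      show "lookup (T i (T i (xpow (V a c))) - hk * T i (xpow (V a c)) - xpow (V a c)) u = lookup 0 u"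
        apply (cases a c rule: linorder_cases)
          apply (simp_all add: TV T_lin bd lookup_add lookup_minus sig_zero inv)
          apply (use k_nonzero sig_nonzero[of "a - c"] in \<open>simp_all add: field_simps\<close>)
        done
    qed
  qed simp
  then have "Q f = 0" for f
    using linop_eqI[OF lin, of "\<lambda>_. 0"] by (simp add: linop_def)
  then show ?thesis by (simp add: Q_def algebra_simps)
qed

lemma T'_T: "1 \<le> i \<Longrightarrow> i < r \<Longrightarrow> T' i (T i f) = f"
  and T_T': "1 \<le> i \<Longrightarrow> i < r \<Longrightarrow> T i (T' i f) = f"
  by (simp_all add: T'_def T_lin T_quadratic)

text \<open>On a monomial, \<open>T i\<close> is multiplication by a Laurent polynomial in
  \<open>x^(alpha_i)\<close>. Since \<open>alpha_i\<close> has equal entries at \<open>j\<close> and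
  \<open>j + 1\<close>, that polynomial passes through \<open>T j\<close>; the same holds with
  \<open>i\<close> and \<open>j\<close> exchanged.\<close>

lemma T_commute:
  assumes "1 \<le> i" "i + 1 < j" "j < r"
  shows "T i (T j f) = T j (T i f)"
proof (rule linop_eqI[where F = "\<lambda>f. T i (T j f)"])
  fix v
  have r: "1 \<le> i" "i < r" "1 \<le> j" "j < r" using assms by auto
  define gi gj where "gi = (geo (scale (int n) (simple_root i)) ((lookup v i - lookup v (i + 1)) div int n) :: 'f laurent)"
    and "gj = (geo (scale (int n) (simple_root j)) ((lookup v j - lookup v (j + 1)) div int n) :: 'f laurent)"
  have sum_pull: "T l (xpow (scale c (simple_root m)) * f) = xpow (scale c (simple_root m)) * T l f"
    if "(l, m) \<in> {(i, j), (j, i)}" for l m c f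
    using that assms
    by (intro T_mult_invariant) (auto simp: simple_root_def lookup_minus lookup_eps)
  have geo_pull: "T l (geo (scale (int n) (simple_root m)) c * f) =
      geo (scale (int n) (simple_root m)) c * T l f"
    if "(l, m) \<in> {(i, j), (j, i)}" for l m c f
    by (simp add: geo_def left_diff_distrib T_lin sum_distrib_right scale_scale sum_pull[OF that])
  define Ai where "Ai = hk * gi +
    cst (G (lookup v i - lookup v (i + 1))) * xpow (scale (- (lookup v i - lookup v (i + 1))) (simple_root i))"
  define Aj where "Aj = hk * gj +
    cst (G (lookup v j - lookup v (j + 1))) * xpow (scale (- (lookup v j - lookup v (j + 1))) (simple_root j))"
  have Ti: "T i (xpow v) = Ai * xpow v"
    unfolding T_xpow[OF r(1,2)] Ai_def gi_def perm_act_simple_refl xpow_add by (simp add: algebra_simps)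
  have Tj: "T j (xpow v) = Aj * xpow v"
    unfolding T_xpow[OF r(3,4)] Aj_def gj_def perm_act_simple_refl xpow_add by (simp add: algebra_simps)
  have "T i (Aj * f) = Aj * T i f" for f
    by (simp only: Aj_def gj_def distrib_right mult.assoc T_lin geo_pull[of i j] sum_pull[of i j] insert_iff simp_thms)
  moreover have "T j (Ai * f) = Ai * T j f" for f
    by (simp only: Ai_def gi_def distrib_right mult.assoc T_lin geo_pull[of j i] sum_pull[of j i] insert_iff simp_thms)
  ultimately show "T i (T j (xpow v)) = T j (T i (xpow v))"
    by (simp add: Ti Tj mult.left_commute)
qed (intro linop_intros linop_T_comp)+

lemma T_braid:
  assumes "1 \<le> i" "i + 1 < r"
  shows "T i (T (i + 1) (T i f)) = T (i + 1) (T i (T (i + 1) f))"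
proof -
  define j where "j = i + 1"
  define B where "B f = T i (T j (T i f)) - T j (T i (T j f))" for f
  have r: "1 \<le> i" "i < r" "1 \<le> j" "j < r" using assms by (auto simp: j_def)
  have lin: "linop B"
    unfolding B_def by (intro linop_intros linop_T_comp)
  have Tij: "T i (X i * f) = X j * T' i f" "T i (X j * f) = X i * T i f + hk * (X j * f)"
    "T j (X j * f) = X (j + 1) * T' j f" "T j (X (j + 1) * f) = X j * T j f + hk * (X (j + 1) * f)"
    "T i (X (j + 1) * f) = X (j + 1) * T i f" "T j (X i * f) = X i * T j f" for f
    using T_X_left[OF r(1,2)] T_X_right[OF r(1,2)] T_X_left[OF r(3,4)] T_X_right[OF r(3,4)]
      T_X_other[OF r(1,2)] T_X_other[OF r(3,4)] by (simp_all add: j_def)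
  note TX = Tij T'_def T_lin
  note Tq = T_quadratic[OF r(1,2)] T_quadratic[OF r(3,4)]
  \<comment> \<open>Both braid words move \<open>X\<close> by the longest permutation of the three
    positions. The shorter words that arise cancel in the difference by the quadratic
    relation.\<close>
  have X1: "B (X i * f) = X (j + 1) * B f" for f
    unfolding B_def by (simp only: TX) (simp add: Tq algebra_simps)
  have X2: "B (X j * f) = X j * B f" for f
    unfolding B_def by (simp only: TX) (simp add: Tq algebra_simps)
  have X3: "B (X (j + 1) * f) = X i * B f" for f
    unfolding B_def by (simp only: TX) (simp add: Tq algebra_simps)
  have "B (xpow v) = 0" for v
  proof (rule residue_induct[where J = "{i, j, j + 1}"])
    fix l f assume "l \<in> {i, j, j + 1}"
    then show "B (X l * f) = 0 \<longleftrightarrow> B f = 0"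
      using X1[of f] X2[of f] X3[of f] X_nonzero by auto
  next
    fix v
    assume "\<And>l. l \<in> {i, j, j + 1} \<Longrightarrow> 0 \<le> lookup v l \<and> lookup v l < int n"
    from this[of i] this[of j] this[of "j + 1"]
    have b: "0 \<le> lookup v i" "lookup v i < int n" "0 \<le> lookup v j" "lookup v j < int n"
      "0 \<le> lookup v (j + 1)" "lookup v (j + 1) < int n"
      by auto
    define V where "V x y z = v + scale (x - lookup v i) (eps i) +
      scale (y - lookup v j) (eps j) + scale (z - lookup v (j + 1)) (eps (j + 1))" for x y z
    have lV: "lookup (V x y z) l =
        (if l = i then x else if l = j then y else if l = j + 1 then z else lookup v l)" for x y z l
      by (simp add: V_def lookup_add lookup_eps j_def)
    have sV: "perm_act (simple_refl i) (V x y z) = V y x z"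
      "perm_act (simple_refl j) (V x y z) = V x z y" for x y z
      by (intro poly_mapping_eqI; auto simp: lV simple_refl_apply j_def)+
    have Ti: "T i (xpow (V x y z)) = cst (sig (x - y)) * xpow (V y x z) +
        (if x < y then hk * xpow (V x y z) else 0)"
      if "0 \<le> x" "x < int n" "0 \<le> y" "y < int n" for x y z
      using T_small[OF r(1,2), of "V x y z"] that by (simp add: lV sV j_def)
    have Tj: "T j (xpow (V x y z)) = cst (sig (y - z)) * xpow (V x z y) +
        (if y < z then hk * xpow (V x y z) else 0)"
      if "0 \<le> z" "z < int n" "0 \<le> y" "y < int n" for x y z
      using T_small[OF r(3,4), of "V x y z"] that r by (simp add: lV sV) (simp add: j_def)
    obtain a c d where acd: "a = lookup v i" "c = lookup v j" "d = lookup v (j + 1)" by blast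
    have v: "v = V a c d" by (intro poly_mapping_eqI) (simp add: lV acd)
    have bd: "0 \<le> a" "a < int n" "0 \<le> c" "c < int n" "0 \<le> d" "d < int n" using b acd by auto
    have inv: "sig (y - x) = inverse (sig (x - y))" if "x < y" for x y
      using sig_inverse[of "x - y"] that sig_nonzero[of "x - y"] by (simp add: field_simps)
    have kk: "k * inverse k = 1" using k_nonzero by simp
    note simps = Ti Tj T_lin bd
    show "B (xpow v) = 0"
      unfolding v B_def
    proof (rule poly_mapping_eqI)
      fix u
      show "lookup (T i (T j (T i (xpow (V a c d)))) - T j (T i (T j (xpow (V a c d))))) u = lookup 0 u"
        \<comment> \<open>Entries in \<open>[0, n)\<close> leave only their relative order to be
          distinguished. The values \<open>sig (x - y)\<close> stay symbolic, with
          \<open>sig (y - x)\<close> as inverse and \<open>sig 0 = k\<close> for ties.\<close>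
        apply (cases a c rule: linorder_cases; cases c d rule: linorder_cases; cases a d rule: linorder_cases)
                            apply (simp_all add: simps)
                   apply (simp_all only: lookup_add lookup_minus lookup_cst_mult if_True if_False)
                   apply (simp_all add: inv sig_zero)
                   apply (use k_nonzero in \<open>simp_all add: field_simps\<close>)
        done
    qed
  qed simp
  then have "B f = 0" for f
    using linop_eqI[OF lin, of "\<lambda>_. 0"] by (simp add: linop_def)
  then show ?thesis by (simp add: B_def j_def)
qed

end

subsection \<open>Reduced words in the symmetric group\<close>

declare One_nat_def [simp del]

definition inversions :: "nat \<Rightarrow> (nat \<Rightarrow> nat) \<Rightarrow> (nat \<times> nat) set" where
  "inversions r u = {(a, b). 1 \<le> a \<and> a < b \<and> b \<le> r \<and> u b < u a}"

definition inv_num :: "nat \<Rightarrow> (nat \<Rightarrow> nat) \<Rightarrow> nat" where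
  "inv_num r u = card (inversions r u)"

lemma finite_inversions [simp]: "finite (inversions r u)"
  by (rule finite_subset[of _ "{1..r} \<times> {1..r}"]) (auto simp: inversions_def)

lemma simple_refl_simps [simp]:
  "simple_refl i \<circ> simple_refl i = id" "w \<circ> simple_refl i \<circ> simple_refl i = w"
  by (auto simp: fun_eq_iff)

lemma simple_refl_permutes: "1 \<le> i \<Longrightarrow> i < r \<Longrightarrow> simple_refl i permutes {1..r}"
  unfolding simple_refl_def by (rule permutes_swap_id) auto

lemma comp_simple_refl_permutes:
  "u permutes {1..r} \<Longrightarrow> 1 \<le> i \<Longrightarrow> i < r \<Longrightarrow> (u \<circ> simple_refl i) permutes {1..r}"
  by (intro permutes_compose simple_refl_permutes)

text \<open>Applying \<open>s_i\<close> to both members maps the inversions of \<open>u\<close>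
  bijectively to those of \<open>u s_i\<close> other than \<open>(i, i + 1)\<close>, which is
  new.\<close>

lemma inv_num_ascent:
  assumes "1 \<le> i" "i < r" "u i < u (i + 1)"
  shows "inv_num r (u \<circ> simple_refl i) = Suc (inv_num r u)"
proof -
  let ?s = "simple_refl i"
  have "inversions r (u \<circ> ?s) = insert (i, i + 1) (map_prod ?s ?s ` inversions r u)"
  proof (intro set_eqI iffI)
    fix p assume p: "p \<in> inversions r (u \<circ> ?s)"
    obtain a b where ab: "p = (a, b)" by fastforce
    show "p \<in> insert (i, i + 1) (map_prod ?s ?s ` inversions r u)"
    proof (cases "a = i \<and> b = i + 1")
      case False
      then have "(?s a, ?s b) \<in> inversions r u"
        using p assms unfolding ab by (auto simp: inversions_def simple_refl_apply split: if_splits)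
      then have "map_prod ?s ?s (?s a, ?s b) \<in> map_prod ?s ?s ` inversions r u" by blast
      then show ?thesis by (simp add: ab)
    qed (simp add: ab)
  next
    fix p assume "p \<in> insert (i, i + 1) (map_prod ?s ?s ` inversions r u)"
    then show "p \<in> inversions r (u \<circ> ?s)"
      using assms by (auto simp: inversions_def simple_refl_apply split: if_splits)
  qed
  moreover have "(i, i + 1) \<notin> map_prod ?s ?s ` inversions r u"
    by (auto simp: inversions_def simple_refl_apply split: if_splits)
  moreover have "inj (map_prod ?s ?s)"
    by (intro prod.inj_map bij_is_inj bij_simple_refl)
  ultimately show ?thesis
    by (simp add: inv_num_def card_image inj_on_subset)
qed

lemma inv_num_descent:
  assumes "1 \<le> i" "i < r" "u (i + 1) < u i"
  shows "inv_num r u = Suc (inv_num r (u \<circ> simple_refl i))"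
  using inv_num_ascent[of i r "u \<circ> simple_refl i"] assms by (simp add: simple_refl_apply)

text \<open>Going upwards from 1 gives \<open>j <= u j\<close>, going downwards from
  \<open>r\<close> gives \<open>u j <= j\<close>.\<close>

lemma permutes_no_descent:
  fixes u :: "nat \<Rightarrow> nat"
  assumes u: "u permutes {1..r}" and asc: "\<And>i. 1 \<le> i \<Longrightarrow> i < r \<Longrightarrow> u i < u (i + 1)"
  shows "u = id"
proof
  fix i
  show "u i = id i"
  proof (cases "i \<in> {1..r}")
    case True
    have ge: "j \<le> u j" if "1 \<le> j" "j \<le> r" for j
      using that
    proof (induction j rule: dec_induct)
      case base
      then show ?case using permutes_in_image[OF u, of 1] by simp
    next
      case (step j)
      then show ?case using asc[of j] by (simp flip: Suc_eq_plus1)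
    qed
    have le: "u j \<le> j" if "j \<le> r" "1 \<le> j" for j
      using that
    proof (induction j rule: inc_induct)
      case base
      then show ?case using permutes_in_image[OF u, of r] by simp
    next
      case (step j)
      then show ?case using asc[of j] by (simp flip: Suc_eq_plus1)
    qed
    show ?thesis using ge[of i] le[of i] True by simp
  qed (use u in \<open>auto simp: permutes_def\<close>)
qed

lemma sym_word_append: "sym_word (xs @ ys) = sym_word xs \<circ> sym_word ys"
  by (induction xs) (auto simp: sym_word_def)

lemma sym_word_Nil [simp]: "sym_word [] = id"
  and sym_word_Cons: "sym_word (i # ws) = simple_refl i \<circ> sym_word ws"
  and sym_word_snoc: "sym_word (ws @ [i]) = sym_word ws \<circ> simple_refl i"
  by (simp_all add: sym_word_append) (simp_all add: sym_word_def)

lemma sym_word_permutes: "set ws \<subseteq> {1..<r} \<Longrightarrow> sym_word ws permutes {1..r}"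
  by (induction ws rule: rev_induct)
    (auto simp: sym_word_snoc permutes_id[unfolded id_def[symmetric]] intro!: comp_simple_refl_permutes)

lemma inv_num_id [simp]: "inv_num r id = 0"
proof -
  have "inversions r id = {}" by (auto simp: inversions_def)
  then show ?thesis by (simp add: inv_num_def)
qed

lemma inv_num_le_length: "set ws \<subseteq> {1..<r} \<Longrightarrow> inv_num r (sym_word ws) \<le> length ws"
proof (induction ws rule: rev_induct)
  case (snoc i ws)
  let ?u = "sym_word ws"
  have i: "1 \<le> i" "i < r" using snoc.prems by auto
  have "?u i \<noteq> ?u (i + 1)"
    using permutes_inj[OF sym_word_permutes, of ws r] snoc.prems by (auto dest: injD)
  then consider "?u i < ?u (i + 1)" | "?u (i + 1) < ?u i" by linarith
  then show ?case
    using inv_num_ascent[OF i, of ?u] inv_num_descent[OF i, of ?u] snoc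
    unfolding sym_word_snoc by cases (simp_all del: o_apply)
qed simp

lemma word_of_length_inv_num:
  assumes "u permutes {1..r}"
  shows "\<exists>ws. set ws \<subseteq> {1..<r} \<and> sym_word ws = u \<and> length ws = inv_num r u"
  using assms
proof (induction "inv_num r u" arbitrary: u rule: less_induct)
  case less
  show ?case
  proof (cases "\<exists>i. 1 \<le> i \<and> i < r \<and> u (i + 1) < u i")
    case True
    then obtain i where i: "1 \<le> i" "i < r" "u (i + 1) < u i" by blast
    from less(1)[of "u \<circ> simple_refl i"] inv_num_descent[OF i] comp_simple_refl_permutes[OF less(2) i(1,2)]
    obtain ws where "set ws \<subseteq> {1..<r}" "sym_word ws = u \<circ> simple_refl i"
      "length ws = inv_num r (u \<circ> simple_refl i)" by auto
    then show ?thesis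
      using i inv_num_descent[OF i] by (intro exI[of _ "ws @ [i]"]) (auto simp: sym_word_snoc)
  next
    case False
    have "u i < u (i + 1)" if "1 \<le> i" "i < r" for i
      using False that injD[OF permutes_inj[OF less(2)], of i "i + 1"] by (metis Suc_eq_plus1 linorder_neqE_nat n_not_Suc_n)
    then have "u = id" by (rule permutes_no_descent[OF less(2)])
    then show ?thesis by (intro exI[of _ "[]"]) auto
  qed
qed

lemma sym_length_eq_inv_num:
  assumes "u permutes {1..r}"
  shows "sym_length r u = inv_num r u"
  unfolding sym_length_def cox_length_def
proof (rule Least_equality)
  show "\<exists>ws. set ws \<subseteq> {1..<r} \<and> sym_word ws = u \<and> length ws = inv_num r u"
    by (rule word_of_length_inv_num[OF assms])
  show "inv_num r u \<le> m" if "\<exists>ws. set ws \<subseteq> {1..<r} \<and> sym_word ws = u \<and> length ws = m" for m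
    using that inv_num_le_length by blast
qed

lemma sym_reduced_iff:
  "u permutes {1..r} \<Longrightarrow>
    sym_reduced r u ws \<longleftrightarrow> set ws \<subseteq> {1..<r} \<and> sym_word ws = u \<and> length ws = inv_num r u"
  unfolding sym_reduced_def reduced_word_def sym_length_def[symmetric]
  by (simp add: sym_length_eq_inv_num)

lemma sym_reduced_exists: "u permutes {1..r} \<Longrightarrow> \<exists>ws. sym_reduced r u ws"
  using word_of_length_inv_num by (simp add: sym_reduced_iff)

lemma sym_reduced_snocI:
  assumes "u permutes {1..r}" "sym_reduced r u ws" "1 \<le> i" "i < r" "u i < u (i + 1)"
  shows "sym_reduced r (u \<circ> simple_refl i) (ws @ [i])"
  using assms
  by (simp add: sym_reduced_iff comp_simple_refl_permutes inv_num_ascent[simplified] sym_word_snoc)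

text \<open>If the last letter were an ascent, \<open>u s_i\<close> would have more inversions than
  the remaining word has letters.\<close>

lemma sym_reduced_snocD:
  assumes "u permutes {1..r}" "sym_reduced r u (ws @ [i])"
  shows "1 \<le> i" "i < r" "u (i + 1) < u i" "sym_reduced r (u \<circ> simple_refl i) ws"
proof -
  have ws: "set ws \<subseteq> {1..<r}" "sym_word ws = u \<circ> simple_refl i" "Suc (length ws) = inv_num r u"
    and i: "1 \<le> i" "i < r"
    using assms by (auto simp: sym_reduced_iff sym_word_snoc)
  then have le: "inv_num r (u \<circ> simple_refl i) \<le> length ws"
    using inv_num_le_length by metis
  have "u i \<noteq> u (i + 1)" using injD[OF permutes_inj[OF assms(1)], of i "i + 1"] by auto
  then show d: "u (i + 1) < u i"
    using inv_num_ascent[OF i, of u] le ws(3) by (metis linorder_neqE_nat not_less_eq_eq le_SucI Suc_n_not_le_n)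
  show "1 \<le> i" "i < r" by fact+
  show "sym_reduced r (u \<circ> simple_refl i) ws"
    using ws inv_num_descent[OF i d] by (simp add: sym_reduced_iff comp_simple_refl_permutes assms(1) i)
qed

lemma simple_refl_commute:
  "i + 1 < j \<Longrightarrow> simple_refl i \<circ> simple_refl j = simple_refl j \<circ> simple_refl i"
  by (auto simp: fun_eq_iff simple_refl_apply)

lemma simple_refl_braid:
  "simple_refl i \<circ> simple_refl (i + 1) \<circ> simple_refl i =
    simple_refl (i + 1) \<circ> simple_refl i \<circ> simple_refl (i + 1)"
  by (auto simp: fun_eq_iff simple_refl_apply)

section \<open>The operators \<open>T_u\<close> for permutations \<open>u\<close>, independent of
  the reduced word\<close>

context metaplectic
begin

abbreviation "Tp \<equiv> T_perm r n k G"

text \<open>Matsumoto's theorem for the representation: two reduced words ending in different letters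
  are compared through a reduced word of the element with both descents removed.\<close>

lemma foldr_T_reduced_unique:
  assumes "u permutes {1..r}" "sym_reduced r u ws" "sym_reduced r u ws'"
  shows "foldr T ws = foldr T ws'"
  using assms
proof (induction "inv_num r u" arbitrary: u ws ws' rule: less_induct)
  case less
  have key: "foldr T (xs @ [i]) = foldr T (ys @ [j])"
    if red: "sym_reduced r u (xs @ [i])" "sym_reduced r u (ys @ [j])" and "i < j" for xs ys i j
  proof -
    let ?s = "simple_refl i" and ?t = "simple_refl j"
    note X = sym_reduced_snocD[OF less(2) red(1)] and Y = sym_reduced_snocD[OF less(2) red(2)]
    have IH: "foldr T ws1 = foldr T ws2"
      if "sym_reduced r v ws1" "sym_reduced r v ws2" "v \<in> {u \<circ> ?s, u \<circ> ?t}" for v ws1 ws2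
      using that less(1)[of v ws1 ws2] inv_num_descent[OF X(1-3)] inv_num_descent[OF Y(1-3)]
        comp_simple_refl_permutes[OF less(2)] X(1,2) Y(1,2) by auto
    show ?thesis
    proof (cases "j = i + 1")
      case False
      then have ij: "i + 1 < j" using \<open>i < j\<close> by simp
      define w where "w = u \<circ> ?s \<circ> ?t"
      have w: "w permutes {1..r}"
        unfolding w_def using X Y less(2) by (intro comp_simple_refl_permutes) auto
      obtain zs where zs: "sym_reduced r w zs" using sym_reduced_exists[OF w] by blast
      have ws: "w = u \<circ> ?t \<circ> ?s" unfolding w_def comp_assoc by (simp add: simple_refl_commute[OF ij])
      have "w j < w (j + 1)" "w i < w (i + 1)"
        using X(3) Y(3) ij by (auto simp: w_def simple_refl_apply)
      then have "sym_reduced r (u \<circ> ?s) (zs @ [j])" "sym_reduced r (u \<circ> ?t) (zs @ [i])"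
        using sym_reduced_snocI[OF w zs Y(1,2)] sym_reduced_snocI[OF w zs X(1,2)] ws
        by (auto simp: w_def)
      then have "foldr T xs = foldr T (zs @ [j])" "foldr T ys = foldr T (zs @ [i])"
        using IH[OF X(4)] IH[OF Y(4)] by auto
      then show ?thesis
        using T_commute[OF X(1) ij Y(2)] by (auto simp: fun_eq_iff)
    next
      case True
      define w where "w = u \<circ> ?s \<circ> ?t \<circ> ?s"
      have w: "w permutes {1..r}"
        unfolding w_def using X Y less(2) by (intro comp_simple_refl_permutes) auto
      obtain zs where zs: "sym_reduced r w zs" using sym_reduced_exists[OF w] by blast
      have "?s \<circ> (?t \<circ> ?s) = ?t \<circ> (?s \<circ> ?t)"
        using simple_refl_braid[of i] True by (simp add: comp_assoc)
      then have ws: "w = u \<circ> ?t \<circ> ?s \<circ> ?t" unfolding w_def comp_assoc by simp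
      have "w i < w (i + 1)" "(w \<circ> ?s) j < (w \<circ> ?s) (j + 1)"
        "w j < w (j + 1)" "(w \<circ> ?t) i < (w \<circ> ?t) (i + 1)"
        using X(3) Y(3) True by (auto simp: w_def simple_refl_apply)
      then have "sym_reduced r (w \<circ> ?s \<circ> ?t) ((zs @ [i]) @ [j])" "sym_reduced r (w \<circ> ?t \<circ> ?s) ((zs @ [j]) @ [i])"
        using X(1,2) Y(1,2) w zs by (auto intro!: sym_reduced_snocI comp_simple_refl_permutes simp del: append_assoc)
      moreover have "w \<circ> ?s \<circ> ?t = u \<circ> ?s" by (simp add: w_def)
      moreover have "w \<circ> ?t \<circ> ?s = u \<circ> ?t" by (simp add: ws)
      ultimately have "foldr T xs = foldr T (zs @ [i] @ [j])" "foldr T ys = foldr T (zs @ [j] @ [i])"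
        using IH[OF X(4)] IH[OF Y(4)] by auto
      then show ?thesis
        using T_braid[OF X(1)] Y(2) True by (auto simp: fun_eq_iff)
    qed
  qed
  show ?case
  proof (cases "ws = [] \<or> ws' = []")
    case True
    then show ?thesis using less by (auto simp: sym_reduced_iff)
  next
    case False
    then obtain xs i ys j where ws: "ws = xs @ [i]" "ws' = ys @ [j]"
      by (metis rev_exhaust)
    consider "i < j" | "j < i" | "i = j" by linarith
    then show ?thesis
    proof cases
      case 3
      note D = sym_reduced_snocD[OF less(2) less(3)[unfolded ws]]
      have "foldr T xs = foldr T ys"
        using less(1)[of "u \<circ> simple_refl i" xs ys] inv_num_descent[OF D(1-3)] D
          sym_reduced_snocD[OF less(2) less(4)[unfolded ws]] comp_simple_refl_permutes[OF less(2)] 3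
        by auto
      then show ?thesis using 3 by (simp add: ws fun_eq_iff)
    qed (use key less ws in metis)+
  qed
qed

lemma T_perm_reduced:
  assumes "u permutes {1..r}" "sym_reduced r u ws"
  shows "Tp u f = foldr T ws f"
  unfolding T_perm_def
  using foldr_T_reduced_unique[OF assms(1) _ assms(2)] sym_reduced_exists[OF assms(1)]
  by (metis someI_ex)

lemma linop_foldr_T: "linop (foldr T ws)"
  by (induction ws) (simp_all add: comp_def id_def linop_id linop_T_comp)

lemma linop_T_perm [simp]: "linop (Tp u)"
  unfolding T_perm_def by (rule linop_foldr_T)

lemma T_perm_id [simp]: "Tp id f = f"
  using T_perm_reduced[of id "[]"] by (simp add: sym_reduced_iff permutes_id[unfolded id_def[symmetric]])

lemma T_perm_ascent:
  assumes "u permutes {1..r}" "1 \<le> i" "i < r" "u i < u (i + 1)"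
  shows "Tp u (T i f) = Tp (u \<circ> simple_refl i) f"
proof -
  obtain ws where "sym_reduced r u ws" using sym_reduced_exists[OF assms(1)] by blast
  with sym_reduced_snocI[OF assms(1) this assms(2-4)] show ?thesis
    using assms by (simp add: T_perm_reduced comp_simple_refl_permutes)
qed

lemma T_perm_descent:
  assumes "u permutes {1..r}" "1 \<le> i" "i < r" "u (i + 1) < u i"
  shows "Tp u (T' i f) = Tp (u \<circ> simple_refl i) f"
  using T_perm_ascent[OF comp_simple_refl_permutes[OF assms(1-3)] assms(2,3), of "T' i f"] assms
  by (simp add: simple_refl_apply T_T')

end

subsection \<open>The affine generator\<close>

lemma cycle_apply:
  assumes "j \<le> m"
  shows "sym_word [j..<m] p = (if j \<le> p \<and> p < m then p + 1 else if p = m then j else p)"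
  using assms
proof (induction m arbitrary: p rule: dec_induct)
  case (step m)
  then show ?case by (auto simp: sym_word_snoc simple_refl_apply)
qed auto

text \<open>The cycle conjugates \<open>s_(i-1)\<close> to \<open>s_i\<close>. This is the
  group-level counterpart of passing \<open>T i\<close> through a chain of operators.\<close>

lemma cycle_conj:
  assumes "j < i" "i < r"
  shows "simple_refl i (sym_word [j..<r] (simple_refl (i - 1) p)) = sym_word [j..<r] p"
proof -
  obtain l where i: "i = l + 1" using assms by (metis add.commute less_imp_Suc_add plus_1_eq_Suc)
  have "j \<le> l" "l < r" "l + 1 < r" using assms i by auto
  then show ?thesis
    unfolding i by (simp add: cycle_apply simple_refl_apply)
qed

context metaplectic
begin

lemma foldr_T_fold_T': "set ws \<subseteq> {1..<r} \<Longrightarrow> foldr T ws (fold T' ws f) = f"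
  by (induction ws rule: rev_induct) (simp_all add: T_T')

lemma fold_T'_foldr_T: "set ws \<subseteq> {1..<r} \<Longrightarrow> fold T' ws (foldr T ws f) = f"
  by (induction ws) (simp_all add: T'_T)

lemma linop_fold_T: "linop (fold T ws)"
  by (induction ws rule: rev_induct) (simp_all add: comp_def id_def linop_id linop_T_comp)

lemma linop_fold_T': "linop (fold T' ws)"
  by (induction ws rule: rev_induct) (simp_all add: comp_def id_def linop_id linop_T'_comp)

lemma foldr_T_commute:
  assumes "1 \<le> i" "i + 1 < j" "m \<le> r"
  shows "T i (foldr T [j..<m] f) = foldr T [j..<m] (T i f)"
proof -
  have "T i (foldr T ws f) = foldr T ws (T i f)" if "set ws \<subseteq> {j..<m}" for ws
    using that assms by (induction ws) (auto simp: T_commute)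
  then show ?thesis by simp
qed

text \<open>Factors with index below \<open>i - 1\<close> commute with \<open>T i\<close>. At
  \<open>T_(i-1) T_i\<close> the braid relation turns it into \<open>T_(i-1)\<close>, which commutes
  with the rest.\<close>

lemma foldr_T_shift:
  assumes "1 \<le> j" "j < i" "i < m" "m \<le> r"
  shows "T i (foldr T [j..<m] f) = foldr T [j..<m] (T (i - 1) f)"
proof -
  have "j \<le> i - 1" using assms by simp
  then show ?thesis
    using assms(1)
  proof (induction j rule: inc_induct)
    case base
    define l where "l = i - 1"
    have i: "i = l + 1" using assms by (simp add: l_def)
    have "[l..<m] = l # (l + 1) # [l + 2..<m]"
      using assms i by (simp add: upt_conv_Cons)
    moreover have "1 \<le> l" "l + 1 < r" using base assms by (auto simp: l_def)
    moreover have "T l (foldr T [l + 2..<m] f) = foldr T [l + 2..<m] (T l f)"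
      using base assms l_def by (intro foldr_T_commute) auto
    ultimately show ?case
      using T_braid[of l "foldr T [l + 2..<m] f"]
      unfolding l_def[symmetric] i by simp
  next
    case (step j)
    then have "[j..<m] = j # [Suc j..<m]"
      using assms by (simp add: upt_conv_Cons)
    moreover have "T i (T j g) = T j (T i g)" for g
      using step assms by (intro T_commute[symmetric]) auto
    ultimately show ?case using step by simp
  qed
qed

text \<open>\<open>pi_op\<close> lifts the rotation \<open>v \<mapsto> (v\<^sub>r + n, v\<^sub>1, \<dots>, v\<^sub>r\<^sub>-\<^sub>1)\<close> of the extended affine Weyl group;
  since the rotation conjugates \<open>s\<^sub>r\<^sub>-\<^sub>1\<close> to \<open>s\<^sub>0\<close>, it yields the missing generator \<open>T\<^sub>0\<close>.\<close>

definition pi_op :: "'f laurent \<Rightarrow> 'f laurent" where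
  "pi_op f = X 1 * foldr T [1..<r] f"

definition pi_inv :: "'f laurent \<Rightarrow> 'f laurent" where
  "pi_inv f = fold T' [1..<r] (xpow (scale (- int n) (eps 1)) * f)"

lemma linop_pi_op: "linop pi_op"
  unfolding pi_op_def by (intro linop_lmult linop_foldr_T)

lemma linop_pi_inv: "linop pi_inv"
  unfolding linop_def pi_inv_def
proof (intro conjI allI)
  fix f g c
  let ?x = "xpow (scale (- int n) (eps 1)) :: 'f laurent"
  show "fold T' [1..<r] (?x * (f + g)) = fold T' [1..<r] (?x * f) + fold T' [1..<r] (?x * g)"
    unfolding distrib_left by (rule linop_add[OF linop_fold_T'])
  have "?x * (cst c * f) = cst c * (?x * f)" by (rule mult.left_commute)
  then show "fold T' [1..<r] (?x * (cst c * f)) = cst c * fold T' [1..<r] (?x * f)"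
    by (simp only: linop_cst[OF linop_fold_T'])
qed

lemma X_inverse: "X j * (xpow (scale (- int n) (eps j)) * f) = f"
  "xpow (scale (- int n) (eps j)) * (X j * f) = f"
proof -
  have "scale (int n) (eps j) + scale (- int n) (eps j) = (0 :: nat \<Rightarrow>\<^sub>0 int)"
    by (intro poly_mapping_eqI) (simp add: lookup_add)
  then have "X j * xpow (scale (- int n) (eps j)) = 1"
    unfolding X_def xpow_add[symmetric] by simp
  then have x: "X j * xpow (scale (- int n) (eps j)) * f = f" by simp
  then show "X j * (xpow (scale (- int n) (eps j)) * f) = f"
    by (simp only: mult.assoc)
  with x show "xpow (scale (- int n) (eps j)) * (X j * f) = f"
    by (simp only: mult.left_commute)
qed

lemma pi_op_inv [simp]: "pi_op (pi_inv f) = f" "pi_inv (pi_op f) = f"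
  by (simp_all add: pi_op_def pi_inv_def foldr_T_fold_T' fold_T'_foldr_T X_inverse)

definition T_aff :: "nat \<Rightarrow> 'f laurent \<Rightarrow> 'f laurent" where
  "T_aff i f = (if i = 0 then pi_op (T (r - 1) (pi_inv f)) else T i f)"

lemma linop_T_aff: "linop (T_aff i)"
proof (cases "i = 0")
  case True
  then have "T_aff i = (\<lambda>f. pi_op (T (r - 1) (pi_inv f)))" by (auto simp: T_aff_def)
  then show ?thesis
    using linop_comp[OF linop_pi_op linop_T_comp[OF linop_pi_inv]] by simp
next
  case False
  then have "T_aff i = T i" by (auto simp: T_aff_def)
  then show ?thesis by simp
qed

lemma T_perm_cycle:
  assumes "1 \<le> j" "j \<le> m" "m \<le> r"
  shows "Tp (sym_word [j..<m]) f = foldr T [j..<m] f"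
  using assms(2,1,3)
proof (induction m arbitrary: f rule: dec_induct)
  case (step m)
  have "Tp (sym_word [j..<m]) (T m f) = Tp (sym_word [j..<m] \<circ> simple_refl m) f"
    using step by (intro T_perm_ascent sym_word_permutes) (auto simp: cycle_apply)
  then show ?case using step by (simp add: sym_word_snoc del: o_apply)
qed simp

text \<open>The case needed is \<open>j = 1\<close>, but the induction on the length of
  \<open>u\<close> leaves it: removing a last letter \<open>i = j\<close> uses
  \<open>T_j X_j T_j = X_(j+1)\<close> and continues with \<open>j + 1\<close>. Letters away from
  \<open>j\<close> pass through the chain by commutation or an index shift. The ordering hypothesis
  rules out \<open>i + 1 = j\<close>, the one letter that would move \<open>X j\<close> the wrong
  way.\<close>

lemma T_perm_X_chain:
  assumes "u permutes {1..r}" "1 \<le> j" "j \<le> r" "\<And>i. 1 \<le> i \<Longrightarrow> i < j \<Longrightarrow> u i < u j"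
  shows "Tp u (X j * foldr T [j..<r] f) = X (u j) * Tp (u \<circ> sym_word [j..<r]) f"
  using assms
proof (induction "inv_num r u" arbitrary: u j f rule: less_induct)
  case less
  show ?case
  proof (cases "\<exists>i. 1 \<le> i \<and> i < r \<and> u (i + 1) < u i")
    case False
    have "u i < u (i + 1)" if "1 \<le> i" "i < r" for i
      using False that injD[OF permutes_inj[OF less(2)], of i "i + 1"]
      by (metis Suc_eq_plus1 linorder_neqE_nat n_not_Suc_n)
    then have "u = id" by (rule permutes_no_descent[OF less(2)])
    then show ?thesis using less by (simp add: T_perm_cycle)
  next
    case True
    then obtain i where i: "1 \<le> i" "i < r" "u (i + 1) < u i" by blast
    define u' where "u' = u \<circ> simple_refl i"
    have u': "u' permutes {1..r}"
      unfolding u'_def using i less(2) by (intro comp_simple_refl_permutes)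
    have asc: "u' i < u' (i + 1)" using i by (simp add: u'_def simple_refl_apply)
    have Tu: "Tp u g = Tp u' (T i g)" for g
      using T_perm_ascent[OF u' i(1,2) asc] by (simp add: u'_def del: o_apply)
    have inv: "inv_num r u' < inv_num r u"
      using inv_num_descent[OF i] by (simp add: u'_def)
    let ?c = "\<lambda>j. sym_word [j..<r]"
    have cyc: "?c j permutes {1..r}" if "1 \<le> j" for j
      using that by (intro sym_word_permutes) auto
    have uc: "(u' \<circ> ?c j) permutes {1..r}" by (rule permutes_compose[OF cyc[OF less(3)] u'])
    consider "i + 1 < j" | "i + 1 = j" | "i = j" | "j < i" by linarith
    then show ?thesis
    proof cases
      case 1
      have "Tp u (X j * foldr T [j..<r] f) = Tp u' (X j * foldr T [j..<r] (T i f))"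
        using i 1 by (simp add: Tu T_X_other foldr_T_commute)
      also have "\<dots> = X (u' j) * Tp (u' \<circ> ?c j) (T i f)"
        using less(3-5) 1 i by (intro less(1)[OF inv u']) (auto simp: u'_def simple_refl_apply)
      also have "\<dots> = X (u' j) * Tp (u' \<circ> ?c j \<circ> simple_refl i) f"
        using i asc 1 less(3,4) by (subst T_perm_ascent[OF uc])
          (auto simp: cycle_apply)
      also have "u' \<circ> ?c j \<circ> simple_refl i = u \<circ> ?c j"
        using i 1 less(3,4) by (auto simp: fun_eq_iff u'_def cycle_apply simple_refl_apply)
      finally have "Tp u (X j * foldr T [j..<r] f) = X (u' j) * Tp (u \<circ> ?c j) f" .
      moreover have "u' j = u j" using 1 by (simp add: u'_def simple_refl_apply)
      ultimately show ?thesis by (simp only:)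
    next
      case 2
      then show ?thesis using less(5)[of i] i by simp
    next
      case 3
      have "[j..<r] = j # [j + 1..<r]" using i 3 by (simp add: upt_conv_Cons flip: Suc_eq_plus1)
      then have "Tp u (X j * foldr T [j..<r] f) = Tp u' (X (j + 1) * foldr T [j + 1..<r] f)"
        using i 3 by (simp add: Tu T_X_left T'_T)
      also have "\<dots> = X (u' (j + 1)) * Tp (u' \<circ> ?c (j + 1)) f"
      proof (rule less(1)[OF inv u'])
        fix l assume "1 \<le> l" "l < j + 1"
        then show "u' l < u' (j + 1)"
          using less(5)[of l] i 3 by (cases "l = j") (auto simp: u'_def simple_refl_apply)
      qed (use i 3 in auto)
      also have "u' \<circ> ?c (j + 1) = u \<circ> ?c j"
        using i 3 by (auto simp: fun_eq_iff u'_def cycle_apply simple_refl_apply)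
      finally have "Tp u (X j * foldr T [j..<r] f) = X (u' (j + 1)) * Tp (u \<circ> ?c j) f" .
      moreover have "u' (j + 1) = u j" using 3 by (simp add: u'_def simple_refl_apply)
      ultimately show ?thesis by (simp only:)
    next
      case 4
      have "Tp u (X j * foldr T [j..<r] f) = Tp u' (X j * foldr T [j..<r] (T (i - 1) f))"
        using i 4 less(3) by (simp add: Tu T_X_other foldr_T_shift)
      also have "\<dots> = X (u' j) * Tp (u' \<circ> ?c j) (T (i - 1) f)"
        using less(3-5) 4 by (intro less(1)[OF inv u']) (auto simp: u'_def simple_refl_apply)
      also have "\<dots> = X (u' j) * Tp (u' \<circ> ?c j \<circ> simple_refl (i - 1)) f"
        using i asc 4 less(3,4) by (subst T_perm_ascent[OF uc])
          (auto simp: cycle_apply)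
      also have "u' \<circ> ?c j \<circ> simple_refl (i - 1) = u \<circ> ?c j"
        using cycle_conj[OF 4 i(2)] by (simp add: fun_eq_iff u'_def)
      finally have "Tp u (X j * foldr T [j..<r] f) = X (u' j) * Tp (u \<circ> ?c j) f" .
      moreover have "u' j = u j" using 4 by (simp add: u'_def simple_refl_apply)
      ultimately show ?thesis by (simp only:)
    qed
  qed
qed

lemma T_perm_pi:
  assumes "u permutes {1..r}"
  shows "Tp u (pi_op f) = X (u 1) * Tp (u \<circ> sym_word [1..<r]) f"
  unfolding pi_op_def using assms r_ge_2 by (intro T_perm_X_chain) auto

text \<open>Alcoves are indexed by the unscaled group, so a translation part is dilated by
  \<open>n\<close> here.\<close>

definition X_aff :: "aff \<Rightarrow> 'f laurent \<Rightarrow> 'f laurent" where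
  "X_aff A f = xpow (scale (int n) (fst A)) * Tp (snd A) f"

lemma linop_X_aff: "linop (X_aff A)"
  unfolding X_aff_def by (intro linop_lmult linop_T_perm)

text \<open>\<open>ascending A i\<close> says that \<open>A\<close> lies on the positive side of the wall between \<open>A\<close> and
  \<open>A s\<^sub>i\<close>.\<close>

definition ascending :: "aff \<Rightarrow> nat \<Rightarrow> bool" where
  "ascending A i \<longleftrightarrow> (if i = 0 then snd A r < snd A 1 else snd A i < snd A (i + 1))"

text \<open>For \<open>i > 0\<close> this is multiplication of \<open>T_u\<close> by
  \<open>T_i\<close> or its inverse. For \<open>i = 0\<close>, write \<open>f = pi_op g\<close>:
  passing \<open>T_u\<close> through \<open>pi_op\<close> replaces \<open>u\<close> by
  \<open>u c\<close> with the cycle \<open>c\<close>, and the step becomes the finite one with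
  letter \<open>r - 1\<close>. Since \<open>u c\<close> sends \<open>r - 1\<close> to
  \<open>u r\<close> and \<open>r\<close> to \<open>u 1\<close>, an ascent there means
  \<open>u r < u 1\<close>.\<close>

lemma X_aff_step:
  assumes A: "snd A permutes {1..r}" and i: "i < r"
  shows "ascending A i \<Longrightarrow> X_aff A (T_aff i f) = X_aff (aff_mult A (aff_gen r 1 i)) f"
    and "\<not> ascending A i \<Longrightarrow>
      X_aff A (T_aff i f - hk * f) = X_aff (aff_mult A (aff_gen r 1 i)) f"
proof -
  let ?u = "snd A" and ?c = "sym_word [1..<r]" and ?B = "aff_mult A (aff_gen r 1 i)"
  have inj: "?u a = ?u b \<longleftrightarrow> a = b" for a b
    using permutes_inj[OF A] by (auto dest: injD)
  have "(ascending A i \<longrightarrow> X_aff A (T_aff i f) = X_aff ?B f) \<and>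
    (\<not> ascending A i \<longrightarrow> X_aff A (T_aff i f - hk * f) = X_aff ?B f)"
  proof (cases "i = 0")
    case False
    then have B: "?B = (fst A, ?u \<circ> simple_refl i)"
      using permutes_bij[OF A]
      by (simp add: aff_mult_def aff_gen_def) (intro poly_mapping_eqI, simp add: lookup_perm_act)
    show ?thesis
      using T_perm_ascent[OF A _ i, of f] T_perm_descent[OF A _ i, of f] False inj[of i "i + 1"]
      by (auto simp: ascending_def B X_aff_def T_aff_def T'_def)
  next
    case True
    have c: "?c permutes {1..r}" by (rule sym_word_permutes) auto
    let ?\<theta> = "transpose 1 r"
    have \<theta>: "?\<theta> permutes {1..r}" using r_ge_2 by (intro permutes_swap_id) auto
    have B: "?B = (fst A + (eps (?u 1) - eps (?u r)), ?u \<circ> ?\<theta>)"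
      using True permutes_bij[OF A]
      by (auto simp: aff_mult_def aff_gen_def highest_root_def lookup_perm_act lookup_minus
          lookup_eps lookup_add bij_inv_eq_iff intro!: poly_mapping_eqI)
    define g where "g = pi_inv f"
    have f: "f = pi_op g" by (simp add: g_def)
    have uc: "(?u \<circ> ?c) permutes {1..r}" by (rule permutes_compose[OF c A])
    have r: "1 \<le> r - 1" "r - 1 < r" "r - 1 + 1 = r" using r_ge_2 by auto
    \<comment> \<open>The cycle conjugates \<open>s_(r-1)\<close> to the transposition of 1 and
      \<open>r\<close>, the permutation part of the affine generator.\<close>
    have "?u \<circ> ?c \<circ> simple_refl (r - 1) = ?u \<circ> ?\<theta> \<circ> ?c"
      using r_ge_2 by (auto simp: fun_eq_iff cycle_apply simple_refl_apply transpose_def)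
    note Tc = this
    have \<theta>f: "X_aff ?B f =
        xpow (scale (int n) (fst A)) * (X (?u 1) * Tp (?u \<circ> ?\<theta> \<circ> ?c) g)"
    proof -
      have "scale (int n) (fst A + (eps (?u 1) - eps (?u r))) + scale (int n) (eps (?u r)) =
          scale (int n) (fst A) + scale (int n) (eps (?u 1))"
        by (intro poly_mapping_eqI) (simp add: lookup_add lookup_minus algebra_simps)
      then have "xpow (scale (int n) (fst A + (eps (?u 1) - eps (?u r)))) * X (?u r) =
          xpow (scale (int n) (fst A)) * X (?u 1)"
        unfolding X_def xpow_add[symmetric] by simp
      then show ?thesis
        unfolding X_aff_def B f
        using T_perm_pi[OF permutes_compose[OF \<theta> A], of g] by (simp add: flip: mult.assoc)
    qed
    have T: "X_aff A (T_aff i f) =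
        xpow (scale (int n) (fst A)) * (X (?u 1) * Tp (?u \<circ> ?c) (T (r - 1) g))"
      using True T_perm_pi[OF A, of "T (r - 1) g"] by (simp add: X_aff_def T_aff_def g_def)
    have T': "X_aff A (T_aff i f - hk * f) =
        xpow (scale (int n) (fst A)) * (X (?u 1) * Tp (?u \<circ> ?c) (T' (r - 1) g))"
    proof -
      have "T_aff i f - hk * f = pi_op (T' (r - 1) g)"
        using True by (simp add: T_aff_def T'_def g_def linop_diff[OF linop_pi_op]
            linop_cst[OF linop_pi_op])
      then show ?thesis
        using T_perm_pi[OF A, of "T' (r - 1) g"] by (simp add: X_aff_def)
    qed
    have asc: "ascending A i \<longleftrightarrow> (?u \<circ> ?c) (r - 1) < (?u \<circ> ?c) (r - 1 + 1)"
      using True r_ge_2 by (auto simp: ascending_def cycle_apply)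
    have desc: "\<not> ascending A i \<Longrightarrow> (?u \<circ> ?c) (r - 1 + 1) < (?u \<circ> ?c) (r - 1)"
      using True r_ge_2 inj[of r 1] by (auto simp: ascending_def cycle_apply)
    show ?thesis
      unfolding \<theta>f T T'
      using T_perm_ascent[OF uc r(1,2), of g] T_perm_descent[OF uc r(1,2), of g] asc desc
      by (simp add: Tc)
  qed
  then show "ascending A i \<Longrightarrow> X_aff A (T_aff i f) = X_aff ?B f"
    and "\<not> ascending A i \<Longrightarrow> X_aff A (T_aff i f - hk * f) = X_aff ?B f"
    by blast+
qed

end

subsection \<open>The operators \<open>Y\<^sub>j\<close>\<close>

lemma lookup_rotate_vec:
  assumes "r \<ge> 1"
  shows "lookup (rotate_vec r v) j =
    (if j = 1 then lookup v r else if 2 \<le> j \<and> j \<le> r then lookup v (j - 1) else 0)"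
proof -
  have "(\<Sum>i=1..<r. lookup (Poly_Mapping.single (i + 1) (lookup v i)) j) =
      (\<Sum>i=1..<r. if i = j - 1 then if j \<ge> 2 then lookup v i else 0 else 0)"
    by (rule sum.cong) (auto simp: lookup_single when_def)
  also have "\<dots> = (if 2 \<le> j \<and> j \<le> r then lookup v (j - 1) else 0)"
    by auto
  finally show ?thesis
    by (auto simp: rotate_vec_def lookup_add lookup_sum lookup_single when_def)
qed

lemma rotate_vec_add:
  assumes "r \<ge> 1"
  shows "rotate_vec r (u + v) = rotate_vec r u + rotate_vec r v"
  by (intro poly_mapping_eqI) (simp add: lookup_rotate_vec[OF assms] lookup_add)

context metaplectic
begin

abbreviation "om \<equiv> omega_op r q"

lemma linop_om: "linop om"
  unfolding omega_op_def by (rule linop_lin_ext)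

lemma om_xpow: "om (xpow v) = cst (q powi (- lookup v r)) * xpow (rotate_vec r v)"
  by (simp add: omega_op_def scale_laurent)

lemma om_mult: "om (xpow \<beta> * f) = cst (q powi (- lookup \<beta> r)) * xpow (rotate_vec r \<beta>) * om f"
proof (rule linop_eqI[where F = "\<lambda>f. om (xpow \<beta> * f)"])
  show "linop (\<lambda>f. om (xpow \<beta> * f))"
    by (rule linop_comp[OF linop_om linop_mult])
  show "linop (\<lambda>f. cst (q powi (- lookup \<beta> r)) * xpow (rotate_vec r \<beta>) * om f)"
    by (intro linop_lmult linop_om)
  fix v
  have "q powi (- lookup (\<beta> + v) r) = q powi (- lookup \<beta> r) * q powi (- lookup v r)"
    using q_nonzero by (simp add: lookup_add flip: power_int_add)
  then show "om (xpow \<beta> * xpow v) =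
      cst (q powi (- lookup \<beta> r)) * xpow (rotate_vec r \<beta>) * om (xpow v)"
    using r_ge_2
    by (simp add: om_xpow rotate_vec_add cst_mult xpow_add mult.assoc mult.left_commute flip: xpow_add)
qed

lemma om_X:
  assumes "1 \<le> j" "j < r"
  shows "om (X j * f) = X (j + 1) * om f"
proof -
  have "rotate_vec r (scale (int n) (eps j)) = scale (int n) (eps (j + 1))"
    using assms by (intro poly_mapping_eqI) (auto simp: lookup_rotate_vec lookup_eps)
  then show ?thesis
    using assms by (simp add: X_def om_mult lookup_eps)
qed

lemma om_X_last: "om (X r * f) = cst (q powi (- int n)) * (X 1 * om f)"
proof -
  have "rotate_vec r (scale (int n) (eps r)) = scale (int n) (eps 1)"
    using r_ge_2 by (intro poly_mapping_eqI) (auto simp: lookup_rotate_vec lookup_eps)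
  then show ?thesis
    by (simp add: X_def om_mult lookup_eps mult.assoc)
qed

text \<open>The rotation carries \<open>alpha_i\<close> to \<open>alpha_(i+1)\<close>. No power of
  \<open>q\<close> appears because \<open>alpha_i\<close> has entry 0 at position
  \<open>r\<close>.\<close>

lemma om_T:
  assumes "1 \<le> i" "i + 1 < r"
  shows "om (T i f) = T (i + 1) (om f)"
proof (rule linop_eqI[where F = "\<lambda>f. om (T i f)"])
  show "linop (\<lambda>f. om (T i f))"
    by (rule linop_comp[OF linop_om linop_T])
  show "linop (\<lambda>f. T (i + 1) (om f))"
    by (rule linop_T_comp[OF linop_om])
  fix v
  let ?a = "lookup v i - lookup v (i + 1)" and ?w = "rotate_vec r v"
  have ir: "1 \<le> i" "i < r" "1 \<le> i + 1" "i + 1 < r" using assms by auto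
  have rot: "rotate_vec r (scale c (simple_root i)) = scale c (simple_root (i + 1))" for c
    using assms by (intro poly_mapping_eqI)
      (auto simp: lookup_rotate_vec lookup_eps simple_root_def lookup_minus)
  have "lookup (simple_root i) r = (0 :: int)"
    using assms by (simp add: simple_root_def lookup_minus lookup_eps)
  then have om_root: "om (xpow (scale c (simple_root i)) * f) = xpow (scale c (simple_root (i + 1))) * om f" for c f
    by (simp add: om_mult rot)
  have om_geo: "om (geo (scale (int n) (simple_root i)) c * f) =
      geo (scale (int n) (simple_root (i + 1))) c * om f" for c f
    by (simp add: geo_def left_diff_distrib linop_diff[OF linop_om] linop_sum[OF linop_om]
        sum_distrib_right scale_scale om_root)
  have w: "lookup ?w (i + 1) - lookup ?w (i + 1 + 1) = ?a"
    using assms by (simp add: lookup_rotate_vec)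
  have "om (T i (xpow v)) = hk * (geo (scale (int n) (simple_root (i + 1))) (?a div int n) * om (xpow v)) +
      cst (G ?a) * (xpow (scale (- ?a) (simple_root (i + 1))) * om (xpow v))"
    unfolding T_xpow[OF ir(1,2)] perm_act_simple_refl xpow_add mult.commute[of "xpow v"]
    by (simp only: linop_add[OF linop_om] linop_cst[OF linop_om] om_geo om_root)
  also have "\<dots> = cst (q powi (- lookup v r)) * T (i + 1) (xpow ?w)"
    unfolding T_xpow[OF ir(3,4)] w om_xpow perm_act_simple_refl xpow_add
    by (simp add: algebra_simps)
  also have "\<dots> = T (i + 1) (om (xpow v))"
    unfolding om_xpow by (rule linop_cst[OF linop_T, symmetric])
  finally show "om (T i (xpow v)) = T (i + 1) (om (xpow v))" .
qed

lemma om_foldr_T: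
  assumes "m < r"
  shows "om (foldr T [1..<m] f) = foldr T [2..<m + 1] (om f)"
  using assms
proof (induction m arbitrary: f)
  case (Suc m)
  show ?case
  proof (cases "1 \<le> m")
    case True
    then have "[1..<Suc m] = [1..<m] @ [m]" "[2..<Suc m + 1] = [2..<m + 1] @ [m + 1]" by auto
    then show ?thesis using Suc om_T[of m f] True by simp
  qed (simp add: not_le)
qed simp

lemma fold_T_commute:
  assumes "1 \<le> i" "i + 1 < j" "m \<le> r"
  shows "T i (fold T [j..<m] f) = fold T [j..<m] (T i f)"
proof -
  have "T i (fold T ws f) = fold T ws (T i f)" if "set ws \<subseteq> {j..<m}" for ws
    using that assms by (induction ws arbitrary: f) (auto simp: T_commute)
  then show ?thesis by simp
qed

lemma fold_T_shift:
  assumes "1 \<le> j" "j < i" "i < m" "m \<le> r"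
  shows "fold T [j..<m] (T i f) = T (i - 1) (fold T [j..<m] f)"
proof -
  have "j \<le> i - 1" using assms by simp
  then show ?thesis
    using assms(1)
  proof (induction j arbitrary: f rule: inc_induct)
    case base
    define l where "l = i - 1"
    have i: "i = l + 1" using assms by (simp add: l_def)
    have "[l..<m] = l # (l + 1) # [l + 2..<m]"
      using assms i by (simp add: upt_conv_Cons)
    moreover have "1 \<le> l" "l + 1 < r" using base assms by (auto simp: l_def)
    moreover have "T l (fold T [l + 2..<m] g) = fold T [l + 2..<m] (T l g)" for g
      using base assms l_def by (intro fold_T_commute) auto
    ultimately show ?case
      using T_braid[of l f]
      unfolding l_def[symmetric] i by simp
  next
    case (step j)
    then have "[j..<m] = j # [Suc j..<m]"
      using assms by (simp add: upt_conv_Cons)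
    moreover have "T j (T i g) = T i (T j g)" for g
      using step assms by (intro T_commute) auto
    ultimately show ?case using step by simp
  qed
qed

text \<open>\<open>Y_op\<close> with \<open>T'\<close> in place of \<open>T_inv\<close>, hence
  defined on the whole group ring. The two agree on Laurent polynomials in the \<open>r\<close>
  variables by \<open>Y_op_eq\<close>.\<close>

definition Y :: "nat \<Rightarrow> 'f laurent \<Rightarrow> 'f laurent" where
  "Y j f = fold T' [1..<j] (om (fold T [j..<r] f))"

lemma Y_add: "Y j (f + g) = Y j f + Y j g"
  and Y_cst: "Y j (cst c * f) = cst c * Y j f"
  by (simp_all add: Y_def linop_add[OF linop_fold_T] linop_add[OF linop_fold_T'] linop_add[OF linop_om]
      linop_cst[OF linop_fold_T] linop_cst[OF linop_fold_T'] linop_cst[OF linop_om])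

lemma Y_Suc:
  assumes "1 \<le> i" "i < r"
  shows "Y (i + 1) f = T' i (Y i (T' i f))"
proof -
  have "[i..<r] = i # [i + 1..<r]" "[1..<i + 1] = [1..<i] @ [i]"
    using assms upt_Suc_append[of 1 i] by (simp_all only: upt_conv_Cons Suc_eq_plus1)
  then show ?thesis
    using assms by (simp add: Y_def T_T')
qed

lemma fold_T'_commute:
  assumes "1 \<le> m" "m < i" "i < r"
  shows "T i (fold T' [1..<m] f) = fold T' [1..<m] (T i f)"
proof -
  have "T i (fold T' ws f) = fold T' ws (T i f)" if "set ws \<subseteq> {1..<m}" for ws
    using that assms
    by (induction ws arbitrary: f) (auto simp: T_commute[symmetric] T'_def T_lin)
  then show ?thesis by simp
qed

lemma fold_T'_shift:
  assumes "1 \<le> i" "i + 1 < m" "m \<le> r"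
  shows "fold T' [1..<m] (T (i + 1) f) = T i (fold T' [1..<m] f)"
proof -
  define g where "g = fold T' [1..<m] f"
  have s: "set [1..<m] \<subseteq> {1..<r}" using assms by auto
  have "f = foldr T [1..<m] g" using foldr_T_fold_T'[OF s] by (simp add: g_def)
  then have "T (i + 1) f = foldr T [1..<m] (T i g)"
    using foldr_T_shift[of 1 "i + 1" m g] assms by simp
  then show ?thesis using fold_T'_foldr_T[OF s] by (simp add: g_def)
qed

text \<open>For \<open>j < i\<close> the inner chain lowers the index of \<open>T i\<close> by one
  and the rotation raises it again. For \<open>i + 1 < j\<close> the rotation raises it and the
  outer chain of inverses lowers it.\<close>

lemma Y_T:
  assumes "1 \<le> i" "i < r" "1 \<le> j" "j \<le> r" "j \<noteq> i" "j \<noteq> i + 1"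
  shows "Y j (T i f) = T i (Y j f)"
proof (cases "j < i")
  case True
  then have "fold T [j..<r] (T i f) = T (i - 1) (fold T [j..<r] f)"
    using assms by (intro fold_T_shift) auto
  moreover have "om (T (i - 1) (fold T [j..<r] f)) = T i (om (fold T [j..<r] f))"
    using om_T[of "i - 1" "fold T [j..<r] f"] True assms by simp
  ultimately show ?thesis
    using fold_T'_commute[of j i] True assms by (simp add: Y_def)
next
  case False
  then have "i + 1 < j" using assms by simp
  then show ?thesis
    using assms fold_T_commute[of i j r f] om_T[of i "fold T [j..<r] f"]
      fold_T'_shift[of i j "om (fold T [j..<r] f)"]
    by (simp add: Y_def)
qed

lemma T_pi:
  assumes "1 < i" "i < r"
  shows "T i (pi_op f) = pi_op (T (i - 1) f)"
  using assms by (simp add: pi_op_def T_X_other foldr_T_shift)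

lemma T'_pi:
  assumes "1 < i" "i < r"
  shows "T' i (pi_op f) = pi_op (T' (i - 1) f)"
  using assms by (simp add: T'_def T_pi linop_diff[OF linop_pi_op] linop_cst[OF linop_pi_op])

text \<open>The chain in \<open>Y 1\<close> turns \<open>X 1\<close> into \<open>X r\<close> while
  consuming the chain of \<open>pi_op\<close>. Rotating \<open>X r\<close> back to
  \<open>X 1\<close> costs \<open>q^(-n)\<close>.\<close>

lemma Y_1_pi: "Y 1 (pi_op f) = cst (q powi (- int n)) * pi_op (Y r f)"
proof -
  have "fold T [1..<m] (X 1 * g) = X m * fold T' [1..<m] g" if "1 \<le> m" "m \<le> r" for m g
    using that
  proof (induction m rule: dec_induct)
    case (step m)
    then show ?case using T_X_left[of m] by (simp flip: Suc_eq_plus1)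
  qed simp
  from this[of r "foldr T [1..<r] f"]
  have "fold T [1..<r] (pi_op f) = X r * f"
    using r_ge_2 by (simp add: pi_op_def fold_T'_foldr_T)
  then show ?thesis
    by (simp add: Y_def om_X_last pi_op_def foldr_T_fold_T')
qed

lemma T'_X_right: 
  assumes "1 \<le> i" "i < r"
  shows "T' i (X (i + 1) * f) = X i * T i f"
  using T_X_right[OF assms] by (simp add: T'_def)

text \<open>Only \<open>j = 1\<close> needs the chains. The rest follows from
  \<open>Y_(j+1) = T_j^-1 Y_j T_j^-1\<close>, since \<open>pi_op\<close> raises the index of
  \<open>T'\<close> by one.\<close>

lemma Y_pi:
  assumes "1 \<le> j" "j < r"
  shows "Y (j + 1) (pi_op f) = pi_op (Y j f)"
  using assms
proof (induction j arbitrary: f rule: dec_induct)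
  case base
  have r: "[1..<r] = 1 # [2..<r]" "[1..<r] = [1..<r - 1] @ [r - 1]" "[1..<1 + 1] = [1]"
    using r_ge_2 upt_Suc_append[of 1 "r - 1"] by (simp_all add: upt_conv_Cons)
  have shift: "fold T ws (foldr T [1..<r] g) = foldr T [1..<r] (fold T (map (\<lambda>i. i - 1) ws) g)"
    if "set ws \<subseteq> {2..<r}" for ws g
    using that
    by (induction ws arbitrary: g) (auto simp: foldr_T_shift)
  have "map (\<lambda>i. i - 1) [2..<r] = [1..<r - 1]"
    by (rule nth_equalityI) auto
  then have s: "fold T [2..<r] (foldr T [1..<r] f) = foldr T [1..<r] (fold T [1..<r - 1] f)"
    using shift[of "[2..<r]" f] by simp
  have comm: "fold T [2..<r] (X 1 * g) = X 1 * fold T [2..<r] g" for g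
  proof -
    have "fold T ws (X 1 * g) = X 1 * fold T ws g" if "set ws \<subseteq> {2..<r}" for ws
      using that by (induction ws arbitrary: g) (auto simp: T_X_other)
    then show ?thesis by simp
  qed
  have "Y (1 + 1) (pi_op f) = T' 1 (om (X 1 * foldr T [1..<r] (fold T [1..<r - 1] f)))"
    unfolding Y_def pi_op_def r(3) by (simp add: comm s)
  also have "\<dots> = X 1 * T 1 (om (foldr T [1..<r] (fold T [1..<r - 1] f)))"
    using r_ge_2 T'_X_right[of 1] by (simp add: om_X)
  \<comment> \<open>The middle factor \<open>T_(r-1)\<close> changes sides and completes the inner
    chain of \<open>Y 1\<close>.\<close>
  also have "foldr T [1..<r] (fold T [1..<r - 1] f) = foldr T [1..<r - 1] (fold T [1..<r] f)"
    unfolding r(2) by simp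
  also have "om \<dots> = foldr T [2..<r] (om (fold T [1..<r] f))"
    using om_foldr_T[of "r - 1"] r_ge_2 by simp
  also have "X 1 * T 1 \<dots> = pi_op (Y 1 f)"
    unfolding pi_op_def Y_def by (subst (2) r(1)) simp
  finally show ?case .
next
  case (step j)
  have "Y (Suc j + 1) (pi_op f) = T' (j + 1) (Y (j + 1) (T' (j + 1) (pi_op f)))"
    using Y_Suc[of "j + 1" "pi_op f"] step by (simp flip: Suc_eq_plus1)
  also have "\<dots> = pi_op (T' j (Y j (T' j f)))"
    using step by (simp add: T'_pi)
  also have "\<dots> = pi_op (Y (Suc j) f)"
    using Y_Suc[of j f] step by (simp flip: Suc_eq_plus1)
  finally show ?case .
qed

section \<open>Joint eigenvectors of the \<open>Y_j\<close> and intertwiners between them\<close>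

definition eigen :: "'f laurent \<Rightarrow> (nat \<Rightarrow> 'f) \<Rightarrow> bool" where
  "eigen f g \<longleftrightarrow> (\<forall>j\<in>{1..r}. Y j f = cst (g j) * f)"

lemma eigen_cong: "eigen f g \<Longrightarrow> (\<And>j. j \<in> {1..r} \<Longrightarrow> g j = g' j) \<Longrightarrow> eigen f g'"
  by (simp add: eigen_def)

lemma eigen_cst: "eigen f g \<Longrightarrow> eigen (cst c * f) g"
  by (simp add: eigen_def Y_cst mult.left_commute)

lemma pi_op_eigen:
  assumes "eigen f g"
  shows "eigen (pi_op f) (\<lambda>j. if j = 1 then q powi (- int n) * g r else g (j - 1))"
  unfolding eigen_def
proof
  fix j assume j: "j \<in> {1..r}"
  show "Y j (pi_op f) = cst (if j = 1 then q powi (- int n) * g r else g (j - 1)) * pi_op f"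
  proof (cases "j = 1")
    case True
    then show ?thesis
      using assms r_ge_2
      by (simp add: eigen_def Y_1_pi linop_cst[OF linop_pi_op] cst_mult mult.assoc)
  next
    case False
    then have "1 \<le> j - 1" "j - 1 < r" "j - 1 + 1 = j" using j by auto
    then show ?thesis
      using assms Y_pi[of "j - 1" f] False
      by (simp add: eigen_def linop_cst[OF linop_pi_op])
  qed
qed

lemma pi_inv_eigen:
  assumes "eigen f g"
  shows "eigen (pi_inv f) (\<lambda>j. if j = r then q powi int n * g 1 else g (j + 1))"
  unfolding eigen_def
proof
  fix j assume j: "j \<in> {1..r}"
  define f' where "f' = pi_inv f"
  have f: "f = pi_op f'" by (simp add: f'_def)
  have c: "pi_inv (cst c * f) = cst c * f'" for c
    by (simp add: f'_def linop_cst[OF linop_pi_inv])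
  show "Y j (pi_inv f) = cst (if j = r then q powi int n * g 1 else g (j + 1)) * pi_inv f"
  proof (cases "j = r")
    case True
    have q: "q powi int n * q powi (- int n) = 1"
      using q_nonzero by (simp add: power_int_minus)
    have "Y 1 f = cst (g 1) * f" using assms r_ge_2 by (simp add: eigen_def)
    then have "cst (q powi (- int n)) * pi_op (Y r f') = cst (g 1) * f"
      using Y_1_pi[of f'] f by simp
    then have "pi_inv (cst (q powi (- int n)) * pi_op (Y r f')) = cst (g 1) * f'"
      using c by simp
    then have "cst (q powi (- int n)) * Y r f' = cst (g 1) * f'"
      by (simp add: linop_cst[OF linop_pi_inv])
    then have "cst (q powi int n) * (cst (q powi (- int n)) * Y r f') = cst (q powi int n) * (cst (g 1) * f')"
      by (rule arg_cong)
    then have "Y r f' = cst (q powi int n * g 1) * f'"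
      unfolding mult.assoc[symmetric] cst_mult[symmetric] q by simp
    then show ?thesis using True by (simp add: f'_def)
  next
    case False
    have "Y (j + 1) f = cst (g (j + 1)) * f" using assms j False by (simp add: eigen_def)
    then have "pi_op (Y j f') = cst (g (j + 1)) * f"
      using Y_pi[of j f'] j False f by simp
    then have "pi_inv (pi_op (Y j f')) = cst (g (j + 1)) * f'"
      using c by simp
    then show ?thesis using False by (simp add: f'_def)
  qed
qed

text \<open>On the span of \<open>f\<close> and \<open>T i f\<close> the operators
  \<open>Y i\<close> and \<open>Y (i + 1)\<close> are triangular with \<open>g i\<close> and
  \<open>g (i + 1)\<close> on the diagonal. The shift \<open>c\<close> is the one that diagonalises
  both; the remaining \<open>Y j\<close> commute with \<open>T i\<close>.\<close>

lemma T_eigen: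
  assumes "eigen f g" and i: "1 \<le> i" "i < r" and g: "g i \<noteq> 0" "g (i + 1) \<noteq> g i"
    and c: "c = (inverse k - k) / (1 - g (i + 1) / g i)"
  shows "eigen (T i f + cst c * f) (\<lambda>j. g (simple_refl i j))"
  unfolding eigen_def
proof
  fix j assume j: "j \<in> {1..r}"
  have Y: "Y l f = cst (g l) * f" if "l \<in> {1..r}" for l
    using assms(1) that by (simp add: eigen_def)
  \<comment> \<open>This single equation cancels the terms in \<open>f\<close> for both
    \<open>Y i\<close> and \<open>Y (i + 1)\<close>.\<close>
  have ci: "c * (g i - g (i + 1)) = (inverse k - k) * g i"
    using g c by (simp add: field_simps)
  have Yi1: "Y (i + 1) (T i f) = cst (g i) * T' i f"
    using Y_Suc[OF i, of "T i f"] T'_T[OF i] Y[of i] i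
    by (simp add: linop_cst[OF linop_T'])
  have "T i (Y (i + 1) f) = Y i (T' i f)"
    using Y_Suc[OF i, of f] T_T'[OF i] by simp
  moreover have "Y i (T i f) = Y i (T' i f) + hk * Y i f"
    using Y_add[of i "T' i f" "hk * f"] by (simp add: T'_def Y_cst)
  ultimately have Yi: "Y i (T i f) = cst (g (i + 1)) * T i f + hk * (cst (g i) * f)"
    using Y[of i] Y[of "i + 1"] i by (simp add: T_lin)
  consider "j = i" | "j = i + 1" | "j \<noteq> i" "j \<noteq> i + 1" by blast
  then show "Y j (T i f + cst c * f) = cst (g (simple_refl i j)) * (T i f + cst c * f)"
  proof cases
    case 1
    have "cst (k - inverse k) * (cst (g i) * f) + cst c * (cst (g i) * f) = cst ((k - inverse k) * g i + c * g i) * f"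
      by (simp only: cst_add cst_mult distrib_right mult.assoc)
    also have "(k - inverse k) * g i + c * g i = g (i + 1) * c"
      using ci by (simp add: algebra_simps)
    finally show ?thesis
      using 1 Y[of i] i by (simp add: Y_add Y_cst Yi simple_refl_apply distrib_left cst_mult mult.assoc add.assoc)
  next
    case 2
    have "cst c * (cst (g (i + 1)) * f) - cst (g i) * (hk * f) = cst (c * g (i + 1) - g i * (k - inverse k)) * f"
      by (simp only: cst_diff cst_mult left_diff_distrib mult.assoc)
    also have "c * g (i + 1) - g i * (k - inverse k) = g i * c"
      using ci by (simp add: algebra_simps)
    finally have "cst c * (cst (g (i + 1)) * f) = cst (g i) * (hk * f) + cst (g i) * (cst c * f)"
      by (simp add: cst_mult mult.assoc algebra_simps)
    then show ?thesis
      using 2 Y[of "i + 1"] i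
      by (simp add: Y_add Y_cst Yi1 simple_refl_apply T'_def distrib_left right_diff_distrib)
  next
    case 3
    then show ?thesis
      using Y[OF j] i j Y_T[OF i, of j f]
      by (simp add: Y_add Y_cst T_lin simple_refl_apply distrib_left mult.left_commute)
  qed
qed

text \<open>The finite intertwiner for the letter \<open>r - 1\<close>, conjugated by
  \<open>pi_op\<close>. Conjugation rotates the eigenvalues and supplies the powers of
  \<open>q\<close>.\<close>

lemma T_aff_0_eigen:
  assumes "eigen f g" and g: "g r \<noteq> 0" "q powi int n * g 1 \<noteq> g r"
    and c: "c = (inverse k - k) / (1 - q powi int n * g 1 / g r)"
  shows "eigen (T_aff 0 f + cst c * f)
    (\<lambda>j. if j = 1 then q powi (- int n) * g r else if j = r then q powi int n * g 1 else g j)"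
proof -
  let ?g = "\<lambda>j. if j = r then q powi int n * g 1 else g (j + 1)"
  have "eigen (T (r - 1) (pi_inv f) + cst c * pi_inv f) (\<lambda>j. ?g (simple_refl (r - 1) j))"
    using r_ge_2 g c by (intro T_eigen pi_inv_eigen assms(1)) auto
  then have "eigen (pi_op (T (r - 1) (pi_inv f) + cst c * pi_inv f))
      (\<lambda>j. if j = 1 then q powi (- int n) * ?g (simple_refl (r - 1) r)
        else ?g (simple_refl (r - 1) (j - 1)))"
    by (rule pi_op_eigen)
  moreover have "pi_op (T (r - 1) (pi_inv f) + cst c * pi_inv f) = T_aff 0 f + cst c * f"
    by (simp add: T_aff_def linop_add[OF linop_pi_op] linop_cst[OF linop_pi_op])
  ultimately have "eigen (T_aff 0 f + cst c * f)
      (\<lambda>j. if j = 1 then q powi (- int n) * ?g (simple_refl (r - 1) r)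
        else ?g (simple_refl (r - 1) (j - 1)))"
    by simp
  then show ?thesis
    by (rule eigen_cong) (use r_ge_2 in \<open>auto simp: simple_refl_apply\<close>)
qed

end

subsection \<open>Triangularity\<close>

lemma alcove_weights_diff:
  assumes "v \<in> alcove_weights r n" "1 \<le> a" "a \<le> b" "b \<le> r"
  shows "0 \<le> lookup v a - lookup v b" "lookup v a - lookup v b \<le> int n"
proof -
  have dom: "lookup v (Suc i) \<le> lookup v i" if "1 \<le> i" "i < r" for i
    using assms(1) that by (auto simp: alcove_weights_def dominant_def Suc_eq_plus1)
  have mono: "lookup v d \<le> lookup v c" if "c \<le> d" "1 \<le> c" "d \<le> r" for c d
    using that
  proof (induction d rule: dec_induct)
    case (step d)
    then show ?case using dom[of d] by simp
  qed simp
  show "0 \<le> lookup v a - lookup v b" using mono[of a b] assms by simp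
  have "lookup v 1 - lookup v r \<le> int n" using assms(1) by (simp add: alcove_weights_def)
  then show "lookup v a - lookup v b \<le> int n" using mono[of 1 a] mono[of b r] assms by simp
qed

definition sqnorm :: "nat \<Rightarrow> (nat \<Rightarrow>\<^sub>0 int) \<Rightarrow> int" where
  "sqnorm r v = (\<Sum>p=1..r. (lookup v p)\<^sup>2)"

text \<open>With \<open>pos\<close> the identity this measures how dominant \<open>v\<close> is among the vectors of its orbit.\<close>

definition dom_level :: "nat \<Rightarrow> (nat \<Rightarrow> nat) \<Rightarrow> (nat \<Rightarrow>\<^sub>0 int) \<Rightarrow> int" where
  "dom_level r pos v = (\<Sum>p=1..r. - int (pos p) * lookup v p)"

lemma sum_split_pair:
  fixes f :: "nat \<Rightarrow> int"
  assumes "1 \<le> i" "i < r"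
  shows "(\<Sum>p=1..r. f p) = f i + f (i + 1) + (\<Sum>p\<in>{1..r} - {i, i + 1}. f p)"
proof -
  have "(\<Sum>p=1..r. f p) = f i + (\<Sum>p\<in>{1..r} - {i}. f p)"
    using assms by (intro sum.remove) auto
  also have "(\<Sum>p\<in>{1..r} - {i}. f p) = f (i + 1) + (\<Sum>p\<in>{1..r} - {i} - {i + 1}. f p)"
    using assms by (intro sum.remove) auto
  also have "{1..r} - {i} - {i + 1} = {1..r} - {i, i + 1}" by auto
  finally show ?thesis by simp
qed

text \<open>The interior of a string, \<open>c * (c + a) < 0\<close>, is exactly where the norm
  drops. This makes every remainder in \<open>T_expand\<close> a lower term.\<close>

lemma sqnorm_add_root:
  assumes "1 \<le> i" "i < r"
  shows "sqnorm r (v + scale c (simple_root i)) =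
    sqnorm r v + 2 * (c * (c + (lookup v i - lookup v (i + 1))))"
proof -
  have "(\<Sum>p\<in>{1..r} - {i, i + 1}. (lookup (v + scale c (simple_root i)) p)\<^sup>2) =
      (\<Sum>p\<in>{1..r} - {i, i + 1}. (lookup v p)\<^sup>2)"
    by (rule sum.cong) (auto simp: lookup_add simple_root_def lookup_minus lookup_eps)
  then show ?thesis
    unfolding sqnorm_def sum_split_pair[OF assms]
    by (simp add: lookup_add simple_root_def lookup_minus lookup_eps power2_eq_square algebra_simps)
qed

lemma sqnorm_refl:
  assumes "1 \<le> i" "i < r"
  shows "sqnorm r (perm_act (simple_refl i) v) = sqnorm r v"
  unfolding perm_act_simple_refl sqnorm_add_root[OF assms] by simp

lemma dom_level_refl:
  assumes "1 \<le> i" "i < r"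
  shows "dom_level r (pos \<circ> simple_refl i) (perm_act (simple_refl i) v) = dom_level r pos v"
  using sum.permute[OF simple_refl_permutes[OF assms], of "\<lambda>p. - int (pos p) * lookup v p"]
  by (simp add: dom_level_def comp_def)

text \<open>Measures the term of \<open>T_i x^v\<close> that stays at \<open>v\<close> while the
  recorded positions are exchanged. The sign of the product decides whether its level rises.\<close>

lemma dom_level_swap:
  assumes "1 \<le> i" "i < r"
  shows "dom_level r (pos \<circ> simple_refl i) v = dom_level r pos v +
    (int (pos (i + 1)) - int (pos i)) * (lookup v (i + 1) - lookup v i)"
proof -
  have "(\<Sum>p\<in>{1..r} - {i, i + 1}. - int ((pos \<circ> simple_refl i) p) * lookup v p) =
      (\<Sum>p\<in>{1..r} - {i, i + 1}. - int (pos p) * lookup v p)"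
    by (rule sum.cong) (auto simp: simple_refl_apply)
  then show ?thesis
    unfolding dom_level_def sum_split_pair[OF assms]
    by (simp add: simple_refl_apply algebra_simps)
qed

lemma sum_rotate:
  fixes f :: "nat \<Rightarrow> int"
  assumes "r \<ge> 2"
  shows "(\<Sum>p=1..r. f (if p = 1 then r else p - 1)) = (\<Sum>p=1..r. f p)"
  using assms
  by (intro sum.reindex_bij_witness[where j = "\<lambda>p. if p = 1 then r else p - 1"
        and i = "\<lambda>p. if p = r then 1 else p + 1"]) auto

lemma sqnorm_rotate: "r \<ge> 2 \<Longrightarrow> sqnorm r (rotate_vec r v) = sqnorm r v"
  unfolding sqnorm_def
  by (subst (2) sum_rotate[symmetric]) (auto simp: lookup_rotate_vec intro!: sum.cong)

lemma dom_level_rotate: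
  "r \<ge> 2 \<Longrightarrow> dom_level r (\<lambda>p. if p = 1 then pos r else pos (p - 1)) (rotate_vec r v) = dom_level r pos v"
  unfolding dom_level_def
  by (subst (2) sum_rotate[symmetric]) (auto simp: lookup_rotate_vec intro!: sum.cong)

section \<open>The triangular order and leading terms of the \<open>Y_j\<close>\<close>

context metaplectic
begin

text \<open>Among exponents of equal norm, the more dominant ones count as lower, so leading terms
  are the least dominant.\<close>

definition low :: "(nat \<Rightarrow> nat) \<Rightarrow> int \<Rightarrow> int \<Rightarrow> 'f laurent set" where
  "low pos N d = {f. \<forall>v\<in>keys f. v \<in> vectors r \<and>
     (sqnorm r v < N \<or> sqnorm r v = N \<and> d < dom_level r pos v)}"

lemma low_zero: "0 \<in> low pos N d"
  by (simp add: low_def)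

lemma low_add: "f \<in> low pos N d \<Longrightarrow> g \<in> low pos N d \<Longrightarrow> f + g \<in> low pos N d"
  using keys_add[of f g] by (auto simp: low_def)

lemma low_cst: "f \<in> low pos N d \<Longrightarrow> cst c * f \<in> low pos N d"
  by (auto simp: low_def in_keys_iff)

lemma low_sum: "(\<And>i. i \<in> I \<Longrightarrow> f i \<in> low pos N d) \<Longrightarrow> (\<Sum>i\<in>I. f i) \<in> low pos N d"
  by (induction I rule: infinite_finite_induct) (auto simp: low_zero low_add)

lemma keys_xpow [simp]: "keys (xpow v :: 'f laurent) = {v}"
  by (simp add: xpow_def)

lemma low_linop:
  assumes "linop F" "f \<in> low pos N d"
    and "\<And>v. v \<in> vectors r \<Longrightarrow> sqnorm r v < N \<or> sqnorm r v = N \<and> d < dom_level r pos v \<Longrightarrow>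
      F (xpow v) \<in> low pos' N d"
  shows "F f \<in> low pos' N d"
proof -
  have "F f = (\<Sum>v\<in>keys f. cst (lookup f v) * F (xpow v))"
    by (subst laurent_expansion) (simp add: linop_sum[OF assms(1)] linop_cst[OF assms(1)])
  then show ?thesis
    using assms(2,3) by (auto simp: low_def[of pos] intro!: low_sum low_cst)
qed

text \<open>\<open>f\<close> has leading term \<open>c x\<^sup>u\<close>, where \<open>pos\<close> records the original positions of the entries
  of \<open>u\<close>; moreover \<open>f = c x\<^sup>u\<close> if \<open>u\<close> was obtained from a weight of the closed alcove.\<close>

definition lead :: "(nat \<Rightarrow> nat) \<Rightarrow> 'f laurent \<Rightarrow> 'f \<Rightarrow> (nat \<Rightarrow>\<^sub>0 int) \<Rightarrow> bool" where
  "lead pos f c u \<longleftrightarrow> u \<in> vectors r \<and> f - cst c * xpow u \<in> low pos (sqnorm r u) (dom_level r pos u) \<and>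
     (\<forall>l\<in>alcove_weights r n. (\<forall>p\<in>{1..r}. pos p \<in> {1..r} \<and> lookup u p = lookup l (pos p)) \<longrightarrow>
        f = cst c * xpow u)"

lemma lead_cong:
  assumes "lead pos f c u" "\<And>p. p \<in> {1..r} \<Longrightarrow> pos p = pos' p"
  shows "lead pos' f c u"
proof -
  have "dom_level r pos v = dom_level r pos' v" for v
    unfolding dom_level_def using assms(2) by (intro sum.cong) auto
  then show ?thesis
    using assms by (simp add: lead_def low_def)
qed

text \<open>Shared by \<open>T i\<close> and its inverse. Interior terms lose norm; the delicate
  term is \<open>cst e * xpow v\<close>, of the same norm as the leading one. It is allowed only
  when exchanging the recorded positions without moving \<open>v\<close> raises the level. Entries
  taken from a closed alcove weight are ordered by these positions, so there the term is absent and
  \<open>exact\<close> applies.\<close>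

lemma lead_step:
  assumes "linop F" and i: "1 \<le> i" "i < r"
    and F: "\<And>v. v \<in> vectors r \<Longrightarrow> \<exists>e R. F (xpow v) = cst (C v) * xpow (perm_act (simple_refl i) v) +
        cst e * xpow v + R \<and>
      (\<forall>u\<in>keys R. \<exists>c. c * (c + (lookup v i - lookup v (i + 1))) < 0 \<and> u = v + scale c (simple_root i)) \<and>
      (e \<noteq> 0 \<longrightarrow> 0 < (int (pos (i + 1)) - int (pos i)) * (lookup v (i + 1) - lookup v i))"
    and exact: "\<And>v. \<bar>lookup v i - lookup v (i + 1)\<bar> \<le> int n \<Longrightarrow>
      (int (pos (i + 1)) - int (pos i)) * (lookup v (i + 1) - lookup v i) \<le> 0 \<Longrightarrow>
      F (xpow v) = cst (C v) * xpow (perm_act (simple_refl i) v)"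
    and ne: "pos i \<noteq> pos (i + 1)"
    and lead: "lead pos f c u"
  shows "lead (pos \<circ> simple_refl i) (F f) (c * C u) (perm_act (simple_refl i) u)"
proof -
  let ?s = "simple_refl i" and ?su = "perm_act (simple_refl i) u"
  let ?pos = "pos \<circ> ?s"
  have vec: "v + scale c (simple_root i) \<in> vectors r" if "v \<in> vectors r" for v and c :: int
    using that i by (auto simp: vectors_def in_keys_iff lookup_add simple_root_def lookup_minus
        lookup_eps split: if_splits)
  have u: "u \<in> vectors r" using lead by (simp add: lead_def)
  have R: "R \<in> low ?pos N d"
    if "\<forall>u\<in>keys R. \<exists>c. c * (c + (lookup v i - lookup v (i + 1))) < 0 \<and> u = v + scale c (simple_root i)"
      "v \<in> vectors r" "sqnorm r v \<le> N" for R N d v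
    unfolding low_def
  proof (intro CollectI ballI)
    fix u assume "u \<in> keys R"
    with that(1) obtain c where "c * (c + (lookup v i - lookup v (i + 1))) < 0"
      "u = v + scale c (simple_root i)" by blast
    then show "u \<in> vectors r \<and> (sqnorm r u < N \<or> sqnorm r u = N \<and> d < dom_level r ?pos u)"
      using vec[OF that(2)] that(3) sqnorm_add_root[OF i, of v c] by auto
  qed
  have E: "cst e * xpow v \<in> low ?pos N d"
    if "e \<noteq> 0 \<longrightarrow> 0 < (int (pos (i + 1)) - int (pos i)) * (lookup v (i + 1) - lookup v i)"
      "v \<in> vectors r" "sqnorm r v < N \<or> sqnorm r v = N \<and> d \<le> dom_level r pos v" for e v N d
  proof (cases "e = 0")
    case False
    then have "dom_level r pos v < dom_level r ?pos v" using that(1) dom_level_swap[OF i] by simp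
    then have "xpow v \<in> low ?pos N d" using that by (auto simp: low_def)
    then show ?thesis by (rule low_cst)
  qed (simp add: low_zero)
  have lowF: "F g \<in> low ?pos N d" if "g \<in> low pos N d" for g N d
  proof (rule low_linop[OF assms(1) that])
    fix v assume v: "v \<in> vectors r" "sqnorm r v < N \<or> sqnorm r v = N \<and> d < dom_level r pos v"
    have "xpow (perm_act ?s v) \<in> low ?pos N d"
      using v vec[OF v(1)] sqnorm_refl[OF i] dom_level_refl[OF i]
      by (simp add: low_def) (simp add: perm_act_simple_refl)
    moreover obtain e R where eR: "F (xpow v) = cst (C v) * xpow (perm_act ?s v) + cst e * xpow v + R"
      "\<forall>u\<in>keys R. \<exists>c. c * (c + (lookup v i - lookup v (i + 1))) < 0 \<and> u = v + scale c (simple_root i)"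
      "e \<noteq> 0 \<longrightarrow> 0 < (int (pos (i + 1)) - int (pos i)) * (lookup v (i + 1) - lookup v i)"
      using F[OF v(1)] by blast
    moreover have "R \<in> low ?pos N d" using v by (intro R[OF eR(2) v(1)]) auto
    moreover have "cst e * xpow v \<in> low ?pos N d" using v by (intro E[OF eR(3) v(1)]) auto
    ultimately show "F (xpow v) \<in> low ?pos N d"
      by (simp only: low_add low_cst)
  qed
  have "?su \<in> vectors r" unfolding perm_act_simple_refl by (rule vec[OF u])
  moreover have "F f - cst (c * C u) * xpow ?su \<in> low ?pos (sqnorm r ?su) (dom_level r ?pos ?su)"
  proof -
    let ?N = "sqnorm r u" and ?d = "dom_level r pos u"
    obtain e R where eR: "F (xpow u) = cst (C u) * xpow ?su + cst e * xpow u + R"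
      "\<forall>w\<in>keys R. \<exists>c. c * (c + (lookup u i - lookup u (i + 1))) < 0 \<and> w = u + scale c (simple_root i)"
      "e \<noteq> 0 \<longrightarrow> 0 < (int (pos (i + 1)) - int (pos i)) * (lookup u (i + 1) - lookup u i)"
      using F[OF u] by blast
    have "F f = F (f - cst c * xpow u) + cst c * F (xpow u)"
      by (simp add: linop_diff[OF assms(1)] linop_cst[OF assms(1)])
    then have "F f - cst (c * C u) * xpow ?su = F (f - cst c * xpow u) + cst c * (cst e * xpow u + R)"
      unfolding eR(1) cst_mult by (simp add: distrib_left mult.assoc)
    moreover have "F (f - cst c * xpow u) \<in> low ?pos ?N ?d"
      using lead by (intro lowF) (simp add: lead_def)
    moreover have "cst c * (cst e * xpow u + R) \<in> low ?pos ?N ?d"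
      using R[OF eR(2) u, of ?N ?d] E[OF eR(3) u, of ?N ?d] by (simp add: low_cst low_add)
    ultimately show ?thesis
      using sqnorm_refl[OF i] dom_level_refl[OF i] by (simp add: low_add)
  qed
  moreover have "F f = cst (c * C u) * xpow ?su"
    if l: "l \<in> alcove_weights r n" "\<forall>p\<in>{1..r}. ?pos p \<in> {1..r} \<and> lookup ?su p = lookup l (?pos p)" for l
  proof -
    have pos: "pos p \<in> {1..r} \<and> lookup u p = lookup l (pos p)" if "p \<in> {1..r}" for p
    proof -
      have "?s p \<in> {1..r}" using permutes_in_image[OF simple_refl_permutes[OF i]] that by blast
      then show ?thesis using l(2)[rule_format, of "?s p"] by simp
    qed
    then have f: "f = cst c * xpow u" using lead l(1) unfolding lead_def by blast
    have ui: "lookup u i = lookup l (pos i)" "lookup u (i + 1) = lookup l (pos (i + 1))"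
      "pos i \<in> {1..r}" "pos (i + 1) \<in> {1..r}"
      using pos[of i] pos[of "i + 1"] i by auto
    have "F (xpow u) = cst (C u) * xpow ?su"
    proof (rule exact)
      consider "pos i < pos (i + 1)" | "pos (i + 1) < pos i" using ne by linarith
      then show "\<bar>lookup u i - lookup u (i + 1)\<bar> \<le> int n"
        using ui alcove_weights_diff[OF l(1), of "pos i" "pos (i + 1)"]
          alcove_weights_diff[OF l(1), of "pos (i + 1)" "pos i"] by cases auto
      consider "pos i < pos (i + 1)" | "pos (i + 1) < pos i" using ne by linarith
      then show "(int (pos (i + 1)) - int (pos i)) * (lookup u (i + 1) - lookup u i) \<le> 0"
        using ui alcove_weights_diff(1)[OF l(1), of "pos i" "pos (i + 1)"]
          alcove_weights_diff(1)[OF l(1), of "pos (i + 1)" "pos i"]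
        by cases (auto simp: mult_le_0_iff)
    qed
    then show ?thesis by (simp add: f linop_cst[OF assms(1)] cst_mult mult.assoc)
  qed
  ultimately show ?thesis by (auto simp: lead_def)
qed

text \<open>The term at \<open>v\<close> requires \<open>v_i < v_(i+1)\<close>, while
  \<open>pos\<close> ascends at \<open>i\<close>; exchanging positions therefore raises its level.
  In \<open>Y j\<close> this is entry \<open>j\<close> travelling right past later entries.\<close>

lemma lead_T:
  assumes i: "1 \<le> i" "i < r" and pos: "pos i < pos (i + 1)" and "lead pos f c u"
  shows "lead (pos \<circ> simple_refl i) (T i f) (c * sig (lookup u i - lookup u (i + 1)))
    (perm_act (simple_refl i) u)"
proof (rule lead_step[where F = "T i" and C = "\<lambda>v. sig (lookup v i - lookup v (i + 1))", OF linop_T i])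
  fix v :: "nat \<Rightarrow>\<^sub>0 int"
  let ?a = "lookup v i - lookup v (i + 1)"
  obtain R where R: "T i (xpow v) = cst (sig ?a) * xpow (perm_act (simple_refl i) v) +
       (if ?a < 0 then hk * xpow v else 0) + R"
    "\<And>u. u \<in> keys R \<Longrightarrow> \<exists>c. int n dvd c \<and> c * (c + ?a) < 0 \<and> u = v + scale c (simple_root i)"
    using T_expand[OF i] by blast
  then show "\<exists>e R. T i (xpow v) = cst (sig ?a) * xpow (perm_act (simple_refl i) v) + cst e * xpow v + R \<and>
      (\<forall>u\<in>keys R. \<exists>c. c * (c + ?a) < 0 \<and> u = v + scale c (simple_root i)) \<and>
      (e \<noteq> 0 \<longrightarrow> 0 < (int (pos (i + 1)) - int (pos i)) * (lookup v (i + 1) - lookup v i))"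
    using pos by (intro exI[of _ "if ?a < 0 then k - inverse k else 0"] exI[of _ R])
      (auto simp: zero_less_mult_iff)
  show "T i (xpow v) = cst (sig ?a) * xpow (perm_act (simple_refl i) v)"
    if "\<bar>?a\<bar> \<le> int n" "(int (pos (i + 1)) - int (pos i)) * (lookup v (i + 1) - lookup v i) \<le> 0"
    using T_small[OF i that(1)] that(2) pos by (auto simp: mult_le_0_iff)
qed (use assms in auto)

text \<open>Subtracting \<open>hk\<close> moves the term at \<open>v\<close> to the case
  \<open>v_i > v_(i+1)\<close>. This suits descending positions, as when entry \<open>j\<close>
  travels back past earlier entries.\<close>

lemma lead_T':
  assumes i: "1 \<le> i" "i < r" and pos: "pos (i + 1) < pos i" and "lead pos f c u"
  shows "lead (pos \<circ> simple_refl i) (T' i f) (c * inverse (sig (lookup u (i + 1) - lookup u i)))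
    (perm_act (simple_refl i) u)"
proof (rule lead_step[where F = "T' i" and C = "\<lambda>v. inverse (sig (lookup v (i + 1) - lookup v i))",
      OF linop_T' i])
  fix v :: "nat \<Rightarrow>\<^sub>0 int"
  let ?a = "lookup v i - lookup v (i + 1)" and ?b = "lookup v (i + 1) - lookup v i"
  let ?sv = "perm_act (simple_refl i) v"
  \<comment> \<open>For \<open>?a = 0\<close> the two exponents coincide and the coefficients
    combine to \<open>k - (k - k^-1) = k^-1\<close>.\<close>
  have C: "cst (sig ?a) * xpow ?sv + (if ?a < 0 then hk * xpow v else 0) - hk * xpow v =
      cst (inverse (sig ?b)) * xpow ?sv + cst (if ?a > 0 then - (k - inverse k) else 0) * xpow v"
  proof (cases "?a = 0")
    case True
    then have "?sv = v" unfolding perm_act_simple_refl by simp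
    then show ?thesis
      using True by (intro poly_mapping_eqI) (simp add: lookup_add lookup_minus sig_zero left_diff_distrib)
  next
    case False
    then have "sig ?a = inverse (sig ?b)"
      using sig_inverse[of ?a] by (metis minus_diff_eq inverse_unique mult.commute inverse_inverse_eq)
    then show ?thesis
      using False by (intro poly_mapping_eqI) (auto simp: lookup_add lookup_minus left_diff_distrib)
  qed
  obtain R where R: "T i (xpow v) = cst (sig ?a) * xpow ?sv +
       (if ?a < 0 then hk * xpow v else 0) + R"
    "\<And>u. u \<in> keys R \<Longrightarrow> \<exists>c. int n dvd c \<and> c * (c + ?a) < 0 \<and> u = v + scale c (simple_root i)"
    using T_expand[OF i] by blast
  have "T' i (xpow v) = cst (inverse (sig ?b)) * xpow ?sv +
      cst (if ?a > 0 then - (k - inverse k) else 0) * xpow v + R"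
    unfolding C[symmetric] T'_def R(1) by simp
  then show "\<exists>e R. T' i (xpow v) = cst (inverse (sig ?b)) * xpow ?sv + cst e * xpow v + R \<and>
      (\<forall>u\<in>keys R. \<exists>c. c * (c + ?a) < 0 \<and> u = v + scale c (simple_root i)) \<and>
      (e \<noteq> 0 \<longrightarrow> 0 < (int (pos (i + 1)) - int (pos i)) * (lookup v (i + 1) - lookup v i))"
    using pos R(2) by (intro exI[of _ "if ?a > 0 then - (k - inverse k) else 0"] exI[of _ R])
      (auto simp: zero_less_mult_iff)
  show "T' i (xpow v) = cst (inverse (sig ?b)) * xpow ?sv"
    if "\<bar>?a\<bar> \<le> int n" "(int (pos (i + 1)) - int (pos i)) * (lookup v (i + 1) - lookup v i) \<le> 0"
  proof -
    have "\<not> ?a > 0" using that(2) pos by (auto simp: mult_le_0_iff)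
    then show ?thesis
      using C unfolding T'_def T_small[OF i that(1)] by simp
  qed
qed (use assms in auto)

lemma lead_om:
  assumes "lead pos f c u"
  shows "lead (\<lambda>p. if p = 1 then pos r else pos (p - 1)) (om f) (c * q powi (- lookup u r)) (rotate_vec r u)"
proof -
  let ?pos = "\<lambda>p. if p = 1 then pos r else pos (p - 1)"
  have r: "1 \<le> r" using r_ge_2 by simp
  have vec: "rotate_vec r v \<in> vectors r" for v
    using r_ge_2 by (auto simp: vectors_def in_keys_iff lookup_rotate_vec[OF r] split: if_splits)
  have "om (f - cst c * xpow u) \<in> low ?pos (sqnorm r u) (dom_level r pos u)"
  proof (rule low_linop[OF linop_om])
    show "f - cst c * xpow u \<in> low pos (sqnorm r u) (dom_level r pos u)"
      using assms by (simp add: lead_def)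
    fix v assume "sqnorm r v < sqnorm r u \<or> sqnorm r v = sqnorm r u \<and> dom_level r pos u < dom_level r pos v"
    then show "om (xpow v) \<in> low ?pos (sqnorm r u) (dom_level r pos u)"
      unfolding om_xpow using vec sqnorm_rotate[OF r_ge_2] dom_level_rotate[OF r_ge_2]
      by (intro low_cst) (simp add: low_def)
  qed
  moreover have "om (f - cst c * xpow u) = om f - cst (c * q powi (- lookup u r)) * xpow (rotate_vec r u)"
    by (simp add: linop_diff[OF linop_om] linop_cst[OF linop_om] om_xpow cst_mult mult.assoc)
  moreover have "om f = cst (c * q powi (- lookup u r)) * xpow (rotate_vec r u)"
    if l: "l \<in> alcove_weights r n"
      "\<forall>p\<in>{1..r}. ?pos p \<in> {1..r} \<and> lookup (rotate_vec r u) p = lookup l (?pos p)" for l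
  proof -
    have "pos p \<in> {1..r} \<and> lookup u p = lookup l (pos p)" if "p \<in> {1..r}" for p
    proof (cases "p = r")
      case True
      then show ?thesis using l(2)[rule_format, of 1] r by (simp add: lookup_rotate_vec)
    next
      case False
      then show ?thesis using l(2)[rule_format, of "p + 1"] that r
        by (simp add: lookup_rotate_vec)
    qed
    then have f: "f = cst c * xpow u" using assms l(1) unfolding lead_def by blast
    show ?thesis unfolding f by (simp add: linop_cst[OF linop_om] om_xpow cst_mult mult.assoc)
  qed
  ultimately show ?thesis
    using vec sqnorm_rotate[OF r_ge_2] dom_level_rotate[OF r_ge_2, of pos u] by (auto simp: lead_def)
qed

text \<open>This is \<open>gamma(n eps_j; u)\<close>, grouped by the entries that \<open>u_j\<close>
  passes: later entries on the way right, earlier ones on the way back.\<close>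

definition Y_weight :: "(nat \<Rightarrow>\<^sub>0 int) \<Rightarrow> nat \<Rightarrow> 'f" where
  "Y_weight u j = q powi (- lookup u j) * (\<Prod>p\<in>{j<..r}. sig (lookup u j - lookup u p)) *
     (\<Prod>p\<in>{1..<j}. inverse (sig (lookup u p - lookup u j)))"

text \<open>Through the factors of \<open>Y\<^sub>j\<close> the entry \<open>u\<^sub>j\<close> travels to the last position, is rotated to the
  front, and travels back to position \<open>j\<close>.\<close>

lemma Y_lead:
  assumes u: "u \<in> vectors r" and j: "1 \<le> j" "j \<le> r"
  shows "lead id (Y j (xpow u)) (Y_weight u j) u"
proof -
  have start: "lead id (xpow u) 1 u"
    using u by (simp add: lead_def low_zero)
  let ?c1 = "\<lambda>m. \<Prod>p\<in>{j<..m}. sig (lookup u j - lookup u p)"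
  have phase1: "\<exists>U. lead (sym_word [j..<m]) (fold T [j..<m] (xpow u)) (?c1 m) U \<and>
      (\<forall>p. lookup U p = lookup u (sym_word [j..<m] p))" if "j \<le> m" "m \<le> r" for m
    using that
  proof (induction m rule: dec_induct)
    case base
    then show ?case using start by (intro exI[of _ u]) (simp add: id_def)
  next
    case (step m)
    then obtain U where U: "lead (sym_word [j..<m]) (fold T [j..<m] (xpow u)) (?c1 m) U"
      "\<forall>p. lookup U p = lookup u (sym_word [j..<m] p)" by auto
    have L: "lead (sym_word [j..<m] \<circ> simple_refl m) (T m (fold T [j..<m] (xpow u)))
        (?c1 m * sig (lookup U m - lookup U (m + 1))) (perm_act (simple_refl m) U)"
      using step j U(1) by (intro lead_T) (auto simp: cycle_apply)
    have "{j<..Suc m} = insert (m + 1) {j<..m}" using step by auto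
    then have c1: "?c1 (Suc m) = ?c1 m * sig (lookup U m - lookup U (m + 1))"
      using U(2) step by (simp add: cycle_apply)
    have up: "[j..<Suc m] = [j..<m] @ [m]" using step by simp
    then have fo: "fold T [j..<Suc m] (xpow u) = T m (fold T [j..<m] (xpow u))" by simp
    have wo: "sym_word [j..<Suc m] = sym_word [j..<m] \<circ> simple_refl m"
      unfolding up by (rule sym_word_snoc)
    show ?case
      unfolding fo wo c1
    proof (intro exI conjI allI)
      show "lookup (perm_act (simple_refl m) U) p =
          lookup u ((sym_word [j..<m] \<circ> simple_refl m) p)" for p
        using U(2) by simp
    qed (rule L)
  qed
  \<comment> \<open>Entry \<open>j\<close> stands at position \<open>m\<close>. Later entries are
    back in place, and earlier entries not yet passed stand one place too far right.\<close>
  let ?pos = "\<lambda>m p. if p = m then j else if p < m \<or> j < p then p else p - 1"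
  let ?c2 = "\<lambda>m. ?c1 r * q powi (- lookup u j) * (\<Prod>p\<in>{1..<m}. inverse (sig (lookup u p - lookup u j)))"
  have phase2: "\<exists>U. lead (?pos m) (fold T' [1..<m] (om (fold T [j..<r] (xpow u)))) (?c2 m) U \<and>
      (\<forall>p\<in>{1..r}. lookup U p = lookup u (?pos m p))" if "1 \<le> m" "m \<le> j" for m
    using that
  proof (induction m rule: dec_induct)
    case base
    obtain U where U: "lead (sym_word [j..<r]) (fold T [j..<r] (xpow u)) (?c1 r) U"
      "\<forall>p. lookup U p = lookup u (sym_word [j..<r] p)" using phase1[of r] j by auto
    have "lead (\<lambda>p. if p = 1 then sym_word [j..<r] r else sym_word [j..<r] (p - 1))
        (om (fold T [j..<r] (xpow u))) (?c1 r * q powi (- lookup U r)) (rotate_vec r U)"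
      by (rule lead_om[OF U(1)])
    then have "lead (?pos 1) (om (fold T [j..<r] (xpow u))) (?c1 r * q powi (- lookup U r)) (rotate_vec r U)"
      by (rule lead_cong) (use j in \<open>auto simp: cycle_apply\<close>)
    then show ?case
      using U(2) j by (intro exI[of _ "rotate_vec r U"]) (auto simp: lookup_rotate_vec cycle_apply)
  next
    case (step m)
    then obtain U where U: "lead (?pos m) (fold T' [1..<m] (om (fold T [j..<r] (xpow u)))) (?c2 m) U"
      "\<forall>p\<in>{1..r}. lookup U p = lookup u (?pos m p)" by auto
    have "lead (?pos m \<circ> simple_refl m) (T' m (fold T' [1..<m] (om (fold T [j..<r] (xpow u)))))
        (?c2 m * inverse (sig (lookup U (m + 1) - lookup U m))) (perm_act (simple_refl m) U)"
      using step j U(1) by (intro lead_T') auto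
    then have L: "lead (?pos (Suc m)) (T' m (fold T' [1..<m] (om (fold T [j..<r] (xpow u)))))
        (?c2 m * inverse (sig (lookup U (m + 1) - lookup U m))) (perm_act (simple_refl m) U)"
      by (rule lead_cong) (use step in \<open>auto simp: simple_refl_apply\<close>)
    have "{1..<Suc m} = insert m {1..<m}" using step by auto
    then have c2: "?c2 (Suc m) = ?c2 m * inverse (sig (lookup U (m + 1) - lookup U m))"
      using U(2) step j by (simp add: mult.assoc mult.commute)
    have "[1..<Suc m] = [1..<m] @ [m]" using step by simp
    then have fo: "fold T' [1..<Suc m] f = T' m (fold T' [1..<m] f)" for f by simp
    show ?case
      unfolding fo c2
    proof (intro exI conjI ballI)
      show "lookup (perm_act (simple_refl m) U) p = lookup u (?pos (Suc m) p)" if "p \<in> {1..r}" for p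
        using U(2) step j that by (auto simp: simple_refl_apply)
    qed (rule L)
  qed
  obtain U where U: "lead (?pos j) (Y j (xpow u)) (?c2 j) U" "\<forall>p\<in>{1..r}. lookup U p = lookup u (?pos j p)"
    using phase2[of j] j unfolding Y_def by blast
  have "U \<in> vectors r" using U(1) by (simp add: lead_def)
  have "U = u"
  proof (rule poly_mapping_eqI)
    fix p
    show "lookup U p = lookup u p"
    proof (cases "p \<in> {1..r}")
      case True
      have "?pos j p = p" by auto
      then show ?thesis using U(2)[rule_format, OF True] by simp
    next
      case False
      then have "p \<notin> keys U" "p \<notin> keys u"
        using \<open>U \<in> vectors r\<close> u by (auto simp: vectors_def)
      then show ?thesis by (simp add: in_keys_iff)
    qed
  qed
  then have "lead (?pos j) (Y j (xpow u)) (?c2 j) u"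
    using U(1) by simp
  then have "lead id (Y j (xpow u)) (?c2 j) u"
    by (rule lead_cong) auto
  then show ?thesis by (simp add: Y_weight_def mult_ac)
qed

lemma alcove_eigen:
  assumes "l \<in> alcove_weights r n"
  shows "eigen (xpow l) (Y_weight l)"
proof -
  have l: "l \<in> vectors r" using assms by (simp add: alcove_weights_def)
  show ?thesis
    unfolding eigen_def
  proof
    fix j assume "j \<in> {1..r}"
    then show "Y j (xpow l) = cst (Y_weight l j) * xpow l"
      using Y_lead[OF l, of j] assms unfolding lead_def by auto
  qed
qed

text \<open>Take an exponent \<open>u\<close> of largest norm and, among those, of least level. By
  triangularity only \<open>x^u\<close> contributes to the coefficient of \<open>Y j f\<close> at
  \<open>u\<close>, so every eigenvalue of \<open>f\<close> is \<open>Y_weight u j\<close>, and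
  separation forces \<open>u = \<mu>\<close>.\<close>

lemma eigen_lookup_nonzero:
  assumes f: "f \<noteq> 0" "keys f \<subseteq> vectors r" and eig: "eigen f (Y_weight \<mu>)" and \<mu>: "\<mu> \<in> vectors r"
    and sep: "\<And>u j. j \<in> {1..r} \<Longrightarrow> Y_weight u j = Y_weight \<mu> j \<Longrightarrow> lookup u j = lookup \<mu> j"
  shows "lookup f \<mu> \<noteq> 0"
proof -
  have fin: "finite (keys f)" "keys f \<noteq> {}" using f(1) by auto
  define N where "N = Max (sqnorm r ` keys f)"
  define S where "S = {v \<in> keys f. sqnorm r v = N}"
  have "N \<in> sqnorm r ` keys f" unfolding N_def using fin by (intro Max_in) auto
  then have "S \<noteq> {}" by (auto simp: S_def)
  have S: "finite S" using fin by (simp add: S_def)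
  define d where "d = Min (dom_level r id ` S)"
  obtain u where u: "u \<in> S" "dom_level r id u = d"
    using Min_in[of "dom_level r id ` S"] S \<open>S \<noteq> {}\<close> unfolding d_def
    by (metis (no_types, lifting) finite_imageI image_iff image_is_empty)
  have uk: "u \<in> keys f" "sqnorm r u = N" using u by (auto simp: S_def)
  have off: "lookup (Y j (xpow v)) u = (if v = u then Y_weight u j else 0)"
    if "v \<in> keys f" "j \<in> {1..r}" for v j
  proof -
    have vv: "v \<in> vectors r" using that f by auto
    have "u \<notin> keys (Y j (xpow v) - cst (Y_weight v j) * xpow v)"
    proof
      assume "u \<in> keys (Y j (xpow v) - cst (Y_weight v j) * xpow v)"
      moreover have "Y j (xpow v) - cst (Y_weight v j) * xpow v \<in> low id (sqnorm r v) (dom_level r id v)"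
        using Y_lead[OF vv] that by (simp add: lead_def)
      ultimately have "sqnorm r u < sqnorm r v \<or> sqnorm r u = sqnorm r v \<and> dom_level r id v < dom_level r id u"
        by (auto simp: low_def)
      moreover have "sqnorm r v \<le> N" using that fin by (simp add: N_def)
      ultimately have "v \<in> S" "dom_level r id v < d" using uk u that by (auto simp: S_def)
      moreover have "d \<le> dom_level r id v" if "v \<in> S"
        unfolding d_def using S that by (intro Min_le) auto
      ultimately show False by simp
    qed
    then show ?thesis by (auto simp: in_keys_iff lookup_minus lookup_xpow)
  qed
  have "lookup u j = lookup \<mu> j" if j: "j \<in> {1..r}" for j
  proof -
    have Y: "linop (Y j)" by (simp add: linop_def Y_add Y_cst)
    have "lookup (Y j f) u = (\<Sum>v\<in>keys f. lookup f v * lookup (Y j (xpow v)) u)"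
      by (subst laurent_expansion) (simp add: linop_sum[OF Y] linop_cst[OF Y] lookup_sum)
    also have "\<dots> = (\<Sum>v\<in>keys f. if v = u then lookup f v * Y_weight v j else 0)"
      using off[OF _ j] by (intro sum.cong) auto
    also have "\<dots> = lookup f u * Y_weight u j" using uk by simp
    finally have "Y_weight \<mu> j * lookup f u = Y_weight u j * lookup f u"
      using eig j by (simp add: eigen_def)
    then have "Y_weight u j = Y_weight \<mu> j" using uk by (simp add: in_keys_iff)
    then show ?thesis using sep j by blast
  qed
  moreover have "u \<in> vectors r" using uk f by auto
  ultimately have "u = \<mu>"
    using \<mu> by (intro poly_mapping_eqI) (metis (no_types, lifting) in_keys_iff mem_Collect_eq subsetD vectors_def)
  then show ?thesis using uk by (simp add: in_keys_iff)
qed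

end

subsection \<open>Spectral weights\<close>

lemma prod_powi: "(\<Prod>i\<in>A. f i) powi m = (\<Prod>i\<in>A. (f i :: 'f::field) powi m)"
  by (induction A rule: infinite_finite_induct) (auto simp: power_int_mult_distrib)

lemma powi_sum:
  assumes "(x :: 'f::field) \<noteq> 0"
  shows "(\<Prod>i\<in>A. x powi f i) = x powi (\<Sum>i\<in>A. f i)"
  using assms by (induction A rule: infinite_finite_induct) (auto simp: power_int_add)

lemma prod_split_pair:
  fixes f :: "nat \<Rightarrow> 'f::comm_monoid_mult"
  assumes "a \<in> {1..r}" "b \<in> {1..r}" "a \<noteq> b"
  shows "(\<Prod>p=1..r. f p) = f a * f b * (\<Prod>p\<in>{1..r} - {a, b}. f p)"
proof -
  have "(\<Prod>p=1..r. f p) = f a * (\<Prod>p\<in>{1..r} - {a}. f p)"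
    using assms by (intro prod.remove) auto
  also have "(\<Prod>p\<in>{1..r} - {a}. f p) = f b * (\<Prod>p\<in>{1..r} - {a} - {b}. f p)"
    using assms by (intro prod.remove) auto
  also have "{1..r} - {a} - {b} = {1..r} - {a, b}" by auto
  finally show ?thesis by (simp add: mult.assoc)
qed

lemma eps_diff_inj:
  assumes "a < b" "c < d" "eps a - eps b = (eps c - eps d :: nat \<Rightarrow>\<^sub>0 int)"
  shows "a = c \<and> b = d"
proof -
  have "lookup (eps a - eps b :: nat \<Rightarrow>\<^sub>0 int) j = lookup (eps c - eps d) j" for j
    using assms(3) by simp
  from this[of a] this[of b] show ?thesis
    using assms(1,2) by (auto simp: lookup_minus lookup_eps split: if_splits)
qed

lemma prod_pos_roots:
  "(\<Prod>\<alpha>\<in>pos_roots r. f \<alpha>) = (\<Prod>a=1..r. \<Prod>b\<in>{a<..r}. f (eps a - eps b :: nat \<Rightarrow>\<^sub>0 int))"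
proof -
  let ?P = "Sigma {1..r} (\<lambda>a. {a<..r})" and ?h = "\<lambda>(a, b). eps a - eps b :: nat \<Rightarrow>\<^sub>0 int"
  have "pos_roots r = ?h ` ?P"
    by (auto simp: pos_roots_def image_iff) force
  moreover have "inj_on ?h ?P"
    by (auto simp: inj_on_def dest: eps_diff_inj)
  ultimately have "(\<Prod>\<alpha>\<in>pos_roots r. f \<alpha>) = (\<Prod>x\<in>?P. f (?h x))"
    by (simp add: prod.reindex comp_def)
  also have "\<dots> = (\<Prod>a=1..r. \<Prod>b\<in>{a<..r}. f (eps a - eps b))"
    by (subst prod.Sigma) (auto intro!: prod.cong)
  finally show ?thesis .
qed

lemma ip_eps_diff:
  assumes "a \<in> {1..r}" "b \<in> {1..r}"
  shows "ip r v (eps a - eps b) = lookup v a - lookup v b"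
proof -
  have "ip r v (eps a - eps b) =
      (\<Sum>j=1..r. (if j = a then lookup v j else 0) - (if j = b then lookup v j else 0))"
    unfolding ip_def by (rule sum.cong) (auto simp: lookup_minus lookup_eps)
  then show ?thesis using assms by (simp add: sum_subtractf)
qed

lemma lookup_aff_act:
  fixes v :: "nat \<Rightarrow>\<^sub>0 'a::ring_1"
  assumes "bij (snd g)"
  shows "lookup (aff_act g v) j = lookup v (inv (snd g) j) + of_int (lookup (fst g) j)"
  using assms by (simp add: aff_act_def lookup_add lookup_perm_act map.rep_eq when_def)

lemma lookup_aff_gen:
  fixes v :: "nat \<Rightarrow>\<^sub>0 int"
  shows "lookup (aff_act (aff_gen r n i) v) j =
    (if i = 0 then lookup v (transpose 1 r j) +
       int n * ((if j = 1 then 1 else 0) - (if j = r then 1 else 0))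
     else lookup v (simple_refl i j))"
  by (auto simp: aff_gen_def lookup_aff_act highest_root_def lookup_minus lookup_eps)

section \<open>\<open>gamma\<close> as a character evaluated on the joint eigenvalues\<close>

context metaplectic
begin

lemma Y_weight_nonzero: "Y_weight v j \<noteq> 0"
  using q_nonzero by (simp add: Y_weight_def)

text \<open>\<open>gamma\<close> is multiplicative in its first argument, hence determined by its
  values on the vectors \<open>n eps_j\<close> and on \<open>delta\<close>. The product over
  positive roots splits by the sign with which \<open>eps_j\<close> occurs in a root.\<close>

lemma gamma_eq:
  "gamma r n k q G (scale (int n) \<eta>, s * (int n)\<^sup>2) v =
    q powi (- (s * int n)) * (\<Prod>j=1..r. Y_weight v j powi lookup \<eta> j)"
proof -
  let ?e = "lookup \<eta>"
  have "ip r (scale (int n) \<eta>) v = int n * (\<Sum>j=1..r. ?e j * lookup v j)"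
    by (simp add: ip_def sum_distrib_left mult.assoc)
  then have ip: "ip r (scale (int n) \<eta>) v div int n = (\<Sum>j=1..r. ?e j * lookup v j)"
    using n_pos by simp
  have s: "s * (int n)\<^sup>2 div (int n)\<^sup>2 = s" using n_pos by simp
  have roots: "(\<Prod>\<alpha>\<in>pos_roots r. sig (ip r v \<alpha>) powi (ip r (scale (int n) \<eta>) \<alpha> div int n)) =
      (\<Prod>a=1..r. \<Prod>b\<in>{a<..r}. sig (lookup v a - lookup v b) powi (?e a - ?e b))"
    unfolding prod_pos_roots
  proof (intro prod.cong refl)
    fix a b assume "a \<in> {1..r}" "b \<in> {a<..r}"
    then have ab: "a \<in> {1..r}" "b \<in> {1..r}" by auto
    have "ip r (scale (int n) \<eta>) (eps a - eps b) = int n * (?e a - ?e b)"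
      unfolding ip_eps_diff[OF ab] by (simp add: right_diff_distrib)
    then show "sig (ip r v (eps a - eps b)) powi (ip r (scale (int n) \<eta>) (eps a - eps b) div int n) =
        sig (lookup v a - lookup v b) powi (?e a - ?e b)"
      using n_pos ip_eps_diff[OF ab, of v] by simp
  qed
  have swap: "(\<Prod>a=1..r. \<Prod>b\<in>{a<..r}. h a b) = (\<Prod>b=1..r. \<Prod>a\<in>{1..<b}. h a b)"
    for h :: "nat \<Rightarrow> nat \<Rightarrow> 'f"
  proof -
    have "(\<Prod>a=1..r. \<Prod>b\<in>{a<..r}. h a b) = (\<Prod>(a, b)\<in>Sigma {1..r} (\<lambda>a. {a<..r}). h a b)"
      by (rule prod.Sigma) auto
    also have "\<dots> = (\<Prod>(b, a)\<in>Sigma {1..r} (\<lambda>b. {1..<b}). h a b)"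
      by (intro prod.reindex_bij_witness[where i = prod.swap and j = prod.swap]) auto
    also have "\<dots> = (\<Prod>b=1..r. \<Prod>a\<in>{1..<b}. h a b)"
      by (rule prod.Sigma[symmetric]) auto
    finally show ?thesis .
  qed
  have qs: "(\<Prod>j=1..r. (q powi (- lookup v j)) powi ?e j) =
      q powi (- (\<Sum>j=1..r. ?e j * lookup v j))"
    using q_nonzero
    by (simp add: powi_sum sum_negf mult.commute flip: power_int_mult)
  have "(\<Prod>a=1..r. \<Prod>b\<in>{a<..r}. sig (lookup v a - lookup v b) powi (?e a - ?e b)) =
      (\<Prod>a=1..r. \<Prod>b\<in>{a<..r}. sig (lookup v a - lookup v b) powi ?e a) *
      (\<Prod>a=1..r. \<Prod>b\<in>{a<..r}. inverse (sig (lookup v a - lookup v b)) powi ?e b)"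
    by (simp add: power_int_diff power_int_inverse divide_inverse prod.distrib)
  also have "\<dots> = (\<Prod>j=1..r. (\<Prod>p\<in>{j<..r}. sig (lookup v j - lookup v p)) powi ?e j) *
      (\<Prod>j=1..r. (\<Prod>p\<in>{1..<j}. inverse (sig (lookup v p - lookup v j))) powi ?e j)"
    by (subst (2) swap) (simp add: prod_powi)
  moreover have "(\<Prod>j=1..r. Y_weight v j powi ?e j) = q powi (- (\<Sum>j=1..r. ?e j * lookup v j)) *
      ((\<Prod>j=1..r. (\<Prod>p\<in>{j<..r}. sig (lookup v j - lookup v p)) powi ?e j) *
      (\<Prod>j=1..r. (\<Prod>p\<in>{1..<j}. inverse (sig (lookup v p - lookup v j))) powi ?e j))"
    unfolding Y_weight_def power_int_mult_distrib prod.distrib qs by (simp only: mult.assoc)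
  ultimately have "q powi (- (\<Sum>j=1..r. ?e j * lookup v j)) *
      (\<Prod>a=1..r. \<Prod>b\<in>{a<..r}. sig (lookup v a - lookup v b) powi (?e a - ?e b)) =
      (\<Prod>j=1..r. Y_weight v j powi ?e j)" by simp
  moreover have "q powi (- s * int n - (\<Sum>j=1..r. ?e j * lookup v j)) =
      q powi (- (s * int n)) * q powi (- (\<Sum>j=1..r. ?e j * lookup v j))"
    using q_nonzero by (simp flip: power_int_add)
  ultimately show ?thesis
    unfolding gamma_def fst_conv snd_conv s ip roots by (simp only: mult.assoc)
qed

lemma Y_weight_refl_aux:
  assumes i: "1 \<le> i" "i < r" and ne: "lookup v i \<noteq> lookup v (i + 1)"
  shows "Y_weight (perm_act (simple_refl i) v) i = Y_weight v (i + 1)"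
proof -
  let ?s = "simple_refl i"
  have "{i<..r} = insert (i + 1) {i + 1<..r}" "{1..<i + 1} = insert i {1..<i}" using i by auto
  moreover have "(\<Prod>p\<in>{i + 1<..r}. sig (lookup v (i + 1) - lookup v (?s p))) =
      (\<Prod>p\<in>{i + 1<..r}. sig (lookup v (i + 1) - lookup v p))"
    by (rule prod.cong) (auto simp: simple_refl_apply)
  moreover have "(\<Prod>p\<in>{1..<i}. inverse (sig (lookup v (?s p) - lookup v (i + 1)))) =
      (\<Prod>p\<in>{1..<i}. inverse (sig (lookup v p - lookup v (i + 1))))"
    by (rule prod.cong) (auto simp: simple_refl_apply)
  moreover have "sig (lookup v (i + 1) - lookup v i) = inverse (sig (lookup v i - lookup v (i + 1)))"
    using sig_inverse[of "lookup v i - lookup v (i + 1)"] ne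
    by (simp add: inverse_unique)
  ultimately show ?thesis
    unfolding Y_weight_def by (simp add: simple_refl_apply mult_ac)
qed

text \<open>Apart from reordering factors, the pair \<open>(i, i + 1)\<close> needs
  \<open>sig a * sig (- a) = 1\<close>, which fails at \<open>a = 0\<close> because
  \<open>sig 0 = k\<close>.\<close>

lemma Y_weight_refl:
  assumes i: "1 \<le> i" "i < r" and ne: "lookup v i \<noteq> lookup v (i + 1)"
  shows "Y_weight (perm_act (simple_refl i) v) j = Y_weight v (simple_refl i j)"
proof -
  let ?s = "simple_refl i"
  consider "j = i" | "j = i + 1" | "j \<noteq> i" "j \<noteq> i + 1" by blast
  then show ?thesis
  proof cases
    case 1
    then show ?thesis using Y_weight_refl_aux[OF i ne] by (simp add: simple_refl_apply)
  next
    case 2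
    have "perm_act ?s (perm_act ?s v) = v" by (simp add: perm_act_comp)
    then show ?thesis
      using 2 Y_weight_refl_aux[OF i, of "perm_act ?s v"] ne by (simp add: simple_refl_apply)
  next
    case 3
    have "(\<Prod>p\<in>{j<..r}. sig (lookup v j - lookup v (?s p))) = (\<Prod>p\<in>{j<..r}. sig (lookup v j - lookup v p))"
      using 3 i by (intro prod.reindex_bij_witness[where i = ?s and j = ?s]) (auto simp: simple_refl_apply)
    moreover have "(\<Prod>p\<in>{1..<j}. inverse (sig (lookup v (?s p) - lookup v j))) =
        (\<Prod>p\<in>{1..<j}. inverse (sig (lookup v p - lookup v j)))"
      using 3 i by (intro prod.reindex_bij_witness[where i = ?s and j = ?s]) (auto simp: simple_refl_apply)
    ultimately show ?thesis
      using 3 by (simp add: Y_weight_def simple_refl_apply)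
  qed
qed

text \<open>Holds without exception: reflection about \<open>n / 2\<close> exchanges positive and
  nonpositive multiples of \<open>n\<close>, hence the values \<open>k^-1\<close> and
  \<open>k\<close>.\<close>

lemma sig_reflect: "sig (int n - a) = inverse (sig a)"
proof (cases "int n dvd a")
  case True
  show ?thesis
  proof (cases "a > 0")
    case pos: True
    then have "int n \<le> a" using True by (rule zdvd_imp_le[rotated])
    then show ?thesis using True pos by (simp add: sigma_def G_dvd)
  next
    case False
    then show ?thesis using True n_pos by (simp add: sigma_def G_dvd)
  qed
next
  case False
  then have "\<not> int n dvd int n - a" by (simp add: dvd_diff_right_iff)
  moreover have "G (int n - a) = G (- a)" using G_shift(1)[of "- a"] by (simp add: algebra_simps)
  ultimately show ?thesis
    using False G_inverse[of a] by (simp add: sigma_def inverse_unique)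
qed

text \<open>Reflection about \<open>n\<close> fixes \<open>a = n\<close>, where
  \<open>sig a = k^-1\<close> is not matched by its inverse.\<close>

lemma sig_reflect_twice:
  assumes "a \<noteq> int n"
  shows "sig (2 * int n - a) = inverse (sig a)"
proof (cases "int n dvd a")
  case True
  then obtain b where b: "a = int n * b" by (elim dvdE)
  have "2 * int n - a > 0 \<longleftrightarrow> \<not> a > 0"
  proof -
    have "2 * int n - a = int n * (2 - b)" using b by (simp add: algebra_simps)
    moreover have "b \<noteq> 1" using assms b by auto
    ultimately show ?thesis using n_pos b by (auto simp: zero_less_mult_iff)
  qed
  then show ?thesis using True by (auto simp: sigma_def G_dvd)
next
  case False
  have "2 * int n - a = int n - (a - int n)" by simp
  then have "sig (2 * int n - a) = inverse (sig (a - int n))" by (simp only: sig_reflect)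
  moreover have "\<not> int n dvd a - int n" using False by (metis diff_add_cancel dvd_add dvd_refl)
  ultimately show ?thesis using False G_shift(2)[of a] by (simp add: sigma_def)
qed

text \<open>Pairs with one entry at 1 or \<open>r\<close> change by the reflection \<open>a\<close>
  to \<open>n - a\<close>, always harmless. Only the pair \<open>(1, r)\<close> is reflected by
  \<open>a\<close> to \<open>2n - a\<close>, which explains the condition.\<close>

lemma Y_weight_affine:
  fixes v defines "v' \<equiv> aff_act (aff_gen r n 0) v"
  assumes ne: "lookup v 1 - lookup v r \<noteq> int n" and j: "j \<in> {1..r}"
  shows "Y_weight v' j = (if j = 1 then q powi (- int n) * Y_weight v r else if j = r then q powi int n * Y_weight v 1 else Y_weight v j)"
proof -
  let ?l = "lookup v"
  have l: "lookup v' p = (if p = 1 then ?l r + int n else if p = r then ?l 1 - int n else ?l p)" for p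
    using r_ge_2 by (auto simp: v'_def lookup_aff_gen transpose_def)
  have sig_neg: "sig (a - b + int n) = inverse (sig (b - a))" for a b
    using sig_reflect[of "b - a"] by (simp add: algebra_simps)
  have q_add: "q powi (a + b) = q powi a * q powi b" for a b
    using q_nonzero by (simp add: power_int_add)
  consider "j = 1" | "j = r" "j \<noteq> 1" | "j \<noteq> 1" "j \<noteq> r" by blast
  then show ?thesis
  proof cases
    case 1
    have s: "{1<..r} = insert r {1<..<r}" "{1..<r} = insert 1 {1<..<r}" using r_ge_2 by auto
    have "(\<Prod>p\<in>{1<..<r}. sig (lookup v' 1 - lookup v' p)) = (\<Prod>p\<in>{1<..<r}. inverse (sig (?l p - ?l r)))"
    proof (rule prod.cong)
      fix p assume "p \<in> {1<..<r}"
      then have "lookup v' 1 - lookup v' p = ?l r - ?l p + int n" by (simp add: l)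
      then show "sig (lookup v' 1 - lookup v' p) = inverse (sig (?l p - ?l r))" by (simp only: sig_neg)
    qed simp
    moreover have "sig (lookup v' 1 - lookup v' r) = inverse (sig (?l 1 - ?l r))"
    proof -
      have "lookup v' 1 - lookup v' r = 2 * int n - (?l 1 - ?l r)" using r_ge_2 by (simp add: l)
      then show ?thesis using sig_reflect_twice[OF ne] by (simp only:)
    qed
    moreover have "q powi (- lookup v' 1) = q powi (- int n) * q powi (- ?l r)"
    proof -
      have "- lookup v' 1 = - int n + - ?l r" by (simp add: l)
      then show ?thesis by (simp only: q_add)
    qed
    ultimately have "Y_weight v' 1 = q powi (- int n) * Y_weight v r"
      unfolding Y_weight_def s by simp
    then show ?thesis using 1 by simp
  next
    case 2
    have s: "{1<..r} = insert r {1<..<r}" "{1..<r} = insert 1 {1<..<r}" using r_ge_2 by auto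
    have "(\<Prod>p\<in>{1<..<r}. inverse (sig (lookup v' p - lookup v' r))) = (\<Prod>p\<in>{1<..<r}. sig (?l 1 - ?l p))"
    proof (rule prod.cong)
      fix p assume "p \<in> {1<..<r}"
      then have "lookup v' p - lookup v' r = ?l p - ?l 1 + int n" by (simp add: l)
      then show "inverse (sig (lookup v' p - lookup v' r)) = sig (?l 1 - ?l p)"
        by (simp only: sig_neg inverse_inverse_eq)
    qed simp
    moreover have "inverse (sig (lookup v' 1 - lookup v' r)) = sig (?l 1 - ?l r)"
    proof -
      have "lookup v' 1 - lookup v' r = 2 * int n - (?l 1 - ?l r)" using r_ge_2 by (simp add: l)
      then show ?thesis using sig_reflect_twice[OF ne] by (simp only: inverse_inverse_eq)
    qed
    moreover have "q powi (- lookup v' r) = q powi int n * q powi (- ?l 1)"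
      unfolding q_add[symmetric] using 2 by (simp add: l)
    ultimately have "Y_weight v' r = q powi int n * Y_weight v 1"
      unfolding Y_weight_def s by simp
    then show ?thesis using 2 by simp
  next
    case 3
    then have s: "{j<..r} = insert r {j<..<r}" "{1..<j} = insert 1 {1<..<j}" using j by auto
    have "(\<Prod>p\<in>{j<..<r}. sig (lookup v' j - lookup v' p)) = (\<Prod>p\<in>{j<..<r}. sig (?l j - ?l p))"
      using 3 j by (intro prod.cong) (auto simp: l)
    moreover have "(\<Prod>p\<in>{1<..<j}. inverse (sig (lookup v' p - lookup v' j))) =
        (\<Prod>p\<in>{1<..<j}. inverse (sig (?l p - ?l j)))"
      using 3 j by (intro prod.cong) (auto simp: l)
    moreover have "sig (lookup v' j - lookup v' r) = inverse (sig (?l 1 - ?l j))"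
    proof -
      have "lookup v' j - lookup v' r = ?l j - ?l 1 + int n" using 3 j by (simp add: l)
      then show ?thesis by (simp only: sig_neg)
    qed
    moreover have "inverse (sig (lookup v' 1 - lookup v' j)) = sig (?l j - ?l r)"
    proof -
      have "lookup v' 1 - lookup v' j = ?l r - ?l j + int n" using 3 j by (simp add: l)
      then show ?thesis by (simp only: sig_neg inverse_inverse_eq)
    qed
    moreover have "q powi (- lookup v' j) = q powi (- ?l j)" using 3 by (simp add: l)
    ultimately have "Y_weight v' j = Y_weight v j"
      unfolding Y_weight_def s by simp
    then show ?thesis using 3 by simp
  qed
qed

section \<open>Words acting on weights and the equivariance of \<open>gamma\<close>\<close>

definition act :: "nat list \<Rightarrow> (nat \<Rightarrow>\<^sub>0 int) \<Rightarrow> (nat \<Rightarrow>\<^sub>0 int)" where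
  "act ws v = foldr (\<lambda>i. aff_act (aff_gen r n i)) ws v"

lemma act_simps [simp]: "act [] v = v" "act (i # ws) v = aff_act (aff_gen r n i) (act ws v)"
  by (simp_all add: act_def)

fun moves :: "nat list \<Rightarrow> (nat \<Rightarrow>\<^sub>0 int) \<Rightarrow> bool" where
  "moves [] v \<longleftrightarrow> True"
| "moves (i # ws) v \<longleftrightarrow> act (i # ws) v \<noteq> act ws v \<and> moves ws v"

lemma aff_gen_act_pos:
  "i \<noteq> 0 \<Longrightarrow> aff_act (aff_gen r n i) v = perm_act (simple_refl i) (v :: nat \<Rightarrow>\<^sub>0 int)"
  by (intro poly_mapping_eqI) (simp add: lookup_aff_gen)

lemma aff_gen_moves_pos:
  assumes "i \<noteq> 0" "aff_act (aff_gen r n i) v \<noteq> (v :: nat \<Rightarrow>\<^sub>0 int)"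
  shows "lookup v i \<noteq> lookup v (i + 1)"
  using assms by (auto simp: aff_gen_act_pos perm_act_simple_refl)

lemma aff_gen_moves_0:
  assumes "aff_act (aff_gen r n 0) v \<noteq> (v :: nat \<Rightarrow>\<^sub>0 int)"
  shows "lookup v 1 - lookup v r \<noteq> int n"
proof
  assume "lookup v 1 - lookup v r = int n"
  then have "aff_act (aff_gen r n 0) v = v"
    using r_ge_2 by (intro poly_mapping_eqI) (auto simp: lookup_aff_gen transpose_def)
  with assms show False by simp
qed

text \<open>By \<open>gamma_eq\<close> it suffices to follow the joint eigenvalues, which a letter
  that moves \<open>v\<close> permutes. For the letter 0 the factors \<open>q^n\<close> and
  \<open>q^(-n)\<close> match the change of the coefficient of \<open>delta\<close>.\<close>

lemma gamma_lin_gen: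
  assumes i: "i < r" and ne: "aff_act (aff_gen r n i) v \<noteq> v"
  shows "gamma r n k q G (lin_gen r n i (scale (int n) \<eta>, s * (int n)\<^sup>2)) v =
    gamma r n k q G (scale (int n) \<eta>, s * (int n)\<^sup>2) (aff_act (aff_gen r n i) v)"
proof (cases "i = 0")
  case False
  have b: "lin_gen r n i (scale (int n) \<eta>, s * (int n)\<^sup>2) =
      (scale (int n) (perm_act (simple_refl i) \<eta>), s * (int n)\<^sup>2)"
    using False by (simp add: lin_gen_def perm_act_scale)
  have "(\<Prod>j=1..r. Y_weight v j powi lookup (perm_act (simple_refl i) \<eta>) j) =
      (\<Prod>j=1..r. Y_weight v (simple_refl i j) powi lookup \<eta> j)"
    using prod.permute[OF simple_refl_permutes[of i r], of "\<lambda>j. Y_weight v j powi lookup \<eta> (simple_refl i j)"]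
      False i by (simp add: comp_def)
  also have "\<dots> = (\<Prod>j=1..r. Y_weight (aff_act (aff_gen r n i) v) j powi lookup \<eta> j)"
    using False i Y_weight_refl[of i v] aff_gen_moves_pos[OF False ne] by (simp add: aff_gen_act_pos)
  finally show ?thesis unfolding b gamma_eq by simp
next
  case True
  let ?\<theta> = "transpose 1 r" and ?v = "aff_act (aff_gen r n 0) v" and ?e = "lookup \<eta>"
  have h: "ip r \<eta> (highest_root r) = ?e 1 - ?e r"
    unfolding highest_root_def using r_ge_2 by (intro ip_eps_diff) auto
  have "ip r (scale (int n) \<eta>) (highest_root r) = int n * ip r \<eta> (highest_root r)"
    by (simp add: ip_def sum_distrib_left mult.assoc)
  then have b: "lin_gen r n i (scale (int n) \<eta>, s * (int n)\<^sup>2) =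
      (scale (int n) (perm_act ?\<theta> \<eta>), (s + (?e 1 - ?e r)) * (int n)\<^sup>2)"
    using True unfolding h by (simp add: lin_gen_def perm_act_scale distrib_right power2_eq_square)
  have one_r: "1 \<in> {1..r}" "r \<in> {1..r}" "1 \<noteq> r" using r_ge_2 by auto
  have gv: "Y_weight ?v j = (if j = 1 then q powi (- int n) * Y_weight v r else if j = r then q powi int n * Y_weight v 1 else Y_weight v j)"
    if "j \<in> {1..r}" for j
    using Y_weight_affine[OF aff_gen_moves_0 that] ne True by simp
  have rest: "(\<Prod>j\<in>{1..r} - {1, r}. Y_weight ?v j powi ?e j) = (\<Prod>j\<in>{1..r} - {1, r}. Y_weight v j powi lookup (perm_act ?\<theta> \<eta>) j)"
    by (rule prod.cong) (auto simp: gv lookup_perm_act transpose_def)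
  have "q powi (- ((s + (?e 1 - ?e r)) * int n)) = q powi (- (s * int n)) * (q powi (- int n * ?e 1) * q powi (int n * ?e r))"
    using q_nonzero by (simp add: algebra_simps flip: power_int_add)
  moreover have "(q powi (- int n) * Y_weight v r) powi ?e 1 = q powi (- int n * ?e 1) * Y_weight v r powi ?e 1"
    "(q powi int n * Y_weight v 1) powi ?e r = q powi (int n * ?e r) * Y_weight v 1 powi ?e r"
    by (simp_all only: power_int_mult_distrib power_int_mult)
  moreover have "lookup (perm_act ?\<theta> \<eta>) 1 = ?e r" "lookup (perm_act ?\<theta> \<eta>) r = ?e 1"
    by (simp_all add: lookup_perm_act)
  ultimately show ?thesis
    unfolding b unfolding gamma_eq True prod_split_pair[OF one_r] rest[symmetric]
    using one_r by (simp add: gv)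
qed

text \<open>Keeps vectors in the lattice on which the integer divisions inside \<open>gamma\<close>
  are exact, so that \<open>gamma_eq\<close> applies after each letter.\<close>

lemma lin_gen_form:
  "\<exists>\<eta>' s'. lin_gen r n i (scale (int n) \<eta>, s * (int n)\<^sup>2) = (scale (int n) \<eta>', s' * (int n)\<^sup>2)"
proof (cases "i = 0")
  case False
  then show ?thesis by (auto simp: lin_gen_def perm_act_scale)
next
  case True
  have "ip r (scale (int n) \<eta>) (highest_root r) = int n * ip r \<eta> (highest_root r)"
    by (simp add: ip_def sum_distrib_left mult.assoc)
  then have "lin_gen r n i (scale (int n) \<eta>, s * (int n)\<^sup>2) =
      (scale (int n) (perm_act (transpose 1 r) \<eta>), (s + ip r \<eta> (highest_root r)) * (int n)\<^sup>2)"
    using True by (simp add: lin_gen_def perm_act_scale algebra_simps power2_eq_square)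
  then show ?thesis by blast
qed

lemma gamma_fold_lin_gen:
  assumes "set ws \<subseteq> {0..<r}" "moves ws v"
  shows "gamma r n k q G (fold (lin_gen r n) ws (scale (int n) \<eta>, s * (int n)\<^sup>2)) v =
    gamma r n k q G (scale (int n) \<eta>, s * (int n)\<^sup>2) (act ws v)"
  using assms
proof (induction ws arbitrary: \<eta> s)
  case (Cons i ws)
  obtain \<eta>' s' where b: "lin_gen r n i (scale (int n) \<eta>, s * (int n)\<^sup>2) = (scale (int n) \<eta>', s' * (int n)\<^sup>2)"
    using lin_gen_form by blast
  have "gamma r n k q G (fold (lin_gen r n) (i # ws) (scale (int n) \<eta>, s * (int n)\<^sup>2)) v =
      gamma r n k q G (lin_gen r n i (scale (int n) \<eta>, s * (int n)\<^sup>2)) (act ws v)"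
    using Cons b by simp
  also have "\<dots> = gamma r n k q G (scale (int n) \<eta>, s * (int n)\<^sup>2) (act (i # ws) v)"
    using Cons.prems by (subst gamma_lin_gen) auto
  finally show ?case .
qed simp

lemma lin_gen_uminus: "lin_gen r n i (- b) = - lin_gen r n i b"
proof -
  have "perm_act w (- u) = - perm_act w u" if "bij w" for w and u :: "nat \<Rightarrow>\<^sub>0 int"
    using that by (intro poly_mapping_eqI) (simp add: lookup_perm_act)
  moreover have "ip r (- u) v = - ip r u v" for u v :: "nat \<Rightarrow>\<^sub>0 int"
    by (simp add: ip_def sum_negf)
  ultimately show ?thesis by (cases b) (simp add: lin_gen_def)
qed

lemma fold_lin_gen_uminus: "fold (lin_gen r n) ws (- b) = - fold (lin_gen r n) ws b"
  by (induction ws arbitrary: b) (simp_all add: lin_gen_uminus)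

lemma aff_root_form:
  "\<exists>\<eta> s. - aff_root r n i = (scale (int n) \<eta>, s * (int n)\<^sup>2)"
proof (cases "i = 0")
  case True
  have "- aff_root r n i = (scale (int n) (highest_root r), (- 1) * (int n)\<^sup>2)"
    using True by (simp add: aff_root_def)
  then show ?thesis by blast
next
  case False
  have "- aff_root r n i = (scale (int n) (- simple_root i), 0 * (int n)\<^sup>2)"
    using False by (auto simp: aff_root_def intro: poly_mapping_eqI)
  then show ?thesis by blast
qed

text \<open>Replaces \<open>gamma(-beta_j; lambda)\<close> by the value of \<open>gamma\<close> at a
  simple affine root and the weight reached so far, which is a ratio of two eigenvalues up to a
  power of \<open>q\<close>.\<close>

lemma gamma_beta:
  assumes "set ws \<subseteq> {0..<r}" "moves ws v"
  shows "gamma r n k q G (- fold (lin_gen r n) ws (aff_root r n i)) v =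
    gamma r n k q G (- aff_root r n i) (act ws v)"
proof -
  obtain \<eta> s where "- aff_root r n i = (scale (int n) \<eta>, s * (int n)\<^sup>2)" using aff_root_form by blast
  then show ?thesis
    using gamma_fold_lin_gen[OF assms, of \<eta> s] fold_lin_gen_uminus[of ws "aff_root r n i"] by simp
qed

lemma gamma_minus_simple_root:
  assumes "1 \<le> i" "i < r"
  shows "gamma r n k q G (- aff_root r n i) v = Y_weight v (i + 1) / Y_weight v i"
proof -
  have b: "- aff_root r n i = (scale (int n) (- simple_root i), 0 * (int n)\<^sup>2)"
    using assms by (auto simp: aff_root_def intro: poly_mapping_eqI)
  have "(\<Prod>j\<in>{1..r} - {i, i + 1}. Y_weight v j powi lookup (- simple_root i) j) = 1"
    by (rule prod.neutral) (auto simp: simple_root_def lookup_minus lookup_eps)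
  moreover have "i \<in> {1..r}" "i + 1 \<in> {1..r}" "i \<noteq> i + 1" using assms by auto
  ultimately show ?thesis
    unfolding b gamma_eq prod_split_pair[OF \<open>i \<in> {1..r}\<close> \<open>i + 1 \<in> {1..r}\<close> \<open>i \<noteq> i + 1\<close>]
    by (simp add: simple_root_def lookup_minus lookup_eps power_int_minus divide_inverse)
qed

lemma gamma_minus_affine_root:
  "gamma r n k q G (- aff_root r n 0) v = q powi int n * Y_weight v 1 / Y_weight v r"
proof -
  have b: "- aff_root r n 0 = (scale (int n) (highest_root r), (- 1) * (int n)\<^sup>2)"
    by (simp add: aff_root_def)
  have "(\<Prod>j\<in>{1..r} - {1, r}. Y_weight v j powi lookup (highest_root r) j) = 1"
    by (rule prod.neutral) (auto simp: highest_root_def lookup_minus lookup_eps)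
  moreover have *: "1 \<in> {1..r}" "r \<in> {1..r}" "1 \<noteq> r" using r_ge_2 by auto
  ultimately show ?thesis
    unfolding b gamma_eq prod_split_pair[OF *]
    using *(3) by (simp add: highest_root_def lookup_minus lookup_eps power_int_minus divide_inverse)
qed

lemma gamma_eps:
  assumes "j \<in> {1..r}"
  shows "gamma r n k q G (scale (int n) (eps j), 0) v = Y_weight v j"
proof -
  have "(\<Prod>p=1..r. Y_weight v p powi lookup (eps j) p) = (\<Prod>p=1..r. if p = j then Y_weight v p else 1)"
    by (rule prod.cong) (auto simp: lookup_eps)
  then show ?thesis using gamma_eq[of "eps j" 0 v] assms by simp
qed

subsection \<open>Intertwiners and the polynomials \<open>E\<^sub>\<mu>\<close>\<close>

abbreviation "lp \<equiv> (laurent_polys r :: 'f laurent set)"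

lemma lp_add: "f \<in> lp \<Longrightarrow> g \<in> lp \<Longrightarrow> f + g \<in> lp"
  using keys_add[of f g] by (auto simp: laurent_polys_def)

lemma lp_zero: "0 \<in> lp"
  by (simp add: laurent_polys_def)

lemma lp_cst: "f \<in> lp \<Longrightarrow> cst c * f \<in> lp"
  by (auto simp: laurent_polys_def in_keys_iff)

lemma lp_diff: "f \<in> lp \<Longrightarrow> g \<in> lp \<Longrightarrow> f - g \<in> lp"
  using lp_add[of f "cst (- 1) * g"] lp_cst[of g "- 1"] by (simp add: single_uminus)

lemma lp_xpow: "v \<in> vectors r \<Longrightarrow> xpow v \<in> lp"
  by (simp add: laurent_polys_def)

lemma lp_sum: "(\<And>i. i \<in> I \<Longrightarrow> f i \<in> lp) \<Longrightarrow> (\<Sum>i\<in>I. f i) \<in> lp"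
  by (induction I rule: infinite_finite_induct) (auto simp: lp_add lp_zero)

lemma lp_linop:
  assumes "linop F" "f \<in> lp" "\<And>v. v \<in> vectors r \<Longrightarrow> F (xpow v) \<in> lp"
  shows "F f \<in> lp"
proof -
  have "F f = (\<Sum>v\<in>keys f. cst (lookup f v) * F (xpow v))"
    by (subst laurent_expansion) (simp add: linop_sum[OF assms(1)] linop_cst[OF assms(1)])
  moreover have "v \<in> vectors r" if "v \<in> keys f" for v
    using assms(2) that by (auto simp: laurent_polys_def)
  ultimately show ?thesis
    using assms(3) by (auto intro!: lp_sum lp_cst)
qed

lemma vectors_add_root:
  assumes "1 \<le> i" "i < r" "v \<in> vectors r"
  shows "v + scale c (simple_root i) \<in> vectors r"
  using assms by (auto simp: vectors_def in_keys_iff lookup_add simple_root_def lookup_minus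
      lookup_eps split: if_splits)

lemma lp_T:
  assumes i: "1 \<le> i" "i < r" and f: "f \<in> lp"
  shows "T i f \<in> lp"
proof (rule lp_linop[OF linop_T f])
  fix v :: "nat \<Rightarrow>\<^sub>0 int" assume v: "v \<in> vectors r"
  obtain R where R: "T i (xpow v) = cst (sig (lookup v i - lookup v (i + 1))) * xpow (perm_act (simple_refl i) v) +
       (if lookup v i - lookup v (i + 1) < 0 then hk * xpow v else 0) + R"
    "\<And>u. u \<in> keys R \<Longrightarrow> \<exists>c. int n dvd c \<and> c * (c + (lookup v i - lookup v (i + 1))) < 0 \<and> u = v + scale c (simple_root i)"
    using T_expand[OF i] by blast
  have "R \<in> lp" using R(2) vectors_add_root[OF i v] by (force simp: laurent_polys_def)
  moreover have "xpow (perm_act (simple_refl i) v) \<in> lp"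
    unfolding perm_act_simple_refl by (intro lp_xpow vectors_add_root i v)
  moreover have "(if lookup v i - lookup v (i + 1) < 0 then hk * xpow v else 0) \<in> lp"
    using lp_cst[OF lp_xpow[OF v]] by (auto simp: laurent_polys_def)
  ultimately show "T i (xpow v) \<in> lp"
    unfolding R(1) by (intro lp_add lp_cst)
qed

lemma lp_T': "1 \<le> i \<Longrightarrow> i < r \<Longrightarrow> f \<in> lp \<Longrightarrow> T' i f \<in> lp"
  by (simp add: T'_def lp_diff lp_T lp_cst)

lemma lp_mult_xpow:
  assumes "\<beta> \<in> vectors r" "f \<in> lp"
  shows "xpow \<beta> * f \<in> lp"
proof (rule lp_linop[OF linop_mult assms(2)])
  fix v :: "nat \<Rightarrow>\<^sub>0 int" assume "v \<in> vectors r"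
  then have "\<beta> + v \<in> vectors r"
    using assms(1) keys_add[of \<beta> v] by (auto simp: vectors_def)
  then show "xpow \<beta> * xpow v \<in> lp" by (simp add: lp_xpow flip: xpow_add)
qed

lemma lp_om: "f \<in> lp \<Longrightarrow> om f \<in> lp"
proof (rule lp_linop[OF linop_om])
  fix v
  have "rotate_vec r v \<in> vectors r"
    using r_ge_2 by (auto simp: vectors_def in_keys_iff lookup_rotate_vec split: if_splits)
  then show "om (xpow v) \<in> lp" unfolding om_xpow by (intro lp_cst lp_xpow)
qed

lemma lp_fold_T: "set ws \<subseteq> {1..<r} \<Longrightarrow> f \<in> lp \<Longrightarrow> fold T ws f \<in> lp"
  and lp_foldr_T: "set ws \<subseteq> {1..<r} \<Longrightarrow> f \<in> lp \<Longrightarrow> foldr T ws f \<in> lp"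
  and lp_fold_T': "set ws \<subseteq> {1..<r} \<Longrightarrow> f \<in> lp \<Longrightarrow> fold T' ws f \<in> lp"
  by (induction ws arbitrary: f) (auto simp: lp_T lp_T')

lemma scale_eps_vectors: "j \<in> {1..r} \<Longrightarrow> scale c (eps j) \<in> vectors r"
  by (auto simp: vectors_def in_keys_iff lookup_eps split: if_splits)

lemma lp_T_aff:
  assumes "i < r" "f \<in> lp"
  shows "T_aff i f \<in> lp"
proof -
  have 1: "1 \<in> {1..r}" using r_ge_2 by simp
  have "pi_inv f \<in> lp"
    unfolding pi_inv_def by (intro lp_fold_T' lp_mult_xpow scale_eps_vectors 1 assms) auto
  then have "T (r - 1) (pi_inv f) \<in> lp" using r_ge_2 by (intro lp_T) auto
  then have "pi_op (T (r - 1) (pi_inv f)) \<in> lp"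
    unfolding pi_op_def X_def by (intro lp_foldr_T lp_mult_xpow scale_eps_vectors 1) auto
  then show ?thesis using assms by (simp add: T_aff_def lp_T)
qed

lemma T_inv_eq:
  assumes i: "1 \<le> i" "i < r" and f: "f \<in> lp"
  shows "T_inv r n k G i f = T' i f"
  unfolding T_inv_def
proof (rule inv_into_f_eq)
  show "inj_on (T i) lp" by (rule inj_on_inverseI[of _ "T' i"]) (simp add: T'_T[OF i])
qed (simp_all add: i f T_T' lp_T')

lemma Y_op_eq:
  assumes "j \<in> {1..r}" "f \<in> lp"
  shows "Y_op r n k q G j f = Y j f"
proof -
  have "fold (T_inv r n k G) ws g = fold T' ws g" if "set ws \<subseteq> {1..<r}" "g \<in> lp" for ws g
    using that by (induction ws arbitrary: g) (auto simp: T_inv_eq lp_T')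
  moreover have "set [j..<r] \<subseteq> {1..<r}" "set [1..<j] \<subseteq> {1..<r}" using assms(1) by auto
  ultimately show ?thesis
    unfolding Y_op_def Y_def using assms(2) by (simp add: lp_om lp_fold_T)
qed

lemma T_aff_quadratic:
  assumes "i < r"
  shows "T_aff i (T_aff i f) = hk * T_aff i f + f"
proof (cases "i = 0")
  case True
  have "1 \<le> r - 1" "r - 1 < r" using r_ge_2 by auto
  then show ?thesis
    using True by (simp add: T_aff_def T_quadratic linop_add[OF linop_pi_op] linop_cst[OF linop_pi_op])
next
  case False
  then show ?thesis using assms by (simp add: T_aff_def T_quadratic)
qed

text \<open>The quadratic relation leaves only the eigenvalues \<open>k\<close> and
  \<open>- k^-1\<close> for \<open>T_aff i\<close>. This bounds when an intertwiner can kill a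
  vector.\<close>

lemma T_aff_eigenvalue:
  assumes "i < r" "f \<noteq> 0" "T_aff i f + cst c * f = 0"
  shows "c = - k \<or> c = inverse k"
proof -
  have T: "T_aff i f = cst (- c) * f"
    using assms(3) by (simp add: single_uminus eq_neg_iff_add_eq_0)
  have "cst (- c) * (cst (- c) * f) = hk * (cst (- c) * f) + f"
    using T_aff_quadratic[OF assms(1), of f] unfolding T linop_cst[OF linop_T_aff] T by simp
  moreover obtain v where v: "lookup f v \<noteq> 0"
    using assms(2) by (metis lookup_zero poly_mapping_eqI)
  ultimately have "lookup (cst (- c) * (cst (- c) * f)) v = lookup (hk * (cst (- c) * f) + f) v" by simp
  then have "(c * c) * lookup f v = (- (k - inverse k) * c + 1) * lookup f v"
    unfolding lookup_add lookup_cst_mult by (simp add: algebra_simps)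
  then have "c * c = - (k - inverse k) * c + 1" using v by simp
  then have "(c + k) * (c - inverse k) = 0"
    using k_nonzero by (simp add: algebra_simps)
  then show ?thesis by (auto simp: add_eq_0_iff2)
qed

definition step_coeff :: "nat \<Rightarrow> nat list \<Rightarrow> (nat \<Rightarrow>\<^sub>0 int) \<Rightarrow> 'f" where
  "step_coeff i ws v = gamma r n k q G (- fold (lin_gen r n) ws (aff_root r n i)) v"

fun intertwined :: "nat list \<Rightarrow> (nat \<Rightarrow>\<^sub>0 int) \<Rightarrow> 'f laurent" where
  "intertwined [] v = xpow v"
| "intertwined (i # ws) v = T_aff i (intertwined ws v) +
     cst ((inverse k - k) / (1 - step_coeff i ws v)) * intertwined ws v"

end

text \<open>\<open>M\<close> is the group of signed monomials in the parameters other than \<open>q\<close>.\<close>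

locale generic_metaplectic = metaplectic +
  fixes M :: "'a set"
  assumes M_mult: "x \<in> M \<Longrightarrow> y \<in> M \<Longrightarrow> x * y \<in> M"
    and M_inverse: "x \<in> M \<Longrightarrow> inverse x \<in> M"
    and M_nonzero: "0 \<notin> M" and M_G: "G j \<in> M"
    and q_generic: "q powi m \<in> M \<Longrightarrow> m = 0"
begin

lemma M_k: "k \<in> M"
  using M_G[of 0] G_0 by simp

lemma M_one: "1 \<in> M"
  using M_mult[OF M_k M_inverse[OF M_k]] k_nonzero by simp

lemma M_prod: "(\<And>i. i \<in> A \<Longrightarrow> f i \<in> M) \<Longrightarrow> (\<Prod>i\<in>A. f i) \<in> M"
  by (induction A rule: infinite_finite_induct) (auto simp: M_one M_mult)

lemma M_sig: "sig a \<in> M"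
  by (simp add: sigma_def M_G M_inverse M_k)

lemma Y_weight_form: "\<exists>m\<in>M. Y_weight v j = q powi (- lookup v j) * m"
proof
  show "Y_weight v j = q powi (- lookup v j) * ((\<Prod>p\<in>{j<..r}. sig (lookup v j - lookup v p)) *
      (\<Prod>p\<in>{1..<j}. inverse (sig (lookup v p - lookup v j))))"
    by (simp add: Y_weight_def mult.assoc)
qed (intro M_mult M_prod M_inverse M_sig)

lemma q_powi_M:
  assumes "q powi a * x \<in> M" "x \<in> M"
  shows "a = 0"
proof -
  have "x \<noteq> 0" using assms(2) M_nonzero by blast
  then have "q powi a * x * inverse x = q powi a" by (simp add: mult.assoc)
  then have "q powi a \<in> M" using M_mult[OF assms(1) M_inverse[OF assms(2)]] by (simp only:)
  then show ?thesis by (rule q_generic)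
qed

lemma Y_weight_separates:
  assumes "Y_weight u j = Y_weight v j"
  shows "lookup u j = lookup v j"
proof -
  obtain a b where ab: "a \<in> M" "b \<in> M" "Y_weight u j = q powi (- lookup u j) * a" "Y_weight v j = q powi (- lookup v j) * b"
    using Y_weight_form by metis
  have "q powi (lookup v j - lookup u j) * a = q powi lookup v j * (q powi (- lookup u j) * a)"
    using q_nonzero by (simp add: mult.assoc[symmetric] flip: power_int_add)
  also have "\<dots> = q powi lookup v j * (q powi (- lookup v j) * b)"
    using assms ab by simp
  also have "\<dots> = b"
    using q_nonzero by (simp add: mult.assoc[symmetric] flip: power_int_add)
  finally have "lookup v j - lookup u j = 0" using q_powi_M ab by metis
  then show ?thesis by simp
qed

text \<open>The exponent of \<open>q\<close> is \<open>v_i - v_(i+1)\<close>, or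
  \<open>n - (v_1 - v_r)\<close> for the letter 0. It vanishes exactly when the letter fixes
  \<open>v\<close>.\<close>

lemma gamma_root_generic:
  assumes "i < r" "aff_act (aff_gen r n i) v \<noteq> v"
  shows "gamma r n k q G (- aff_root r n i) v \<notin> M"
proof (cases "i = 0")
  case True
  obtain a b where ab: "a \<in> M" "b \<in> M" "Y_weight v 1 = q powi (- lookup v 1) * a" "Y_weight v r = q powi (- lookup v r) * b"
    using Y_weight_form by metis
  have "q powi (int n - (lookup v 1 - lookup v r)) = q powi int n * q powi (- lookup v 1) * inverse (q powi (- lookup v r))"
    using q_nonzero by (simp add: power_int_diff power_int_minus divide_inverse)
  then have "gamma r n k q G (- aff_root r n i) v = q powi (int n - (lookup v 1 - lookup v r)) * (a * inverse b)"
    using True gamma_minus_affine_root[of v] unfolding ab(3,4) by (simp add: divide_inverse)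
  moreover have "int n - (lookup v 1 - lookup v r) \<noteq> 0"
    using aff_gen_moves_0[of v] assms True by auto
  ultimately show ?thesis
    using q_powi_M M_mult[OF ab(1) M_inverse[OF ab(2)]] by metis
next
  case False
  obtain a b where ab: "a \<in> M" "b \<in> M" "Y_weight v (i + 1) = q powi (- lookup v (i + 1)) * a" "Y_weight v i = q powi (- lookup v i) * b"
    using Y_weight_form by metis
  have "gamma r n k q G (- aff_root r n i) v = q powi (lookup v i - lookup v (i + 1)) * (a * inverse b)"
    using False assms(1) gamma_minus_simple_root[of i v] q_nonzero unfolding ab(3,4)
    by (simp add: power_int_diff power_int_minus field_simps)
  moreover have "lookup v i - lookup v (i + 1) \<noteq> 0"
    using aff_gen_moves_pos[OF False assms(2)] by simp
  ultimately show ?thesis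
    using q_powi_M M_mult[OF ab(1) M_inverse[OF ab(2)]] by metis
qed

lemma step_coeff_eq:
  assumes "set ws \<subseteq> {0..<r}" "moves ws v"
  shows "step_coeff i ws v = gamma r n k q G (- aff_root r n i) (act ws v)"
  unfolding step_coeff_def by (rule gamma_beta[OF assms])

lemma step_coeff_generic:
  assumes "set (i # ws) \<subseteq> {0..<r}" "moves (i # ws) v"
  shows "step_coeff i ws v \<notin> M"
  using assms gamma_root_generic[of i "act ws v"] by (simp add: step_coeff_eq)

lemma intertwined_eigen:
  assumes "v \<in> alcove_weights r n" "set ws \<subseteq> {0..<r}" "moves ws v"
  shows "eigen (intertwined ws v) (Y_weight (act ws v)) \<and> intertwined ws v \<noteq> 0 \<and> intertwined ws v \<in> lp"
  using assms(2,3)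
proof (induction ws)
  case Nil
  have "xpow v \<noteq> (0 :: 'a laurent)"
    by (metis lookup_xpow lookup_zero zero_neq_one)
  then show ?case
    using alcove_eigen[OF assms(1)] assms(1) by (auto simp: alcove_weights_def intro: lp_xpow)
next
  case (Cons i ws)
  define f where "f = intertwined ws v"
  define u where "u = act ws v"
  define \<gamma> where "\<gamma> = step_coeff i ws v"
  define c where "c = (inverse k - k) / (1 - \<gamma>)"
  have IH: "eigen f (Y_weight u)" "f \<noteq> 0" "f \<in> lp" using Cons by (auto simp: f_def u_def)
  have i: "i < r" using Cons.prems by simp
  have mv: "aff_act (aff_gen r n i) u \<noteq> u" using Cons.prems by (simp add: u_def)
  have e: "intertwined (i # ws) v = T_aff i f + cst c * f"
    by (simp add: f_def c_def \<gamma>_def)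
  have \<gamma>: "\<gamma> = gamma r n k q G (- aff_root r n i) u"
    using Cons.prems by (simp add: \<gamma>_def u_def step_coeff_eq)
  have \<gamma>M: "\<gamma> \<notin> M" using gamma_root_generic[OF i mv] \<gamma> by simp
  then have \<gamma>1: "\<gamma> \<noteq> 1" using M_one by auto
  have "eigen (T_aff i f + cst c * f) (Y_weight (aff_act (aff_gen r n i) u))"
  proof (cases "i = 0")
    case True
    have \<gamma>0: "\<gamma> = q powi int n * Y_weight u 1 / Y_weight u r"
      unfolding \<gamma> True by (rule gamma_minus_affine_root)
    have "eigen (T_aff 0 f + cst c * f)
        (\<lambda>j. if j = 1 then q powi (- int n) * Y_weight u r else if j = r then q powi int n * Y_weight u 1 else Y_weight u j)"
      using \<gamma>1 \<gamma>0 Y_weight_nonzero by (intro T_aff_0_eigen IH) (auto simp: c_def)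
    then show ?thesis
      unfolding True by (rule eigen_cong) (use mv True Y_weight_affine[OF aff_gen_moves_0] in simp)
  next
    case False
    have \<gamma>i: "\<gamma> = Y_weight u (i + 1) / Y_weight u i"
      unfolding \<gamma> using False i by (intro gamma_minus_simple_root) auto
    have "eigen (T i f + cst c * f) (\<lambda>j. Y_weight u (simple_refl i j))"
      using \<gamma>1 \<gamma>i Y_weight_nonzero False i by (intro T_eigen IH) (auto simp: c_def)
    then have "eigen (T i f + cst c * f) (Y_weight (perm_act (simple_refl i) u))"
      by (rule eigen_cong) (use False i Y_weight_refl aff_gen_moves_pos[OF False mv] in simp)
    then show ?thesis using False by (simp add: T_aff_def aff_gen_act_pos)
  qed
  \<comment> \<open>Vanishing would force \<open>c = - k\<close> or \<open>c = k^-1\<close>, that is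
    \<open>\<gamma> = k^-2\<close> or \<open>\<gamma> = k^2\<close>, both monomials in
    \<open>M\<close>.\<close>
  moreover have "T_aff i f + cst c * f \<noteq> 0"
  proof
    assume "T_aff i f + cst c * f = 0"
    then have "c = - k \<or> c = inverse k" using T_aff_eigenvalue[OF i IH(2)] by blast
    then have "\<gamma> = inverse k * inverse k \<or> \<gamma> = k * k"
    proof
      assume "c = - k"
      then have "inverse k - k = - k * (1 - \<gamma>)" using \<gamma>1 by (simp add: c_def divide_eq_eq)
      then show ?thesis using k_nonzero by (simp add: field_simps)
    next
      assume "c = inverse k"
      then have "inverse k - k = inverse k * (1 - \<gamma>)" using \<gamma>1 by (simp add: c_def divide_eq_eq)
      then show ?thesis using k_nonzero by (simp add: field_simps)
    qed
    then show False using \<gamma>M M_mult M_inverse M_k by auto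
  qed
  ultimately show ?case
    using IH i unfolding e by (simp add: u_def lp_add lp_cst lp_T_aff)
qed

text \<open>The nonvanishing of the coefficient at \<open>\<mu>\<close> serves twice: it permits
  normalising \<open>f\<close>, and applied to the difference of two normalised eigenvectors it
  gives the uniqueness that \<open>THE\<close> requires.\<close>

lemma E_poly_eq:
  assumes \<mu>: "\<mu> \<in> vectors r" and f: "eigen f (Y_weight \<mu>)" "f \<noteq> 0" "f \<in> lp"
  shows "lookup f \<mu> \<noteq> 0" "E_poly r n k q G \<mu> = cst (inverse (lookup f \<mu>)) * f"
proof -
  have nz: "lookup h \<mu> \<noteq> 0" if "h \<noteq> 0" "h \<in> lp" "eigen h (Y_weight \<mu>)" for h
  proof (rule eigen_lookup_nonzero[OF that(1) _ that(3) \<mu>])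
    show "keys h \<subseteq> vectors r" using that(2) by (simp add: laurent_polys_def)
  qed (rule Y_weight_separates)
  show d: "lookup f \<mu> \<noteq> 0" by (rule nz) (fact f)+
  have eig: "(\<forall>i\<in>{1..r}. Y_op r n k q G i h = scale (gamma r n k q G (scale (int n) (eps i), 0) \<mu>) h) \<longleftrightarrow>
      eigen h (Y_weight \<mu>)" if "h \<in> lp" for h
    using that by (simp add: eigen_def Y_op_eq gamma_eps scale_laurent)
  show "E_poly r n k q G \<mu> = cst (inverse (lookup f \<mu>)) * f"
    unfolding E_poly_def
  proof (rule the_equality)
    let ?g = "cst (inverse (lookup f \<mu>)) * f"
    have "?g \<in> lp" "eigen ?g (Y_weight \<mu>)" using f by (auto intro: lp_cst eigen_cst)
    then show "?g \<in> lp \<and> lookup ?g \<mu> = 1 \<and>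
        (\<forall>i\<in>{1..r}. Y_op r n k q G i ?g = scale (gamma r n k q G (scale (int n) (eps i), 0) \<mu>) ?g)"
      using d eig by simp
    fix h assume h: "h \<in> lp \<and> lookup h \<mu> = 1 \<and>
        (\<forall>i\<in>{1..r}. Y_op r n k q G i h = scale (gamma r n k q G (scale (int n) (eps i), 0) \<mu>) h)"
    have "h + cst (- 1) * ?g \<in> lp" using h \<open>?g \<in> lp\<close> by (auto intro: lp_add lp_cst)
    moreover have "eigen (h + cst (- 1) * ?g) (Y_weight \<mu>)"
      using h eig[of h] eigen_cst[OF \<open>eigen ?g (Y_weight \<mu>)\<close>, of "- 1"]
      by (simp add: eigen_def Y_add distrib_left)
    moreover have "lookup (h + cst (- 1) * ?g) \<mu> = 0" using h d by (simp add: lookup_add)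
    ultimately have "h + cst (- 1) * ?g = 0" using nz by blast
    then show "h = ?g" by (simp add: single_uminus eq_neg_iff_add_eq_0)
  qed
qed

end

subsection \<open>Genericity of the parameters\<close>

lemma poly_val_single:
  assumes "c \<noteq> 0"
  shows "poly_val \<iota> xs (Poly_Mapping.single m c) = \<iota> c * (\<Prod>i\<in>keys m. (xs ! i) ^ lookup m i)"
  using assms by (simp add: poly_val_def)

lemma poly_val_diff_single:
  assumes "m \<noteq> m'" "c \<noteq> 0" "c' \<noteq> 0"
  shows "poly_val \<iota> xs (Poly_Mapping.single m c + Poly_Mapping.single m' c') =
    \<iota> c * (\<Prod>i\<in>keys m. (xs ! i) ^ lookup m i) + \<iota> c' * (\<Prod>i\<in>keys m'. (xs ! i) ^ lookup m' i)"
proof -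
  have "keys (Poly_Mapping.single m c + Poly_Mapping.single m' c') = {m, m'}"
    using assms by (auto simp: in_keys_iff lookup_add lookup_single when_def split: if_splits)
  then show ?thesis
    using assms by (simp add: poly_val_def lookup_add lookup_single when_def)
qed

text \<open>The group \<open>M\<close> consists of quotients of monomials free of \<open>q\<close>,
  up to sign; the sign absorbs \<open>G (n div 2)\<close>. A nontrivial power of \<open>q\<close> in
  \<open>M\<close> would be an algebraic relation between the indeterminates.\<close>

lemma generic_metaplectic_exists:
  fixes k q :: "'f::field"
  assumes "r \<ge> 2" "n \<ge> 1" "metaplectic_parameters n k q G"
  shows "\<exists>M. generic_metaplectic r n k q G M"
proof -
  define xs where "xs = k # q # map (\<lambda>j. G (int j)) [1..<Suc ((n - 1) div 2)]"
  define L where "L = length xs"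
  have rf: "rational_function_field xs" and G0: "G 0 = k"
    and Ginv: "\<And>j. \<not> int n dvd j \<Longrightarrow> G j * G (- j) = 1"
    and Gper: "\<And>i j. i mod int n = j mod int n \<Longrightarrow> G i = G j"
    and Ghalf: "even n \<Longrightarrow> G (int n div 2) \<in> {1, - 1}"
    using assms(3) unfolding metaplectic_parameters_def xs_def by blast+
  obtain \<iota> :: "complex \<Rightarrow> 'f" where \<iota>1: "\<iota> 1 = 1" and \<iota>add: "\<And>a b. \<iota> (a + b) = \<iota> a + \<iota> b"
    and indep: "\<And>P. (\<forall>m\<in>keys P. keys m \<subseteq> {..<length xs}) \<Longrightarrow> P \<noteq> 0 \<Longrightarrow> poly_val \<iota> xs P \<noteq> 0"
    using rf unfolding rational_function_field_def Let_def by blast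
  have \<iota>0: "\<iota> 0 = 0" using \<iota>add[of 0 0] by (metis add.right_neutral add_left_cancel)
  have \<iota>m1: "\<iota> (- 1) = - 1" using \<iota>add[of 1 "- 1"] \<iota>0 \<iota>1 by (simp add: eq_neg_iff_add_eq_0 add.commute)
  define mon where "mon e = (\<Prod>i\<in>keys e. (xs ! i) ^ lookup e i)" for e :: "nat \<Rightarrow>\<^sub>0 nat"
  have mon_superset: "mon e = (\<Prod>i<L. (xs ! i) ^ lookup e i)" if "keys e \<subseteq> {..<L}" for e
    unfolding mon_def using that by (intro prod.mono_neutral_left) (auto simp: in_keys_iff)
  have keys_plus: "keys (e + f) \<subseteq> A" if "keys e \<subseteq> A" "keys f \<subseteq> A" for e f :: "nat \<Rightarrow>\<^sub>0 nat" and A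
    using keys_add[of e f] that by blast
  have mon_add: "mon (e + f) = mon e * mon f" if "keys e \<subseteq> {..<L}" "keys f \<subseteq> {..<L}" for e f
    using that keys_plus[OF that] by (simp add: mon_superset lookup_add power_add prod.distrib)
  have mon_single: "mon (Poly_Mapping.single i a) = (xs ! i) ^ a" for i a
    by (cases "a = 0") (simp_all add: mon_def)
  have mon_nz: "mon e \<noteq> 0" if "keys e \<subseteq> {..<L}" for e
  proof -
    have "poly_val \<iota> xs (Poly_Mapping.single e 1) \<noteq> 0"
      using that by (intro indep) (auto simp: L_def, metis lookup_single_eq lookup_zero zero_neq_one)
    then show ?thesis by (simp add: poly_val_single mon_def \<iota>1)
  qed
  \<comment> \<open>Index 1 in \<open>xs\<close> is \<open>q\<close>, so these are the exponents of
    monomials without \<open>q\<close>.\<close>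
  define E where "E = {e :: nat \<Rightarrow>\<^sub>0 nat. keys e \<subseteq> {..<L} - {1}}"
  have EL: "keys e \<subseteq> {..<L}" if "e \<in> E" for e using that by (auto simp: E_def)
  have E_add: "e + f \<in> E" if "e \<in> E" "f \<in> E" for e f
    using that keys_plus unfolding E_def by blast
  define M where "M = {x. \<exists>s\<in>{1, - 1}. \<exists>e\<in>E. \<exists>f\<in>E. x * mon f = s * mon e}"
  have zeroE: "0 \<in> E" and mon0: "mon 0 = 1" by (simp_all add: E_def mon_def)
  have M_gen: "xs ! i \<in> M" if "i < L" "i \<noteq> 1" for i
  proof -
    have "Poly_Mapping.single i 1 \<in> E" using that by (simp add: E_def)
    moreover have "xs ! i * mon 0 = 1 * mon (Poly_Mapping.single i 1)"
      by (simp add: mon0 mon_single)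
    ultimately show ?thesis unfolding M_def using zeroE by blast
  qed
  have M_mult: "x * y \<in> M" if xy: "x \<in> M" "y \<in> M" for x y
  proof -
    obtain s e f where x: "s \<in> {1, - 1}" "e \<in> E" "f \<in> E" "x * mon f = s * mon e"
      using xy unfolding M_def by blast
    obtain s' e' f' where y: "s' \<in> {1, - 1}" "e' \<in> E" "f' \<in> E" "y * mon f' = s' * mon e'"
      using xy unfolding M_def by blast
    have "x * y * mon (f + f') = (x * mon f) * (y * mon f')"
      unfolding mon_add[OF EL[OF x(3)] EL[OF y(3)]] by (simp only: mult_ac)
    also have "\<dots> = (s * s') * mon (e + e')"
      unfolding x(4) y(4) mon_add[OF EL[OF x(2)] EL[OF y(2)]] by (simp only: mult_ac)
    finally show ?thesis
      unfolding M_def using x y E_add by (auto intro!: bexI[of _ "s * s'"])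
  qed
  have M_nz: "0 \<notin> M" unfolding M_def using mon_nz EL by auto
  have M_inv: "inverse x \<in> M" if xM: "x \<in> M" for x
  proof -
    obtain s e f where x: "s \<in> {1, - 1}" "e \<in> E" "f \<in> E" "x * mon f = s * mon e"
      using xM unfolding M_def by blast
    have "x \<noteq> 0" using xM M_nz by blast
    moreover have "s * s = 1" using x by auto
    ultimately have "inverse x * mon e = s * mon f"
      using x(4) by (metis (no_types, opaque_lifting) left_inverse mult.assoc mult.commute mult_1)
    then show ?thesis unfolding M_def using x by blast
  qed
  have one: "1 \<in> M" "- 1 \<in> M"
    unfolding M_def using zeroE mon0 by force+
  have k: "k \<in> M" using M_gen[of 0] by (simp add: xs_def L_def)
  have half: "G (int j) \<in> M" if "1 \<le> j" "j \<le> (n - 1) div 2" for j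
  proof -
    have "[1..<Suc ((n - 1) div 2)] ! (j - 1) = j"
      using that nth_upt[of 1 "j - 1" "Suc ((n - 1) div 2)"] by simp
    then have "xs ! (j + 1) = G (int j)" "j + 1 < L"
      using that by (simp_all add: xs_def L_def nth_Cons' del: upt_Suc)
    then show ?thesis using M_gen[of "j + 1"] that by simp
  qed
  \<comment> \<open>By periodicity \<open>j\<close> becomes a residue: 0 gives \<open>k\<close>, one
    below \<open>n/2\<close> an indeterminate, \<open>n/2\<close> a sign, and one above
    \<open>n/2\<close> the inverse of an indeterminate.\<close>
  have M_G: "G j \<in> M" for j
  proof -
    define m where "m = nat (j mod int n)"
    have m: "int m = j mod int n" "m < n"
      using assms(2) by (simp_all add: m_def nat_less_iff)
    have "G j = G (int m)" using m by (intro Gper) simp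
    moreover have "G (int m) \<in> M"
    proof -
      consider "m = 0" | "1 \<le> m" "2 * m < n" | "2 * m = n" | "2 * m > n" by linarith
      then show ?thesis
      proof cases
        case 1
        then show ?thesis using k G0 by simp
      next
        case 2
        then show ?thesis by (intro half) auto
      next
        case 3
        then have "G (int m) \<in> {1, - 1}" using Ghalf by (auto simp: zdiv_int[symmetric])
        then show ?thesis using one by auto
      next
        case 4
        have "\<not> n dvd m" using m(2) 4 by (intro nat_dvd_not_less) auto
        then have "\<not> int n dvd int m" by (simp only: int_dvd_int_iff not_False_eq_True)
        then have "G (int m) * G (- int m) = 1" by (rule Ginv)
        moreover have "G (- int m) = G (int (n - m))"
          using m by (intro Gper) (simp add: of_nat_diff)
        moreover have "G (int (n - m)) \<in> M" using 4 m by (intro half) auto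
        ultimately have "inverse (G (int (n - m))) = G (int m)"
          by (metis inverse_unique mult.commute)
        then show ?thesis using M_inv[OF \<open>G (int (n - m)) \<in> M\<close>] by simp
      qed
    qed
    ultimately show ?thesis by simp
  qed
  have qn: "q = xs ! 1" "1 < L" by (simp_all add: xs_def L_def)
  have key: False if h: "a > 0" "e \<in> E" "f \<in> E" "s \<in> {1, - 1}" "q ^ a * mon f = s * mon e" for a e f s
  proof -
    let ?m = "Poly_Mapping.single 1 a + f"
    \<comment> \<open>The sign has to be lifted to a complex coefficient in order to name the
      nonzero polynomial whose value would be \<open>q ^ a * mon f - s * mon e\<close>.\<close>
    obtain c where c: "\<iota> c = - s" "c \<noteq> 0" using h(4) \<iota>1 \<iota>m1 by (metis (full_types) add.inverse_inverse empty_iff insert_iff neg_equal_0_iff_equal zero_neq_one)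
    have k1: "keys ?m \<subseteq> {..<L}" using EL[OF h(3)] qn by (intro keys_plus) auto
    have "lookup ?m 1 = a" "lookup e 1 = 0"
      using h by (auto simp: lookup_add E_def in_keys_iff subset_iff)
    then have ne: "?m \<noteq> e" using h(1) by auto
    let ?P = "Poly_Mapping.single ?m 1 + Poly_Mapping.single e c"
    have "lookup ?P ?m = 1" using ne by (simp add: lookup_add lookup_single when_def)
    then have "?P \<noteq> 0" by (metis lookup_zero zero_neq_one)
    moreover have "\<forall>m\<in>keys ?P. keys m \<subseteq> {..<length xs}"
    proof
      fix m assume "m \<in> keys ?P"
      then have "m = ?m \<or> m = e"
        by (auto simp: in_keys_iff lookup_add lookup_single when_def split: if_splits)
      then show "keys m \<subseteq> {..<length xs}" using k1 EL[OF h(2)] by (auto simp: L_def)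
    qed
    ultimately have "poly_val \<iota> xs ?P \<noteq> 0" by (intro indep)
    moreover have "poly_val \<iota> xs ?P = mon ?m + - s * mon e"
      using poly_val_diff_single[OF ne _ c(2), of 1 \<iota> xs] c \<iota>1 by (simp add: mon_def)
    moreover have "mon ?m = q ^ a * mon f"
      using EL[OF h(3)] qn by (subst mon_add) (auto simp: mon_single)
    ultimately show False using h(5) by simp
  qed
  have q_nz: "q \<noteq> 0"
    using mon_nz[of "Poly_Mapping.single 1 1"] qn by (simp add: mon_single)
  have q_gen: "m = 0" if h: "q powi m \<in> M" for m
  proof (rule ccontr)
    assume "m \<noteq> 0"
    obtain s e f where x: "s \<in> {1, - 1}" "e \<in> E" "f \<in> E" "q powi m * mon f = s * mon e"
      using h unfolding M_def by blast
    consider "m > 0" | "m < 0" using \<open>m \<noteq> 0\<close> by linarith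
    then show False
    proof cases
      case 1
      then have "q powi m = q ^ nat m" by (simp add: power_int_def)
      then show False using key[of "nat m" e f s] x 1 by auto
    next
      case 2
      have "q powi m = inverse (q ^ nat (- m))" using 2 by (simp add: power_int_def power_inverse)
      then have "mon f = q ^ nat (- m) * (q powi m * mon f)"
        using q_nz by simp
      then have "mon f = q ^ nat (- m) * (s * mon e)"
        by (simp only: x(4))
      then have "q ^ nat (- m) * mon e = s * mon f"
        using x(1) by auto
      then show False using key[of "nat (- m)" f e s] x 2 by auto
    qed
  qed
  have k_nz: "k \<noteq> 0" using k M_nz by blast
  have "generic_metaplectic r n k q G M"
    by unfold_locales (fact assms k_nz G0 q_nz | erule Ginv | erule Gper | erule (1) M_mult |
        erule M_inv | rule M_nz M_G | erule q_gen)+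
  then show ?thesis by blast
qed

section \<open>Permutations and affine maps acting on vectors\<close>

lemma perm_act_diff:
  fixes u v :: "_ \<Rightarrow>\<^sub>0 int"
  assumes "bij w"
  shows "perm_act w (u - v) = perm_act w u - perm_act w v"
  using assms by (intro poly_mapping_eqI) (simp add: lookup_perm_act lookup_minus)

lemma vectors_add: "u \<in> vectors r \<Longrightarrow> v \<in> vectors r \<Longrightarrow> u + v \<in> vectors r"
  using keys_add[of u v] by (auto simp: vectors_def)

lemma perm_act_vectors:
  assumes "w permutes {1..r}" "v \<in> vectors r"
  shows "perm_act w v \<in> vectors r"
proof -
  have "j \<in> {1..r}" if "lookup v (inv w j) \<noteq> 0" for j
  proof -
    have "inv w j \<in> {1..r}" using that assms(2) by (auto simp: vectors_def in_keys_iff)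
    then show ?thesis using permutes_in_image[OF permutes_inv[OF assms(1)]] by blast
  qed
  then show ?thesis
    using permutes_bij[OF assms(1)] by (auto simp: vectors_def in_keys_iff lookup_perm_act)
qed

text \<open>The map \<open>(a, b)\<close> to \<open>(u^-1 b, u^-1 a)\<close> matches the inversions.
  It transfers length arguments about last letters to first letters.\<close>

lemma inv_num_inv:
  assumes "u permutes {1..r}"
  shows "inv_num r (inv u) = inv_num r u"
proof -
  have "bij_betw (\<lambda>(a, b). (inv u b, inv u a)) (inversions r (inv u)) (inversions r u)"
  proof (rule bij_betw_byWitness[where f' = "\<lambda>(a, b). (u b, u a)"])
    have i: "u (inv u a) = a" "inv u (u a) = a" for a
      using permutes_inverses[OF assms] by auto
    have in_u: "1 \<le> u a \<and> u a \<le> r \<longleftrightarrow> 1 \<le> a \<and> a \<le> r" "1 \<le> inv u a \<and> inv u a \<le> r \<longleftrightarrow> 1 \<le> a \<and> a \<le> r" for a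
      using permutes_in_image[OF assms, of a] permutes_in_image[OF permutes_inv[OF assms], of a] by auto
    show "\<forall>a\<in>inversions r (inv u). (case case a of (a, b) \<Rightarrow> (inv u b, inv u a) of (a, b) \<Rightarrow> (u b, u a)) = a"
      "\<forall>a'\<in>inversions r u. (case case a' of (a, b) \<Rightarrow> (u b, u a) of (a, b) \<Rightarrow> (inv u b, inv u a)) = a'"
      by (auto simp: i)
    show "(\<lambda>(a, b). (inv u b, inv u a)) ` inversions r (inv u) \<subseteq> inversions r u"
    proof clarify
      fix a b assume "(a, b) \<in> inversions r (inv u)"
      then show "(inv u b, inv u a) \<in> inversions r u"
        using in_u(2)[of a] in_u(2)[of b] by (auto simp: inversions_def i)
    qed
    show "(\<lambda>(a, b). (u b, u a)) ` inversions r u \<subseteq> inversions r (inv u)"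
    proof clarify
      fix a b assume "(a, b) \<in> inversions r u"
      then show "(u b, u a) \<in> inversions r (inv u)"
        using in_u(1)[of a] in_u(1)[of b] by (auto simp: inversions_def i)
    qed
  qed
  then show ?thesis by (simp add: inv_num_def bij_betw_same_card)
qed

lemma fold_perm_act:
  "fold (\<lambda>i. perm_act (simple_refl i)) us v = perm_act (inv (sym_word us)) (v :: _ \<Rightarrow>\<^sub>0 'a::zero)"
  if "set us \<subseteq> {1..<r}" for us r
  using that
proof (induction us arbitrary: v)
  case Nil
  then show ?case using perm_act_id[of v] by (simp add: id_def)
next
  case (Cons i us)
  have b: "bij (sym_word us)" using Cons.prems sym_word_permutes[of us r] by (auto intro: permutes_bij)
  have "inv (sym_word (i # us)) = inv (sym_word us) \<circ> simple_refl i"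
    using b by (simp add: sym_word_Cons o_inv_distrib del: o_apply)
  moreover have "fold (\<lambda>i. perm_act (simple_refl i)) (i # us) v =
      perm_act (inv (sym_word us)) (perm_act (simple_refl i) v)"
    using Cons by simp
  ultimately show ?case
    by (simp only: perm_act_comp[OF bij_imp_bij_inv[OF b] bij_simple_refl])
qed

lemma lookup_map_of_int: "lookup (Poly_Mapping.map of_int v :: _ \<Rightarrow>\<^sub>0 'a::ring_1) j = of_int (lookup v j)"
  by (simp add: map.rep_eq when_def)

lemma aff_act_mult:
  fixes v :: "nat \<Rightarrow>\<^sub>0 'a::ring_1"
  assumes "bij (snd g)" "bij (snd h)"
  shows "aff_act (aff_mult g h) v = aff_act g (aff_act h v)"
  using assms
  by (intro poly_mapping_eqI)
    (simp add: aff_mult_def lookup_aff_act bij_comp o_inv_distrib lookup_add lookup_perm_act)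

lemma bij_aff_gen: "bij (snd (aff_gen r n i))"
  by (simp add: aff_gen_def)

subsection \<open>The sides of the walls of an alcove\<close>

lemma fund_alcove_diff:
  assumes "v \<in> fund_alcove r" "1 \<le> a" "a < b" "b \<le> r"
  shows "0 < lookup v a - lookup v b" "lookup v a - lookup v b < 1"
proof -
  have step: "lookup v (Suc i) < lookup v i" if "1 \<le> i" "i < r" for i
    using assms(1) that by (auto simp: fund_alcove_def Suc_eq_plus1)
  have mono: "lookup v d \<le> lookup v c" if "c \<le> d" "1 \<le> c" "d \<le> r" for c d
    using that
  proof (induction d rule: dec_induct)
    case (step d)
    then show ?case using \<open>\<And>i. 1 \<le> i \<Longrightarrow> i < r \<Longrightarrow> lookup v (Suc i) < lookup v i\<close>[of d] by simp
  qed simp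
  show "0 < lookup v a - lookup v b" using mono[of "Suc a" b] step[of a] assms by simp
  have "lookup v 1 - lookup v r < 1" using assms(1) by (simp add: fund_alcove_def)
  then show "lookup v a - lookup v b < 1" using mono[of 1 a] mono[of b r] assms by simp
qed

lemma fund_alcove_nonempty: "\<exists>v. v \<in> fund_alcove r"
proof
  \<comment> \<open>Equally spaced decreasing entries with total spread
    \<open>(r - 1) / (r + 1) < 1\<close>.\<close>
  let ?v = "\<Sum>i=1..r. Poly_Mapping.single i ((real r - real i) / (real r + 1))"
  have l: "lookup ?v j = (if j \<in> {1..r} then (real r - real j) / (real r + 1) else 0)" for j
  proof -
    have "lookup ?v j = (\<Sum>i=1..r. if i = j then (real r - real i) / (real r + 1) else 0)"
      unfolding lookup_sum by (rule sum.cong) (auto simp: lookup_single when_def)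
    then show ?thesis by simp
  qed
  have "?v \<in> vectors r" by (auto simp: vectors_def in_keys_iff l split: if_splits)
  moreover have "lookup ?v (i + 1) < lookup ?v i" if "i \<in> {1..<r}" for i
    using that by (simp add: l divide_strict_right_mono)
  moreover have "lookup ?v 1 - lookup ?v r < 1"
    by (simp add: l divide_less_eq)
  ultimately show "?v \<in> fund_alcove r" by (simp add: fund_alcove_def)
qed

lemma lookup_aff_gen_real:
  fixes v :: "nat \<Rightarrow>\<^sub>0 real"
  shows "lookup (aff_act (aff_gen r 1 i) v) j =
    (if i = 0 then lookup v (transpose 1 r j) + ((if j = 1 then 1 else 0) - (if j = r then 1 else 0))
     else lookup v (simple_refl i j))"
  by (auto simp: aff_gen_def lookup_aff_act highest_root_def lookup_minus lookup_eps)

lemma ip_eps_diff_real: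
  assumes "a \<in> {1..r}" "b \<in> {1..r}"
  shows "ip r (eps a - eps b) (v :: nat \<Rightarrow>\<^sub>0 real) = lookup v a - lookup v b"
proof -
  have "ip r (eps a - eps b) v =
      (\<Sum>j=1..r. (if j = a then lookup v j else 0) - (if j = b then lookup v j else 0))"
    unfolding ip_def by (rule sum.cong) (auto simp: lookup_minus lookup_eps)
  then show ?thesis using assms by (simp add: sum_subtractf)
qed

lemma aff_act_vectors_real:
  assumes "snd g permutes {1..r}" "fst g \<in> vectors r" "v \<in> vectors r"
  shows "aff_act g v \<in> (vectors r :: (nat \<Rightarrow>\<^sub>0 real) set)"
proof -
  have "Poly_Mapping.map of_int (fst g) \<in> (vectors r :: (nat \<Rightarrow>\<^sub>0 real) set)"
    using assms(2) by (auto simp: vectors_def in_keys_iff lookup_map_of_int subset_iff)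
  then show ?thesis
    unfolding aff_act_def by (intro vectors_add perm_act_vectors assms)
qed

lemma aff_gen_props:
  assumes "r \<ge> 2" "i < r"
  shows "snd (aff_gen r n i) permutes {1..r}" "fst (aff_gen r n i) \<in> vectors r"
  using assms simple_refl_permutes[of i r] permutes_swap_id[of 1 "{1..r}" r]
  by (auto simp: aff_gen_def vectors_def highest_root_def lookup_minus lookup_eps in_keys_iff
      split: if_splits)

lemma aff_mult_props:
  assumes "snd g permutes {1..r}" "fst g \<in> vectors r" "snd h permutes {1..r}" "fst h \<in> vectors r"
  shows "snd (aff_mult g h) permutes {1..r}" "fst (aff_mult g h) \<in> vectors r"
  using assms unfolding aff_mult_def fst_conv snd_conv
  by (blast intro: permutes_compose, blast intro: vectors_add perm_act_vectors)

lemma aff_mult_gen_neq: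
  assumes "r \<ge> 2" "i < r" "snd A permutes {1..r}"
  shows "aff_mult A (aff_gen r n i) \<noteq> A"
proof
  assume eq: "aff_mult A (aff_gen r n i) = A"
  let ?t = "snd (aff_gen r n i)" and ?p = "if i = 0 then 1 else i"
  have "snd A \<circ> ?t = snd A" using arg_cong[OF eq, of snd] by (simp add: aff_mult_def)
  then have "snd A (?t ?p) = snd A ?p" by (metis comp_apply)
  then have "?t ?p = ?p" by (rule injD[OF permutes_inj[OF assms(3)]])
  then show False using assms by (auto simp: aff_gen_def simple_refl_apply split: if_splits)
qed

text \<open>\<open>A\<close> carries a wall of the fundamental alcove to the wall between
  \<open>A\<close> and \<open>B\<close>, whose normal is \<open>eps (w c) - eps (w d)\<close> with
  \<open>w = snd A\<close>. This is a positive root pointing towards \<open>A\<close> exactly when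
  \<open>w c < w d\<close>. For the converse, a hyperplane separating the two alcoves is pulled back
  along \<open>A\<close>.\<close>

lemma separating_wall_iff:
  assumes r: "r \<ge> 2" and i: "i < r" and A: "snd A permutes {1..r}" "fst A \<in> vectors r"
  defines "B \<equiv> aff_mult A (aff_gen r 1 i)"
  shows "(\<exists>\<alpha>\<in>pos_roots r. \<exists>s. separates r \<alpha> s (alcove r A) (alcove r B) \<and>
      alcove r A \<subseteq> pos_side r \<alpha> s) \<longleftrightarrow>
    (if i = 0 then snd A r < snd A 1 else snd A i < snd A (i + 1))"
proof -
  let ?w = "snd A" and ?g = "aff_gen r 1 i"
  have bA: "bij ?w" by (rule permutes_bij[OF A(1)])
  have inj: "?w a = ?w b \<longleftrightarrow> a = b" for a b using bij_is_inj[OF bA] by (auto dest: injD)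
  have B: "aff_act B v = aff_act A (aff_act ?g v)" for v :: "nat \<Rightarrow>\<^sub>0 real"
    unfolding B_def by (rule aff_act_mult[OF bA bij_aff_gen])
  have lA: "lookup (aff_act A v) (?w a) = lookup v a + of_int (lookup (fst A) (?w a))"
    for v :: "nat \<Rightarrow>\<^sub>0 real" and a
    using bA by (simp add: lookup_aff_act bij_is_inj)
  have gv: "aff_act ?g v \<in> vectors r" if "v \<in> vectors r" for v :: "nat \<Rightarrow>\<^sub>0 real"
    using that aff_gen_props[OF r i] by (intro aff_act_vectors_real)
  show ?thesis (is "?L \<longleftrightarrow> ?R")
  proof
    assume R: ?R
    \<comment> \<open>The wall of the fundamental alcove is \<open>v_c - v_d = 0\<close> for
      \<open>i > 0\<close> and \<open>v_r - v_1 + 1 = 0\<close> for \<open>i = 0\<close>.\<close>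
    define c d where "c = (if i = 0 then r else i)" and "d = (if i = 0 then 1 else i + 1)"
    have cd: "c \<in> {1..r}" "d \<in> {1..r}" "?w c < ?w d" using R r i by (auto simp: c_def d_def)
    then have wcd: "?w c \<in> {1..r}" "?w d \<in> {1..r}" using permutes_in_image[OF A(1)] by auto
    define s where "s = (if i = 0 then 1 else 0) - lookup (fst A) (?w c) + lookup (fst A) (?w d)"
    let ?\<alpha> = "eps (?w c) - eps (?w d) :: nat \<Rightarrow>\<^sub>0 real"
    have \<alpha>: "?\<alpha> \<in> pos_roots r" using wcd cd(3) unfolding pos_roots_def by blast
    have val: "ip r ?\<alpha> (aff_act A v) + of_int s = lookup v c - lookup v d + (if i = 0 then 1 else 0)"
      for v :: "nat \<Rightarrow>\<^sub>0 real"
      by (simp add: ip_eps_diff_real[OF wcd] lA s_def)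
    have f: "0 < lookup v c - lookup v d + (if i = 0 then 1 else 0)"
      "lookup (aff_act ?g v) c - lookup (aff_act ?g v) d + (if i = 0 then 1 else 0) < 0"
      if "v \<in> fund_alcove r" for v
      using fund_alcove_diff[OF that, of 1 r] fund_alcove_diff[OF that, of i "i + 1"] r i
      by (auto simp: c_def d_def lookup_aff_gen_real simple_refl_apply)
    have vec: "v \<in> vectors r" if "v \<in> fund_alcove r" for v using that by (simp add: fund_alcove_def)
    have "alcove r A \<subseteq> pos_side r ?\<alpha> s"
      using f(1) vec aff_act_vectors_real[OF A] by (auto simp: alcove_def pos_side_def val)
    moreover have "alcove r B \<subseteq> neg_side r ?\<alpha> s"
      using f(2) vec gv aff_act_vectors_real[OF A] by (auto simp: alcove_def neg_side_def B val)
    ultimately show ?L using \<alpha> unfolding separates_def by blast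
  next
    assume ?L
    then obtain \<alpha> :: "nat \<Rightarrow>\<^sub>0 real" and s where \<alpha>: "\<alpha> \<in> pos_roots r" and sep: "separates r \<alpha> s (alcove r A) (alcove r B)"
      and pos: "alcove r A \<subseteq> pos_side r \<alpha> s" by blast
    obtain v where v: "v \<in> fund_alcove r" using fund_alcove_nonempty by blast
    have "aff_act A v \<in> alcove r A" using v by (simp add: alcove_def)
    then have p: "ip r \<alpha> (aff_act A v) + of_int s > 0" using pos by (auto simp: pos_side_def)
    then have "\<not> alcove r A \<subseteq> neg_side r \<alpha> s"
      using \<open>aff_act A v \<in> alcove r A\<close> by (force simp: neg_side_def)
    then have "alcove r B \<subseteq> neg_side r \<alpha> s" using sep by (auto simp: separates_def)
    moreover have "aff_act B v \<in> alcove r B" using v by (simp add: alcove_def)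
    ultimately have m: "ip r \<alpha> (aff_act A (aff_act ?g v)) + of_int s < 0"
      unfolding B by (auto simp: neg_side_def)
    obtain a' b' where ab': "\<alpha> = eps a' - eps b'" "a' \<in> {1..r}" "b' \<in> {1..r}" "a' < b'"
      using \<alpha> unfolding pos_roots_def by blast
    define a b where "a = inv ?w a'" and "b = inv ?w b'"
    have wab: "?w a = a'" "?w b = b'" using bA by (simp_all add: a_def b_def bij_inv_eq_iff[symmetric] surj_f_inv_f bij_is_surj)
    have ab: "a \<in> {1..r}" "b \<in> {1..r}" "a \<noteq> b"
      using ab' wab permutes_in_image[OF A(1), of a] permutes_in_image[OF A(1), of b] by (simp_all, metis less_irrefl)
    \<comment> \<open>Pulled back along \<open>A\<close>, the hyperplane becomes
      \<open>v_a - v_b + t = 0\<close>, to be compared with the fundamental alcove and its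
      reflection.\<close>
    define t where "t = s + lookup (fst A) a' - lookup (fst A) b'"
    have val: "ip r \<alpha> (aff_act A x) + of_int s = lookup x a - lookup x b + of_int t" for x :: "nat \<Rightarrow>\<^sub>0 real"
      using lA[of x a] lA[of x b] ip_eps_diff_real[OF ab'(2,3)] unfolding ab'(1) wab t_def by simp
    let ?x = "lookup v" and ?y = "lookup (aff_act ?g v)"
    have p': "?x a - ?x b + of_int t > 0" and m': "?y a - ?y b + of_int t < 0"
      using p m by (simp_all only: val)
    note d = fund_alcove_diff[OF v]
    have lt_wab: "?w a < ?w b" using wab ab' by simp
    show ?R
    proof (cases "a < b")
      case True
      \<comment> \<open>Here \<open>v_a - v_b\<close> lies in \<open>(0, 1)\<close>, so positivity
        bounds the integer \<open>t\<close>. A sign change of this difference then leaves only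
        \<open>s_i\<close> with \<open>a = i\<close> and \<open>b = i + 1\<close>.\<close>
      have "t \<ge> 0" using p' d(2)[of a b] ab True by simp
      then have neg: "?y a - ?y b < 0" using m' by linarith
      show ?thesis
      proof (cases "i = 0")
        case i0: True
        have "?y a - ?y b > 0"
          using i0 True ab r d[of 1 r] d[of 1 a] d[of 1 b] d[of a r] d[of b r] d[of a b]
          by (auto simp: lookup_aff_gen_real transpose_def)
        then show ?thesis using neg by simp
      next
        case False
        have "a = i \<and> b = i + 1"
        proof (rule ccontr)
          assume "\<not> (a = i \<and> b = i + 1)"
          then have "simple_refl i a < simple_refl i b" using True by (auto simp: simple_refl_apply)
          moreover have "simple_refl i a \<in> {1..r}" "simple_refl i b \<in> {1..r}"
            using ab False i by (auto simp: simple_refl_apply)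
          ultimately have "?y a - ?y b > 0" using d(1) False by (simp add: lookup_aff_gen_real)
          then show False using neg by simp
        qed
        then show ?thesis using lt_wab False by simp
      qed
    next
      case False
      then have ba: "b < a" using ab by simp
      \<comment> \<open>Now \<open>v_a - v_b\<close> is negative, so \<open>t >= 1\<close> and the
        reflected point has \<open>y_b - y_a > 1\<close>. Only the letter 0 with
        \<open>b = 1\<close> and \<open>a = r\<close> can do this.\<close>
      have "t > 0"
      proof -
        have "of_int t > (0 :: real)" using p' d(1)[of b a] ab ba by auto
        then show ?thesis by simp
      qed
      then have neg: "?y b - ?y a > 1" using m' by linarith
      show ?thesis
      proof (cases "i = 0")
        case i0: True
        have "b = 1 \<and> a = r"
        proof (rule ccontr)
          assume "\<not> (b = 1 \<and> a = r)"
          then have "?y b - ?y a < 1"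
            using i0 ba ab r d[of 1 r] d[of 1 a] d[of 1 b] d[of a r] d[of b r] d[of b a]
            by (auto simp: lookup_aff_gen_real transpose_def)
          then show False using neg by simp
        qed
        then show ?thesis using lt_wab i0 by simp
      next
        case False
        have "?y b - ?y a < 1"
        proof (cases "simple_refl i b < simple_refl i a")
          case True
          moreover have "simple_refl i a \<in> {1..r}" "simple_refl i b \<in> {1..r}"
            using ab False i by (auto simp: simple_refl_apply)
          ultimately show ?thesis using d(2) False by (simp add: lookup_aff_gen_real)
        next
          case ge: False
          then have "b = i" "a = i + 1" using ba by (auto simp: simple_refl_apply split: if_splits)
          then show ?thesis using d(1)[of i "i + 1"] False ab by (simp add: lookup_aff_gen_real simple_refl_apply)
        qed
        then show ?thesis using neg by simp
      qed
    qed
  qed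
qed

subsection \<open>Alcove walks\<close>

lemma walks_Nil: "walks r A [] = {[A]}"
  by (auto simp: walks_def length_Suc_conv)

text \<open>A walk records its starting alcove, so the tail is itself a walk for the remaining
  letters, starting at \<open>A\<close> after a fold and at the neighbour after a crossing.\<close>

lemma walks_Cons:
  "walks r A (i # ws) = (#) A ` (walks r A ws \<union> walks r (aff_mult A (aff_gen r 1 i)) ws)"
proof (intro set_eqI iffI)
  fix p assume p: "p \<in> walks r A (i # ws)"
  then obtain p' where p': "p = A # p'" "length p' = Suc (length ws)"
    by (cases p) (auto simp: walks_def)
  have step: "p ! j \<in> {p ! (j - 1), aff_mult (p ! (j - 1)) (aff_gen r 1 ((i # ws) ! (j - 1)))}"
    if "j \<in> {1..Suc (length ws)}" for j
    using p that by (simp add: walks_def)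
  have "p' ! 0 \<in> {A, aff_mult A (aff_gen r 1 i)}" using step[of 1] p' by (simp add: One_nat_def)
  moreover have "p' ! j \<in> {p' ! (j - 1), aff_mult (p' ! (j - 1)) (aff_gen r 1 (ws ! (j - 1)))}"
    if "j \<in> {1..length ws}" for j
    using step[of "Suc j"] that p' by (cases j) auto
  ultimately have "p' \<in> walks r A ws \<union> walks r (aff_mult A (aff_gen r 1 i)) ws"
    using p' by (auto simp: walks_def)
  then show "p \<in> (#) A ` (walks r A ws \<union> walks r (aff_mult A (aff_gen r 1 i)) ws)"
    using p' by blast
next
  fix p assume "p \<in> (#) A ` (walks r A ws \<union> walks r (aff_mult A (aff_gen r 1 i)) ws)"
  then obtain p' where p': "p = A # p'" "length p' = Suc (length ws)"
    "p' ! 0 \<in> {A, aff_mult A (aff_gen r 1 i)}"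
    "\<And>j. j \<in> {1..length ws} \<Longrightarrow> p' ! j \<in> {p' ! (j - 1), aff_mult (p' ! (j - 1)) (aff_gen r 1 (ws ! (j - 1)))}"
    by (auto simp: walks_def)
  have "p ! j \<in> {p ! (j - 1), aff_mult (p ! (j - 1)) (aff_gen r 1 ((i # ws) ! (j - 1)))}"
    if "j \<in> {1..Suc (length ws)}" for j
  proof (cases "j = 1")
    case True
    then show ?thesis using p' by (simp add: One_nat_def)
  next
    case False
    then have "j = Suc (Suc (j - 2))" using that by auto
    then obtain l where "j = Suc (Suc l)" by blast
    then show ?thesis using p'(4)[of "Suc l"] that p'(1) by (simp add: One_nat_def)
  qed
  then show "p \<in> walks r A (i # ws)" using p' by (auto simp: walks_def)
qed

lemma finite_walks: "finite (walks r A ws)"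
  by (induction ws arbitrary: A) (simp_all add: walks_Nil walks_Cons)

lemma walks_hd: "p \<in> walks r A ws \<Longrightarrow> p \<noteq> [] \<and> p ! 0 = A"
  by (auto simp: walks_def)

lemma walks_last:
  assumes "r \<ge> 2" "set ws \<subseteq> {0..<r}" "snd A permutes {1..r}" "p \<in> walks r A ws"
  shows "snd (last p) permutes {1..r}"
  using assms(2-4)
proof (induction ws arbitrary: A p)
  case (Cons i ws)
  then obtain p' C where p: "p = A # p'" "p' \<in> walks r C ws" "C \<in> {A, aff_mult A (aff_gen r 1 i)}"
    unfolding walks_Cons by blast
  have "snd C permutes {1..r}"
    using p(3) Cons.prems aff_gen_props[OF assms(1), of i 1] by (auto simp: aff_mult_def intro: permutes_compose)
  then have "snd (last p') permutes {1..r}" using Cons.IH[of C p'] Cons.prems p by simp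
  then show ?case using p walks_hd[OF p(2)] by simp
qed (simp add: walks_Nil)

lemma folds_Cons:
  "folds (i # ws) (A # p) = (if p ! 0 = A then {1} else {}) \<union> Suc ` folds ws p"
proof (intro set_eqI)
  fix j
  show "j \<in> folds (i # ws) (A # p) \<longleftrightarrow> j \<in> (if p ! 0 = A then {1} else {}) \<union> Suc ` folds ws p"
  proof (cases j)
    case (Suc l)
    then show ?thesis by (cases l) (auto simp: folds_def One_nat_def)
  qed (auto simp: folds_def One_nat_def)
qed

lemma pos_folds_Cons:
  assumes "r \<ge> 2" "i < r" "snd A permutes {1..r}" "fst A \<in> vectors r"
  shows "pos_folds r (i # ws) (A # p) =
    (if p ! 0 = A \<and> (if i = 0 then snd A r < snd A 1 else snd A i < snd A (i + 1)) then {1} else {}) \<union>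
      Suc ` pos_folds r ws p"
proof (intro set_eqI)
  fix j
  show "j \<in> pos_folds r (i # ws) (A # p) \<longleftrightarrow>
    j \<in> (if p ! 0 = A \<and> (if i = 0 then snd A r < snd A 1 else snd A i < snd A (i + 1)) then {1} else {}) \<union>
      Suc ` pos_folds r ws p"
  proof (cases "j = 1")
    case True
    have "1 \<notin> Suc ` pos_folds r ws p" by (auto simp: pos_folds_def folds_def One_nat_def)
    then show ?thesis
      using True separating_wall_iff[OF assms] unfolding pos_folds_def folds_Cons
      by (auto simp: folds_def)
  next
    case False
    show ?thesis
    proof (cases "j = 0")
      case True
      then show ?thesis by (auto simp: pos_folds_def folds_def)
    next
      case False
      with \<open>j \<noteq> 1\<close> have "j = Suc (Suc (j - 2))" by auto
      then obtain l where l: "j = Suc (Suc l)" by blast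
      have "j \<in> pos_folds r (i # ws) (A # p) \<longleftrightarrow> Suc l \<in> pos_folds r ws p"
        using l by (auto simp: pos_folds_def folds_Cons One_nat_def)
      then show ?thesis using l by (auto simp: One_nat_def)
    qed
  qed
qed

lemma neg_folds_Cons:
  assumes "r \<ge> 2" "i < r" "snd A permutes {1..r}" "fst A \<in> vectors r"
  shows "neg_folds r (i # ws) (A # p) =
    (if p ! 0 = A \<and> \<not> (if i = 0 then snd A r < snd A 1 else snd A i < snd A (i + 1)) then {1} else {}) \<union>
      Suc ` neg_folds r ws p"
proof -
  have "1 \<notin> Suc ` folds ws p" "1 \<notin> Suc ` pos_folds r ws p"
    by (auto simp: pos_folds_def folds_def One_nat_def)
  then show ?thesis
    unfolding neg_folds_def folds_Cons pos_folds_Cons[OF assms] by auto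
qed

text \<open>\<open>beta\<close> depends only on the letters from step \<open>j\<close> onwards, so
  removing the first letter merely renumbers.\<close>

lemma beta_Cons: "1 \<le> j \<Longrightarrow> beta r n (i # ws) (Suc j) = beta r n ws j"
  by (cases j) (simp_all add: beta_def)

section \<open>Coefficients of directions and of folds\<close>

context metaplectic
begin

abbreviation dir_coeff :: "(nat \<Rightarrow>\<^sub>0 int) \<Rightarrow> nat list \<Rightarrow> 'f" where
  "dir_coeff l us \<equiv> (\<Prod>a<length us. sig
    (ip r l (fold (\<lambda>i. perm_act (simple_refl i)) (drop (Suc a) us) (simple_root (us ! a)))))"

text \<open>In a reduced word each further \<open>T_i\<close> meets entries of \<open>l\<close> in
  their original order, so their difference lies in \<open>[0, n]\<close> and \<open>T_small\<close>
  gives a single term.\<close>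

lemma foldr_T_alcove:
  assumes l: "l \<in> alcove_weights r n"
    and us: "set us \<subseteq> {1..<r}" "length us = inv_num r (sym_word us)"
  shows "foldr T us (xpow l) = cst (dir_coeff l us) * xpow (perm_act (sym_word us) l)"
  using us
proof (induction us)
  case Nil
  then show ?case using perm_act_id[of l] by (simp add: id_def)
next
  case (Cons i us)
  let ?v = "sym_word us"
  have i: "1 \<le> i" "i < r" and us: "set us \<subseteq> {1..<r}" using Cons.prems by auto
  have v: "?v permutes {1..r}" by (rule sym_word_permutes[OF us])
  then have bv: "bij ?v" and pv: "inv ?v permutes {1..r}" by (auto intro: permutes_bij permutes_inv)
  have "inv (simple_refl i \<circ> ?v) = inv ?v \<circ> simple_refl i"
    using bv by (simp add: o_inv_distrib del: o_apply)
  moreover have "(simple_refl i \<circ> ?v) permutes {1..r}"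
    by (rule permutes_compose[OF v simple_refl_permutes[OF i]])
  ultimately have inv: "inv_num r (simple_refl i \<circ> ?v) = inv_num r (inv ?v \<circ> simple_refl i)"
    using inv_num_inv by metis
  have len: "Suc (length us) = inv_num r (inv ?v \<circ> simple_refl i)"
    using Cons.prems(2) inv by (simp add: sym_word_Cons del: o_apply)
  have le: "inv_num r (inv ?v) \<le> length us"
    using inv_num_le_length[OF us] inv_num_inv[OF v] by simp
  \<comment> \<open>The letter is added on the left, so reducedness is read off as an ascent of the
    inverse permutation.\<close>
  have asc: "inv ?v i < inv ?v (i + 1)"
  proof (rule ccontr)
    assume "\<not> inv ?v i < inv ?v (i + 1)"
    moreover have "inv ?v i \<noteq> inv ?v (i + 1)"
      using injD[OF permutes_inj[OF pv], of i "i + 1"] by auto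
    ultimately have "inv ?v (i + 1) < inv ?v i" by simp
    from inv_num_descent[OF i this] show False using len le by simp
  qed
  have "length us = inv_num r ?v"
    using inv_num_ascent[OF i asc] len inv_num_inv[OF v] by simp
  note IH = Cons.IH[OF us this]
  let ?a = "lookup l (inv ?v i) - lookup l (inv ?v (i + 1))"
  have in_r: "inv ?v i \<in> {1..r}" "inv ?v (i + 1) \<in> {1..r}"
    using permutes_in_image[OF pv, of i] permutes_in_image[OF pv, of "i + 1"] i by simp_all
  have a: "0 \<le> ?a" "?a \<le> int n"
    using alcove_weights_diff[OF l _ _ , of "inv ?v i" "inv ?v (i + 1)"] asc in_r by auto
  have "lookup (perm_act ?v l) i - lookup (perm_act ?v l) (i + 1) = ?a"
    by (simp add: lookup_perm_act[OF bv])
  then have T: "T i (xpow (perm_act ?v l)) = cst (sig ?a) * xpow (perm_act (simple_refl i) (perm_act ?v l))"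
    using T_small[OF i, of "perm_act ?v l"] a by simp
  have "fold (\<lambda>i. perm_act (simple_refl i)) us (simple_root i) = (eps (inv ?v i) - eps (inv ?v (i + 1)) :: nat \<Rightarrow>\<^sub>0 int)"
    using bij_imp_bij_inv[OF bv]
    by (simp add: fold_perm_act[OF us] simple_root_def perm_act_diff perm_act_eps)
  then have "ip r l (fold (\<lambda>i. perm_act (simple_refl i)) us (simple_root i)) = ?a"
    using ip_eps_diff[OF in_r] by simp
  then have c: "dir_coeff l (i # us) = sig ?a * dir_coeff l us"
    by (simp add: prod.lessThan_Suc_shift del: prod.lessThan_Suc)
  have "foldr T (i # us) (xpow l) = cst (dir_coeff l us) * (cst (sig ?a) * xpow (perm_act (simple_refl i) (perm_act ?v l)))"
    using IH T by (simp add: T_lin)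
  also have "perm_act (simple_refl i) (perm_act ?v l) = perm_act (sym_word (i # us)) l"
    unfolding sym_word_Cons by (rule perm_act_comp[OF bij_simple_refl bv])
  also have "cst (dir_coeff l us) * (cst (sig ?a) * xpow (perm_act (sym_word (i # us)) l)) =
      cst (dir_coeff l (i # us)) * xpow (perm_act (sym_word (i # us)) l)"
    unfolding c cst_mult by (simp only: mult_ac)
  finally show ?case .
qed

lemma X_aff_alcove:
  assumes "l \<in> alcove_weights r n" "snd A permutes {1..r}" "sym_reduced r (snd A) us"
  shows "X_aff A (xpow l) = cst (dir_coeff l us) * xpow (scale (int n) (fst A) + perm_act (snd A) l)"
proof -
  have us: "set us \<subseteq> {1..<r}" "length us = inv_num r (sym_word us)" "sym_word us = snd A"
    using assms(2,3) by (auto simp: sym_reduced_iff)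
  have "Tp (snd A) (xpow l) = cst (dir_coeff l us) * xpow (perm_act (snd A) l)"
    using T_perm_reduced[OF assms(2,3)] foldr_T_alcove[OF assms(1) us(1,2)] us(3) by simp
  then show ?thesis
    unfolding X_aff_def xpow_add by (simp only: mult_ac)
qed

abbreviation fold_coeff :: "(nat \<Rightarrow>\<^sub>0 int) \<Rightarrow> nat list \<Rightarrow> aff list \<Rightarrow> 'f" where
  "fold_coeff l ws p \<equiv>
    (\<Prod>j\<in>pos_folds r ws p. (inverse k - k) / (1 - gamma r n k q G (- beta r n ws j) l)) *
    (\<Prod>j\<in>neg_folds r ws p. (inverse k - k) * gamma r n k q G (- beta r n ws j) l /
      (1 - gamma r n k q G (- beta r n ws j) l))"

lemma fold_coeff_Cons:
  fixes l :: "nat \<Rightarrow>\<^sub>0 int" and ws :: "nat list"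
  assumes i: "i < r" and A: "snd A permutes {1..r}" "fst A \<in> vectors r"
  defines "c \<equiv> (inverse k - k) / (1 - step_coeff i ws l)"
  shows "fold_coeff l (i # ws) (A # p) =
    (if p ! 0 = A then if ascending A i then c else c * step_coeff i ws l else 1) * fold_coeff l ws p"
proof -
  have fin: "finite (folds ws p)" by (simp add: folds_def)
  then have fin: "finite (pos_folds r ws p)" "finite (neg_folds r ws p)"
    by (simp_all add: pos_folds_def neg_folds_def)
  have ge1: "1 \<le> j" if "j \<in> pos_folds r ws p \<or> j \<in> neg_folds r ws p" for j
    using that by (auto simp: pos_folds_def neg_folds_def folds_def)
  have b1: "gamma r n k q G (- beta r n (i # ws) 1) l = step_coeff i ws l"
    by (simp add: beta_def step_coeff_def One_nat_def)
  \<comment> \<open>Stated for an arbitrary function \<open>h\<close> so that it serves both the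
    product over positive folds and that over negative folds.\<close>
  have pr: "(\<Prod>j\<in>(if P then {1} else {}) \<union> Suc ` S. h (gamma r n k q G (- beta r n (i # ws) j) l)) =
      (if P then h (step_coeff i ws l) else 1) * (\<Prod>j\<in>S. h (gamma r n k q G (- beta r n ws j) l))"
    if "finite S" "\<And>j. j \<in> S \<Longrightarrow> 1 \<le> j" for P S and h :: "'f \<Rightarrow> 'f"
  proof -
    have "(\<Prod>j\<in>Suc ` S. h (gamma r n k q G (- beta r n (i # ws) j) l)) =
        (\<Prod>j\<in>S. h (gamma r n k q G (- beta r n ws j) l))"
      using that(2) by (subst prod.reindex) (auto simp: beta_Cons intro!: prod.cong)
    moreover have "1 \<notin> Suc ` S" using that(2) by (force simp: One_nat_def)
    ultimately show ?thesis using that(1) b1 by simp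
  qed
  note P = pr[where h = "\<lambda>g. (inverse k - k) / (1 - g)"]
    and N = pr[where h = "\<lambda>g. (inverse k - k) * g / (1 - g)"]
  show ?thesis
    unfolding pos_folds_Cons[OF r_ge_2 i A] neg_folds_Cons[OF r_ge_2 i A] ascending_def[symmetric]
    using fin ge1 by (subst P, simp, blast, subst N, simp, blast) (simp add: c_def)
qed

end

section \<open>Expansion into alcove walks\<close>

context generic_metaplectic
begin

text \<open>Each factor \<open>T_i + c\<close> either crosses or folds. On the positive side
  \<open>T_i\<close> crosses and \<open>c\<close> is the fold weight. On the negative side
  \<open>T_i + c = T_i^-1 + (c + k - k^-1)\<close>; the inverse crosses, and
  \<open>c + k - k^-1 = c \<gamma>\<close> is the weight of the negative fold.\<close>

lemma walk_expansion:
  assumes ws: "set ws \<subseteq> {0..<r}" "moves ws l" and A: "snd A permutes {1..r}" "fst A \<in> vectors r"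
  shows "X_aff A (intertwined ws l) =
    (\<Sum>p\<in>walks r A ws. cst (fold_coeff l ws p) * X_aff (last p) (xpow l))"
  using assms
proof (induction ws arbitrary: A)
  case Nil
  have "pos_folds r [] [A] = {}" "neg_folds r [] [A] = {}"
    by (auto simp: pos_folds_def neg_folds_def folds_def)
  then show ?case by (simp add: walks_Nil)
next
  case (Cons i ws)
  let ?B = "aff_mult A (aff_gen r 1 i)" and ?e = "intertwined ws l" and ?\<gamma> = "step_coeff i ws l"
  define c where "c = (inverse k - k) / (1 - ?\<gamma>)"
  have i: "i < r" and ws: "set ws \<subseteq> {0..<r}" "moves ws l" using Cons.prems by auto
  have B: "snd ?B permutes {1..r}" "fst ?B \<in> vectors r"
    using Cons.prems(3,4) aff_gen_props[OF r_ge_2 i] by (auto intro: aff_mult_props)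
  have AB: "?B \<noteq> A" by (rule aff_mult_gen_neq[OF r_ge_2 i Cons.prems(3)])
  have \<gamma>1: "?\<gamma> \<noteq> 1" using step_coeff_generic[OF Cons.prems(1,2)] M_one by auto
  then have "c * (1 - ?\<gamma>) = inverse k - k"
    by (simp add: c_def)
  then have c\<gamma>: "c * ?\<gamma> = c + (k - inverse k)"
    by (simp add: algebra_simps)
  define d where "d = (if ascending A i then c else c * ?\<gamma>)"
  have X: "X_aff A (intertwined (i # ws) l) = X_aff ?B ?e + cst d * X_aff A ?e"
  proof (cases "ascending A i")
    case True
    then show ?thesis
      using X_aff_step(1)[OF Cons.prems(3) i]
      by (simp add: linop_add[OF linop_X_aff] linop_cst[OF linop_X_aff] c_def d_def)
  next
    case False
    then have "cst d * ?e = cst c * ?e + hk * ?e"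
      by (simp only: d_def c\<gamma> cst_add distrib_right if_False)
    then have "intertwined (i # ws) l = (T_aff i ?e - hk * ?e) + cst d * ?e"
      by (simp add: c_def)
    then show ?thesis
      using X_aff_step(2)[OF Cons.prems(3) i False]
      by (simp add: linop_add[OF linop_X_aff] linop_cst[OF linop_X_aff] del: intertwined.simps)
  qed
  have step: "cst (fold_coeff l (i # ws) (A # p)) * X_aff (last (A # p)) (xpow l) =
      cst (if p ! 0 = A then d else 1) * (cst (fold_coeff l ws p) * X_aff (last p) (xpow l))"
    if "p \<noteq> []" for p
    using that unfolding fold_coeff_Cons[OF i Cons.prems(3,4)] cst_mult
    by (simp add: d_def c_def mult.assoc)
  \<comment> \<open>The tails after a fold and after a crossing are told apart by their first
    alcove, because \<open>A\<close> and \<open>A s_i\<close> differ.\<close>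
  have disj: "walks r A ws \<inter> walks r ?B ws = {}"
  proof (rule equals0I)
    fix p assume "p \<in> walks r A ws \<inter> walks r ?B ws"
    then have "p ! 0 = A" "p ! 0 = ?B"
      using walks_hd[of p r A ws] walks_hd[of p r ?B ws] by simp_all
    then show False using AB by simp
  qed
  have "(\<Sum>p\<in>walks r A (i # ws). cst (fold_coeff l (i # ws) p) * X_aff (last p) (xpow l)) =
      (\<Sum>p\<in>walks r A ws \<union> walks r ?B ws.
        cst (fold_coeff l (i # ws) (A # p)) * X_aff (last (A # p)) (xpow l))"
    unfolding walks_Cons by (subst sum.reindex) auto
  also have "\<dots> = (\<Sum>p\<in>walks r A ws. cst (fold_coeff l (i # ws) (A # p)) * X_aff (last (A # p)) (xpow l)) +
      (\<Sum>p\<in>walks r ?B ws. cst (fold_coeff l (i # ws) (A # p)) * X_aff (last (A # p)) (xpow l))"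
    by (rule sum.union_disjoint[OF finite_walks finite_walks disj])
  also have "(\<Sum>p\<in>walks r A ws. cst (fold_coeff l (i # ws) (A # p)) * X_aff (last (A # p)) (xpow l)) =
      (\<Sum>p\<in>walks r A ws. cst d * (cst (fold_coeff l ws p) * X_aff (last p) (xpow l)))"
  proof (rule sum.cong)
    fix p assume "p \<in> walks r A ws"
    then have "p \<noteq> []" "p ! 0 = A" using walks_hd[of p r A ws] by simp_all
    then show "cst (fold_coeff l (i # ws) (A # p)) * X_aff (last (A # p)) (xpow l) =
        cst d * (cst (fold_coeff l ws p) * X_aff (last p) (xpow l))"
      unfolding step[OF \<open>p \<noteq> []\<close>] by simp
  qed simp
  also have "\<dots> = cst d * X_aff A ?e"
    unfolding Cons.IH[OF ws Cons.prems(3,4)] sum_distrib_left by simp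
  also have "(\<Sum>p\<in>walks r ?B ws. cst (fold_coeff l (i # ws) (A # p)) * X_aff (last (A # p)) (xpow l)) =
      (\<Sum>p\<in>walks r ?B ws. cst (fold_coeff l ws p) * X_aff (last p) (xpow l))"
  proof (rule sum.cong)
    fix p assume "p \<in> walks r ?B ws"
    then have "p \<noteq> []" "p ! 0 \<noteq> A" using walks_hd[of p r ?B ws] AB by simp_all
    then show "cst (fold_coeff l (i # ws) (A # p)) * X_aff (last (A # p)) (xpow l) =
        cst (fold_coeff l ws p) * X_aff (last p) (xpow l)"
      unfolding step[OF \<open>p \<noteq> []\<close>] by simp
  qed simp
  also have "\<dots> = X_aff ?B ?e"
    by (rule Cons.IH[OF ws B, symmetric])
  finally show ?case unfolding X by (simp add: add.commute)
qed

text \<open>For the alcove \<open>(0, u)\<close> the operator \<open>X_aff\<close> is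
  \<open>T_u\<close>, so the expansion applies to each summand of \<open>P_poly\<close>. The scalar
  is the inverse of the coefficient at \<open>\<mu>\<close> of the unnormalised eigenvector.\<close>

lemma P_poly_expansion:
  assumes l: "l \<in> alcove_weights r n" and ws: "set ws \<subseteq> {0..<r}" "moves ws l"
    and \<mu>: "act ws l = \<mu>" "\<mu> \<in> vectors r"
    and red: "\<forall>u\<in>sym_group r. \<forall>p\<in>walks r (0, u) ws. sym_reduced r (final_dir p) (red p)"
  shows "\<exists>c. c \<noteq> 0 \<and>
    P_poly r n k q G \<mu> =
      scale c (\<Sum>u\<in>sym_group r. scale (k ^ sym_length r u)
        (\<Sum>p\<in>walks r (0, u) ws.
           scale (walk_coeff r n k q G l ws (red p) p)
             (xpow (scale (int n) (wt p) + perm_act (final_dir p) l))))"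
proof -
  define e where "e = intertwined ws l"
  have e: "eigen e (Y_weight \<mu>)" "e \<noteq> 0" "e \<in> lp"
    using intertwined_eigen[OF l ws] \<mu> by (auto simp: e_def)
  define d where "d = inverse (lookup e \<mu>)"
  have E: "E_poly r n k q G \<mu> = cst d * e" and d: "d \<noteq> 0"
    using E_poly_eq[OF \<mu>(2) e] by (auto simp: d_def)
  have walk: "X_aff (0, u) e = (\<Sum>p\<in>walks r (0, u) ws.
      scale (walk_coeff r n k q G l ws (red p) p) (xpow (scale (int n) (wt p) + perm_act (final_dir p) l)))"
    if u: "u \<in> sym_group r" for u
  proof -
    have "X_aff (0, u) e = (\<Sum>p\<in>walks r (0, u) ws. cst (fold_coeff l ws p) * X_aff (last p) (xpow l))"
      unfolding e_def using u by (intro walk_expansion ws) (auto simp: vectors_def)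
    also have "\<dots> = (\<Sum>p\<in>walks r (0, u) ws.
        scale (walk_coeff r n k q G l ws (red p) p) (xpow (scale (int n) (wt p) + perm_act (final_dir p) l)))"
    proof (rule sum.cong)
      fix p assume p: "p \<in> walks r (0, u) ws"
      have "X_aff (last p) (xpow l) =
          cst (dir_coeff l (red p)) * xpow (scale (int n) (wt p) + perm_act (final_dir p) l)"
        unfolding wt_def final_dir_def
      proof (rule X_aff_alcove[OF l])
        show "snd (last p) permutes {1..r}"
          using walks_last[OF r_ge_2 ws(1) _ p] u by simp
        show "sym_reduced r (snd (last p)) (red p)"
          using red u p by (auto simp: final_dir_def)
      qed
      then show "cst (fold_coeff l ws p) * X_aff (last p) (xpow l) =
          scale (walk_coeff r n k q G l ws (red p) p) (xpow (scale (int n) (wt p) + perm_act (final_dir p) l))"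
        unfolding walk_coeff_def scale_laurent cst_mult by (simp only: mult_ac)
    qed simp
    finally show ?thesis .
  qed
  have "Tp u (cst d * e) = cst d * X_aff (0, u) e" for u
  proof -
    have "scale (int n) (0 :: nat \<Rightarrow>\<^sub>0 int) = 0" by (intro poly_mapping_eqI) simp
    then show ?thesis by (simp add: X_aff_def linop_cst[OF linop_T_perm])
  qed
  then have "P_poly r n k q G \<mu> = scale d (\<Sum>u\<in>sym_group r. scale (k ^ sym_length r u) (X_aff (0, u) e))"
    unfolding P_poly_def E scale_laurent sum_distrib_left
    by (intro sum.cong) (simp_all only: mult.left_commute)
  also have "(\<Sum>u\<in>sym_group r. scale (k ^ sym_length r u) (X_aff (0, u) e)) =
      (\<Sum>u\<in>sym_group r. scale (k ^ sym_length r u)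
        (\<Sum>p\<in>walks r (0, u) ws.
           scale (walk_coeff r n k q G l ws (red p) p)
             (xpow (scale (int n) (wt p) + perm_act (final_dir p) l))))"
    using walk by (intro sum.cong) (simp_all only:)
  finally show ?thesis using d by blast
qed

end

subsection \<open>Words of minimal length\<close>

lemma scale_add_right: "scale c (u + v) = scale c u + (scale c v :: _ \<Rightarrow>\<^sub>0 int)"
  by (intro poly_mapping_eqI) (simp add: lookup_add algebra_simps)

lemma finite_roots: "finite (roots r :: (nat \<Rightarrow>\<^sub>0 int) set)"
proof -
  have "(roots r :: (nat \<Rightarrow>\<^sub>0 int) set) \<subseteq> (\<lambda>(i, j). eps i - eps j) ` ({1..r} \<times> {1..r})"
    unfolding roots_def by auto
  then show ?thesis by (rule finite_subset) simp
qed

lemma root_lattice_zero: "0 \<in> root_lattice r"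
  unfolding root_lattice_def by (intro CollectI exI[of _ "\<lambda>_. 0"]) simp

lemma root_lattice_add:
  assumes "u \<in> root_lattice r" "v \<in> root_lattice r"
  shows "u + v \<in> root_lattice r"
proof -
  obtain c d where "u = (\<Sum>\<alpha>\<in>roots r. scale (c \<alpha>) \<alpha>)" "v = (\<Sum>\<alpha>\<in>roots r. scale (d \<alpha>) \<alpha>)"
    using assms unfolding root_lattice_def by blast
  then have "u + v = (\<Sum>\<alpha>\<in>roots r. scale (c \<alpha> + d \<alpha>) \<alpha>)"
    by (simp add: scale_add_left sum.distrib)
  then show ?thesis unfolding root_lattice_def by (intro CollectI exI[of _ "\<lambda>\<alpha>. c \<alpha> + d \<alpha>"]) simp
qed

lemma root_lattice_sum: "(\<And>i. i \<in> I \<Longrightarrow> f i \<in> root_lattice r) \<Longrightarrow> (\<Sum>i\<in>I. f i) \<in> root_lattice r"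
  by (induction I rule: infinite_finite_induct) (auto simp: root_lattice_zero root_lattice_add)

lemma root_lattice_root:
  assumes "\<alpha> \<in> roots r"
  shows "scale c \<alpha> \<in> root_lattice r"
proof -
  have "(\<Sum>\<beta>\<in>roots r. scale (if \<beta> = \<alpha> then c else 0) \<beta>) = (\<Sum>\<beta>\<in>roots r. if \<beta> = \<alpha> then scale c \<alpha> else 0)"
    by (rule sum.cong) auto
  also have "\<dots> = scale c \<alpha>" using assms finite_roots by simp
  finally show ?thesis
    unfolding root_lattice_def by (intro CollectI exI[of _ "\<lambda>\<beta>. if \<beta> = \<alpha> then c else 0"]) simp
qed

lemma perm_act_root_lattice:
  assumes "w permutes {1..r}" "v \<in> root_lattice r"
  shows "perm_act w v \<in> root_lattice r"
proof -
  have b: "bij w" by (rule permutes_bij[OF assms(1)])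
  obtain c where v: "v = (\<Sum>\<alpha>\<in>roots r. scale (c \<alpha>) \<alpha>)"
    using assms unfolding root_lattice_def by blast
  have "perm_act w (\<Sum>\<alpha>\<in>S. scale (c \<alpha>) \<alpha>) = (\<Sum>\<alpha>\<in>S. scale (c \<alpha>) (perm_act w \<alpha>))"
    for S :: "(nat \<Rightarrow>\<^sub>0 int) set"
    by (intro poly_mapping_eqI) (simp add: lookup_perm_act[OF b] lookup_sum)
  moreover have "perm_act w \<alpha> \<in> roots r" if \<alpha>: "\<alpha> \<in> roots r" for \<alpha> :: "nat \<Rightarrow>\<^sub>0 int"
  proof -
    obtain i j where ij: "\<alpha> = eps i - eps j" "i \<in> {1..r}" "j \<in> {1..r}" "i \<noteq> j"
      using \<alpha> unfolding roots_def by blast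
    have "w i \<in> {1..r}" "w j \<in> {1..r}" using permutes_in_image[OF assms(1)] ij by blast+
    moreover have "w i \<noteq> w j" using ij injD[OF permutes_inj[OF assms(1)]] by blast
    ultimately show ?thesis
      unfolding ij(1) perm_act_diff[OF b] perm_act_eps[OF b] roots_def by blast
  qed
  ultimately show ?thesis
    unfolding v by (auto intro!: root_lattice_sum root_lattice_root)
qed

lemma aff_word_Cons: "aff_word r n (i # ws) = aff_mult (aff_gen r n i) (aff_word r n ws)"
  by (simp add: aff_word_def)

text \<open>Makes a shortened word eligible for the minimality hypothesis, which ranges over
  \<open>aff_group\<close>.\<close>

lemma aff_word_in_group:
  assumes "r \<ge> 2" "set ws \<subseteq> {0..<r}"
  shows "aff_word r n ws \<in> aff_group r n"
  using assms(2)
proof (induction ws)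
  case Nil
  have "0 = scale (int n) (0 :: nat \<Rightarrow>\<^sub>0 int)" by (intro poly_mapping_eqI) simp
  then show ?case
    using root_lattice_zero[of r] permutes_id[of "{1..r}"]
    by (simp add: aff_word_def aff_group_def id_def image_iff) metis
next
  case (Cons i ws)
  then obtain \<beta> w where w: "aff_word r n ws = (scale (int n) \<beta>, w)" "\<beta> \<in> root_lattice r" "w permutes {1..r}"
    by (auto simp: aff_group_def)
  let ?g = "snd (aff_gen r n i)"
  have g: "?g permutes {1..r}" using aff_gen_props[OF assms(1)] Cons.prems by simp
  have "highest_root r \<in> (roots r :: (nat \<Rightarrow>\<^sub>0 int) set)"
    unfolding roots_def highest_root_def using assms(1) by force
  then have "scale 1 (highest_root r) \<in> root_lattice r" by (rule root_lattice_root)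
  moreover have "fst (aff_gen r n i) = scale (int n) (if i = 0 then highest_root r else 0)"
    by (auto simp: aff_gen_def intro: poly_mapping_eqI)
  ultimately obtain \<beta>' where \<beta>': "fst (aff_gen r n i) = scale (int n) \<beta>'" "\<beta>' \<in> root_lattice r"
    using root_lattice_zero by (metis scale_one)
  have "aff_word r n (i # ws) = (scale (int n) (\<beta>' + perm_act ?g \<beta>), ?g \<circ> w)"
    unfolding aff_word_Cons w(1) aff_mult_def fst_conv snd_conv \<beta>'(1)
    using permutes_bij[OF g] by (simp add: perm_act_scale scale_add_right)
  moreover have "\<beta>' + perm_act ?g \<beta> \<in> root_lattice r"
    by (intro root_lattice_add \<beta>' perm_act_root_lattice g w)
  moreover have "(?g \<circ> w) permutes {1..r}" by (rule permutes_compose[OF w(3) g])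
  ultimately show ?case
    by (simp only: aff_group_def mem_Sigma_iff mem_Collect_eq) blast
qed

context metaplectic
begin

lemma aff_act_word:
  assumes "set ws \<subseteq> {0..<r}"
  shows "aff_act (aff_word r n ws) v = act ws v"
  using assms
proof (induction ws)
  case Nil
  have "Poly_Mapping.map of_int 0 = (0 :: nat \<Rightarrow>\<^sub>0 int)"
    by (intro poly_mapping_eqI) (simp only: lookup_map_of_int lookup_zero of_int_0)
  then show ?case by (simp add: aff_word_def aff_act_def)
next
  case (Cons i ws)
  have "snd (aff_word r n ws) permutes {1..r}"
    using aff_word_in_group[OF r_ge_2, of ws n] Cons.prems by (auto simp: aff_group_def)
  then have "bij (snd (aff_word r n ws))" by (rule permutes_bij)
  then show ?case
    using Cons by (simp add: aff_word_Cons aff_act_mult[OF bij_aff_gen])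
qed

lemma act_delete_fixed:
  assumes "\<not> moves ws v"
  shows "\<exists>ws'. set ws' \<subseteq> set ws \<and> length ws' < length ws \<and> act ws' v = act ws v"
  using assms
proof (induction ws)
  case (Cons i ws)
  show ?case
  proof (cases "moves ws v")
    case True
    then have "act ws v = act (i # ws) v" using Cons.prems by simp
    then show ?thesis by (intro exI[of _ ws]) auto
  next
    case False
    then obtain ws' where "set ws' \<subseteq> set ws" "length ws' < length ws" "act ws' v = act ws v"
      using Cons.IH by blast
    then show ?thesis by (intro exI[of _ "i # ws'"]) auto
  qed
qed simp

text \<open>A dropped letter would give another group element sending \<open>l\<close> to
  \<open>\<mu>\<close>, of smaller length than \<open>w\<close>.\<close>

lemma minimal_word_moves:
  assumes red: "aff_reduced r n w ws" and w: "aff_act w l = \<mu>"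
    and min: "\<forall>w'\<in>aff_group r n. aff_act w' l = \<mu> \<longrightarrow> aff_length r n w \<le> aff_length r n w'"
  shows "moves ws l"
proof (rule ccontr)
  assume "\<not> moves ws l"
  then obtain ws' where ws': "set ws' \<subseteq> set ws" "length ws' < length ws" "act ws' l = act ws l"
    using act_delete_fixed by blast
  have ws: "set ws \<subseteq> {0..<r}" "aff_word r n ws = w" "length ws = aff_length r n w"
    using red by (auto simp: aff_reduced_def reduced_word_def aff_length_def)
  have s: "set ws' \<subseteq> {0..<r}" using ws ws' by blast
  have "aff_act (aff_word r n ws') l = \<mu>"
    using aff_act_word[OF s] aff_act_word[OF ws(1)] ws(2) ws'(3) w by simp
  then have "aff_length r n w \<le> aff_length r n (aff_word r n ws')"
    using min aff_word_in_group[OF r_ge_2 s] by blast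
  also have "\<dots> \<le> length ws'"
    unfolding aff_length_def cox_length_def using s by (intro Least_le) blast
  finally show False using ws ws' by simp
qed

end

theorem theorem4p6:
  fixes r n :: nat
    and k q :: "'f::field" and G :: "int \<Rightarrow> 'f"
    and \<mu> lam :: "nat \<Rightarrow>\<^sub>0 int"
    and w :: aff and ws :: "nat list"
    and red :: "aff list \<Rightarrow> nat list"
  assumes "r \<ge> 2" and "n \<ge> 1"
    and "metaplectic_parameters n k q G"
    and "\<mu> \<in> vectors r" and "dominant r \<mu>"
    and "lam \<in> alcove_weights r n" and "w \<in> aff_group r n" and "aff_act w lam = \<mu>"
    and "\<forall>w'\<in>aff_group r n. aff_act w' lam = \<mu> \<longrightarrow> aff_length r n w \<le> aff_length r n w'"
    and "aff_reduced r n w ws"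
    and "\<forall>u\<in>sym_group r. \<forall>p\<in>walks r (0, u) ws. sym_reduced r (final_dir p) (red p)"
  shows "\<exists>c. c \<noteq> 0 \<and>
    P_poly r n k q G \<mu> =
      scale c (\<Sum>u\<in>sym_group r. scale (k ^ sym_length r u)
        (\<Sum>p\<in>walks r (0, u) ws.
           scale (walk_coeff r n k q G lam ws (red p) p)
             (xpow (scale (int n) (wt p) + perm_act (final_dir p) lam))))"
proof -
  obtain M where "generic_metaplectic r n k q G M"
    using generic_metaplectic_exists[OF assms(1-3)] by blast
  then interpret generic_metaplectic r n k q G M .
  have ws: "set ws \<subseteq> {0..<r}" "aff_word r n ws = w"
    using assms(10) by (auto simp: aff_reduced_def reduced_word_def)
  have "moves ws lam" by (rule minimal_word_moves[OF assms(10,8,9)])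
  moreover have "act ws lam = \<mu>" using aff_act_word[OF ws(1)] ws(2) assms(8) by simp
  ultimately show ?thesis
    using P_poly_expansion[OF assms(6) ws(1)] assms(4,11) by blast
qed

end
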